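(* Let $1<k\le n$ and let $\|\cdot\|_{(k)}$ be the Ky-Fan $k$-norm on $\mathbb{M}_n(\mathbb{R})$. Assume $T\colon\mathbb{M}_n(\mathbb{R})\to\mathbb{M}_n(\mathbb{R})$ is a linear bijection such that, for all $A,B\in\mathbb{M}_n(\mathbb{R})$, $\|A+B\|_{(k)}=\|A\|_{(k)}+\|B\|_{(k)}$ implies $\|T(A)+T(B)\|_{(k)}=\|T(A)\|_{(k)}+\|T(B)\|_{(k)}$. Then $T$ is a scalar multiple of a linear isometry of $(\mathbb{M}_n(\mathbb{R}),\|\cdot\|_{(k)})$, and hence takes one of the following forms: there exist $\gamma>0$ and orthogonal $U,V\in\mathbb{M}_n(\mathbb{R})$ such that $T$ is $X\mapsto\gamma UXV$ or $X\mapsto\gamma UX^tV$; or $(k,n)=(2,4)$ and there exist $\gamma>0$ and orthogonal $U,V,P\in\mathbb{M}_4(\mathbb{R})$ such that $T$ is $X\mapsto\gamma P\,\mathbb{L}(UXV)$ or $X\mapsto\gamma P\,\mathbb{L}(UX^tV)$, where $\mathbb{L}$ is the specific linear map on $\mathbb{M}_4(\mathbb{R})$ defined in the context.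
   Context: $\mathbb{M}_n(\mathbb{R})$ is the space of $n\times n$ real matrices and $X^t$ is the transpose of $X$. For $A\in\mathbb{M}_n(\mathbb{R})$, $s_1(A)\ge\cdots\ge s_n(A)$ are its singular values, and $\|A\|_{(k)}=s_1(A)+\cdots+s_k(A)$. The map $\mathbb{L}\colon\mathbb{M}_4(\mathbb{R})\to\mathbb{M}_4(\mathbb{R})$ is $$\mathbb{L}(X)=\tfrac12\bigl(X+B_1XC_1+B_2XC_2+B_3XC_3\bigr),$$ where ($\otimes$ being the Kronecker product) $$B_1=\begin{pmatrix}1&0\\0&1\end{pmatrix}\otimes\begin{pmatrix}0&-1\\1&0\end{pmatrix},\quad C_1=\begin{pmatrix}1&0\\0&-1\end{pmatrix}\otimes\begin{pmatrix}0&1\\-1&0\end{pmatrix},$$ $$B_2=\begin{pmatrix}0&1\\-1&0\end{pmatrix}\otimes\begin{pmatrix}-1&0\\0&1\end{pmatrix},\quad C_2=\begin{pmatrix}0&1\\-1&0\end{pmatrix}\otimes\begin{pmatrix}1&0\\0&1\end{pmatrix},$$ $$B_3=\begin{pmatrix}0&-1\\1&0\end{pmatrix}\otimes\begin{pmatrix}0&1\\1&0\end{pmatrix},\quad C_3=\begin{pmatrix}0&1\\1&0\end{pmatrix}\otimes\begin{pmatrix}0&1\\-1&0\end{pmatrix}.$$ *)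

theory Defs
  imports "HOL-Analysis.Analysis" "HOL-Computational_Algebra.Computational_Algebra"
begin

definition charpoly :: "real ^ 'n ^ 'n \<Rightarrow> real poly" where
  "charpoly A = det (mat [:0, 1:] - (\<chi> i j. [:A $ i $ j:]))"

text \<open>The square roots of the eigenvalues of \<open>A\<^sup>t A\<close>, repeated according to multiplicity,
  in decreasing order.\<close>

definition singular_values :: "real ^ 'n ^ 'n \<Rightarrow> real list" where
  "singular_values A =
     rev (sorted_list_of_multiset (image_mset sqrt (proots (charpoly (transpose A ** A)))))"

definition ky_fan :: "nat \<Rightarrow> real ^ 'n ^ 'n \<Rightarrow> real" where
  "ky_fan k A = sum_list (take k (singular_values A))"

definition kronecker ::
    "real ^ 'b ^ 'a \<Rightarrow> real ^ 'd ^ 'c \<Rightarrow> real ^ ('b \<times> 'd) ^ ('a \<times> 'c)" (infixl "\<otimes>\<^sub>K" 75) where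
  "A \<otimes>\<^sub>K B = (\<chi> i j. A $ fst i $ fst j * B $ snd i $ snd j)"

definition mat2 :: "real \<Rightarrow> real \<Rightarrow> real \<Rightarrow> real \<Rightarrow> real ^ 2 ^ 2" where
  "mat2 a b c d = vector [vector [a, b], vector [c, d]]"

text \<open>Real \<open>4 \<times> 4\<close> matrices, with rows and columns indexed by the pairs
  \<open>(1,1), (1,2), (2,1), (2,2)\<close>.\<close>

type_synonym mat4 = "real ^ (2 \<times> 2) ^ (2 \<times> 2)"

definition B1 :: mat4 where "B1 = mat2 1 0 0 1 \<otimes>\<^sub>K mat2 0 (-1) 1 0"
definition C1 :: mat4 where "C1 = mat2 1 0 0 (-1) \<otimes>\<^sub>K mat2 0 1 (-1) 0"
definition B2 :: mat4 where "B2 = mat2 0 1 (-1) 0 \<otimes>\<^sub>K mat2 (-1) 0 0 1"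
definition C2 :: mat4 where "C2 = mat2 0 1 (-1) 0 \<otimes>\<^sub>K mat2 1 0 0 1"
definition B3 :: mat4 where "B3 = mat2 0 (-1) 1 0 \<otimes>\<^sub>K mat2 0 1 1 0"
definition C3 :: mat4 where "C3 = mat2 0 1 1 0 \<otimes>\<^sub>K mat2 0 1 (-1) 0"

definition LL :: "mat4 \<Rightarrow> mat4" where
  "LL X = (1 / 2) *\<^sub>R (X + B1 ** X ** C1 + B2 ** X ** C2 + B3 ** X ** C3)"

definition reindex :: "('m \<Rightarrow> 'n) \<Rightarrow> real ^ 'n ^ 'n \<Rightarrow> real ^ 'm ^ 'm" where
  "reindex f X = (\<chi> i j. X $ f i $ f j)"

text \<open>The map \<open>LL\<close> read on matrices over an arbitrary index type of cardinality \<open>4\<close>, through a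
  numbering \<open>e\<close> of the rows and columns by \<open>(1,1), (1,2), (2,1), (2,2)\<close>.\<close>

definition LL_on :: "('n \<Rightarrow> 2 \<times> 2) \<Rightarrow> real ^ 'n ^ 'n \<Rightarrow> real ^ 'n ^ 'n" where
  "LL_on e X = reindex e (LL (reindex (inv e) X))"

end

theory Submission
  imports Defs
begin

text \<open>The Ky-Fan norm is the support function of the partial isometries of rank \<open>k\<close>, so it is additive
  on \<open>A, B\<close> iff one such \<open>Z\<close> attains the norms of both.

  If \<open>k \<ge> n - 1\<close>, the additive partners of \<open>A \<noteq> 0\<close> span the whole space exactly when \<open>A\<close> has rank one.
  Hence \<open>T\<close> preserves rank one matrices and is \<open>X \<mapsto> A X B\<close> or \<open>X \<mapsto> A X\<^sup>T B\<close>; additivity on pairs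
  \<open>u v\<^sup>T, \<plusminus> x y\<^sup>T\<close> with \<open>u \<bottom> x\<close>, \<open>v \<bottom> y\<close> makes \<open>A\<close> and \<open>B\<close> preserve orthogonality.

  If \<open>k \<le> n - 2\<close>, the function \<open>A \<mapsto> ky_fan k (T A)\<close> is additive wherever \<open>ky_fan k\<close> is, and this rigidity makes it
  a multiple of \<open>ky_fan k\<close>. The resulting isometry preserves the matrices that admit no additive decomposition into
  non-proportional summands; they are the rank one matrices and multiples of orthogonal matrices. So the rank one
  matrices all go to rank one matrices, or all go to multiples of orthogonal matrices. In the second case counting
  dimensions gives \<open>n = 4\<close>, \<open>k = 2\<close>, and composition with \<open>LL\<close> and an orthogonal matrix leads back to the first one.\<close>

unbundle no Formal_Power_Series.fps_syntax

section \<open>Outer products and reflections\<close>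

text \<open>Additivity is seen only through the supporting partial isometries of rank k, and this
  separates the two ranges of k. If k \<ge> n - 1, such an isometry has a kernel of dimension at
  most one; it is then rigid enough to impose a linear equation on all partners of a matrix with two
  nonzero singular values. If k \<le> n - 2, kernel vectors need not be collinear and this fails,
  but now a leading set of k singular values leaves two positions free, and moving entries there
  determines the pulled back norm on diagonal matrices. In that range T is known to be a multiple of
  an isometry before its form is known; in the first range the isometry is read off from the form.

  Spanning statements are used dually: a matrix orthogonal to a family vanishes, and adjoints carry
  this through T. The exceptional case is bounded by comparing the n(n - 1)/2 skew-symmetric
  directions with the 2n - 1 dimensions of a row and a column, which gives n \<le> 4, while 4 \<le>
  k + 2 \<le> n leaves n = 4 and k = 2.\<close>

definition outer :: "real^'m \<Rightarrow> real^'n \<Rightarrow> real^'n^'m" where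
  "outer u v = (\<chi> i j. u $ i * v $ j)"

definition diag :: "real^'n \<Rightarrow> real^'n^'n" where
  "diag d = (\<chi> i j. if i = j then d $ i else 0)"

lemma inner_matrix: "A \<bullet> B = (\<Sum>i\<in>UNIV. \<Sum>j\<in>UNIV. A $ i $ j * B $ i $ j)" for A B :: "real^'n^'m"
  by (simp add: inner_vec_def)

lemma inner_mult_left_matrix: "(U ** A) \<bullet> B = A \<bullet> (transpose U ** B)"
  for A :: "real^'n^'m" and B :: "real^'n^'p"
proof -
  have "(U ** A) \<bullet> B = (\<Sum>i\<in>UNIV. \<Sum>j\<in>UNIV. \<Sum>l\<in>UNIV. U$i$l * A$l$j * B$i$j)"
    by (simp add: inner_matrix matrix_matrix_mult_def sum_distrib_right)
  also have "\<dots> = (\<Sum>i\<in>UNIV. \<Sum>l\<in>UNIV. \<Sum>j\<in>UNIV. U$i$l * A$l$j * B$i$j)"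
    by (intro sum.cong refl sum.swap)
  also have "\<dots> = (\<Sum>l\<in>UNIV. \<Sum>i\<in>UNIV. \<Sum>j\<in>UNIV. U$i$l * A$l$j * B$i$j)"
    by (rule sum.swap)
  also have "\<dots> = (\<Sum>l\<in>UNIV. \<Sum>j\<in>UNIV. \<Sum>i\<in>UNIV. U$i$l * A$l$j * B$i$j)"
    by (intro sum.cong refl sum.swap)
  also have "\<dots> = A \<bullet> (transpose U ** B)"
    by (simp add: inner_matrix matrix_matrix_mult_def transpose_def sum_distrib_left mult_ac)
  finally show ?thesis .
qed

lemma inner_transpose: "transpose A \<bullet> transpose B = A \<bullet> B" for A B :: "real^'n^'m"
  unfolding inner_matrix transpose_def by (subst sum.swap) simp

lemma inner_transpose': "transpose A \<bullet> B = A \<bullet> transpose B" for A :: "real^'n^'m"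
  using inner_transpose[of A "transpose B"] by simp

lemma inner_mult_right_matrix: "(A ** V) \<bullet> B = A \<bullet> (B ** transpose V)"
  for A :: "real^'p^'m" and B :: "real^'n^'m"
proof -
  have "(A ** V) \<bullet> B = (transpose V ** transpose A) \<bullet> transpose B"
    by (metis inner_transpose matrix_transpose_mul)
  also have "\<dots> = transpose A \<bullet> (V ** transpose B)"
    by (simp only: inner_mult_left_matrix transpose_transpose)
  also have "\<dots> = A \<bullet> (B ** transpose V)"
    by (metis inner_transpose matrix_transpose_mul transpose_transpose)
  finally show ?thesis .
qed

lemma inner_outer: "outer u v \<bullet> A = u \<bullet> (A *v v)"
  by (simp add: inner_matrix outer_def matrix_vector_mult_def inner_vec_def sum_distrib_left mult_ac)

lemma inner_outer_right: "A \<bullet> outer u v = u \<bullet> (A *v v)"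
  by (metis inner_commute inner_outer)

lemma mult_outer: "A ** outer u v = outer (A *v u) v"
  by (simp add: outer_def matrix_matrix_mult_def matrix_vector_mult_def vec_eq_iff sum_distrib_right mult.assoc)

lemma outer_mult: "outer u v ** B = outer u (v v* B)"
  by (simp add: outer_def matrix_matrix_mult_def vector_matrix_mult_def vec_eq_iff sum_distrib_left mult_ac)

lemma transpose_outer: "transpose (outer u v) = outer v u"
  by (simp add: outer_def transpose_def vec_eq_iff mult_ac)

lemma outer_vec: "outer u v *v x = (v \<bullet> x) *\<^sub>R u"
  by (simp add: outer_def matrix_vector_mult_def vec_eq_iff inner_vec_def sum_distrib_left mult_ac)

lemma vec_outer: "x v* outer u v = (u \<bullet> x) *\<^sub>R v"
  by (metis transpose_outer outer_vec transpose_matrix_vector)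

lemma outer_bilinear:
  shows outer_add_left: "outer (u + u') v = outer u v + outer u' v"
    and outer_add_right: "outer u (v + v') = outer u v + outer u v'"
    and outer_diff_left: "outer (u - u') v = outer u v - outer u' v"
    and outer_diff_right: "outer u (v - v') = outer u v - outer u v'"
    and outer_scaleR_left: "outer (c *\<^sub>R u) v = c *\<^sub>R outer u v"
    and outer_scaleR_right: "outer u (c *\<^sub>R v) = c *\<^sub>R outer u v"
    and outer_minus_left: "outer (- u) v = - outer u v"
    and outer_minus_right: "outer u (- v) = - outer u v"
  by (simp_all add: outer_def vec_eq_iff algebra_simps)

lemma outer_0 [simp]: "outer 0 v = 0" "outer u 0 = 0"
  by (simp_all add: outer_def vec_eq_iff)

lemma outer_eq_0_iff: "outer u v = 0 \<longleftrightarrow> u = 0 \<or> v = 0"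
  by (auto simp: outer_def vec_eq_iff)

lemma outer_normalize:
  "u \<noteq> 0 \<Longrightarrow> v \<noteq> 0 \<Longrightarrow> outer u v = (norm u * norm v) *\<^sub>R outer (u /\<^sub>R norm u) (v /\<^sub>R norm v)"
  by (simp add: outer_bilinear field_simps)

lemma linear_outer_left: "linear (\<lambda>u. outer u v)"
  by (rule linearI) (simp_all add: outer_bilinear)
lemma linear_outer_right: "linear (outer u)"
  by (rule linearI) (simp_all add: outer_bilinear)

lemma outer_axis: "outer (axis i 1) (axis j 1) $ a $ b = (if a = i \<and> b = j then 1 else 0)"
  by (auto simp: outer_def axis_def)

lemma matrix_eq_sum_outer: "A = (\<Sum>i\<in>UNIV. \<Sum>j\<in>UNIV. A $ i $ j *\<^sub>R outer (axis i 1) (axis j 1))"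
  for A :: "real^'n^'m"
proof -
  have "(\<Sum>i\<in>UNIV. \<Sum>j\<in>UNIV. A $ i $ j * (if a = i \<and> b = j then 1 else 0)) = A $ a $ b" for a b
  proof -
    have "(\<Sum>j\<in>UNIV. A $ i $ j * (if a = i \<and> b = j then 1 else 0)) = (if a = i then A $ a $ b else 0)" for i
      by (cases "a = i") (simp_all add: if_distrib cong: if_cong)
    then show ?thesis by simp
  qed
  then show ?thesis by (simp add: vec_eq_iff outer_axis)
qed

lemma linear_outer_nonzero:
  fixes T :: "real^'n^'m \<Rightarrow> 'b::real_vector"
  assumes "linear T" "inj T" "u \<noteq> 0" "v \<noteq> 0"
  shows "T (outer u v) \<noteq> 0"
  using assms linear_injective_0[OF assms(1)] outer_eq_0_iff by blast

lemma linear_eq_on_outer: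
  fixes f g :: "real^'n^'m \<Rightarrow> 'b::real_vector"
  assumes "linear f" "linear g" and "\<And>u v. f (outer u v) = g (outer u v)"
  shows "f = g"
proof
  fix A
  show "f A = g A"
    by (subst (1 2) matrix_eq_sum_outer[of A])
       (simp add: linear_sum[OF assms(1)] linear_sum[OF assms(2)] linear_cmul[OF assms(1)] linear_cmul[OF assms(2)] assms(3))
qed

lemma matrix_mult_add_rdistrib: "(A + B) ** C = A ** C + B ** C" for A :: "real^'n^'m"
  by (simp add: matrix_matrix_mult_def vec_eq_iff sum.distrib algebra_simps)

lemma matrix_mul_linear_left: "linear (\<lambda>X::real^'n^'m. U ** X)"
  by (rule linearI) (simp_all add: matrix_add_ldistrib matrix_scalar_ac scalar_matrix_assoc)

lemma matrix_mul_linear_both: "linear (\<lambda>X::real^'n^'m. U ** X ** V)"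
  by (rule linearI) (simp_all add: matrix_add_ldistrib matrix_mult_add_rdistrib matrix_scalar_ac scalar_matrix_assoc)

lemma linear_transpose: "linear (transpose :: real^'n^'m \<Rightarrow> _)"
  by (rule linearI) (simp_all add: transpose_def vec_eq_iff)

section \<open>Orthogonal matrices and Householder reflections\<close>

lemma orthogonal_matrixD:
  assumes "orthogonal_matrix (U :: real^'n^'n)"
  shows "transpose U ** U = mat 1" "U ** transpose U = mat 1"
  using assms by (auto simp: orthogonal_matrix_def)

lemma orthogonal_matrix_inner:
  assumes "orthogonal_matrix (U :: real^'n^'n)"
  shows "(U *v x) \<bullet> (U *v y) = x \<bullet> y"
proof -
  have "(U *v x) \<bullet> (U *v y) = (x v* transpose U) \<bullet> (U *v y)" by simp
  also have "\<dots> = x \<bullet> (transpose U *v (U *v y))" by (rule dot_lmul_matrix)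
  also have "\<dots> = x \<bullet> y"
    by (simp add: matrix_vector_mul_assoc orthogonal_matrixD[OF assms] del: transpose_matrix_vector)
  finally show ?thesis .
qed

lemma orthogonal_matrix_norm:
  assumes "orthogonal_matrix (U :: real^'n^'n)"
  shows "norm (U *v x) = norm x"
  by (simp add: norm_eq_sqrt_inner orthogonal_matrix_inner[OF assms])

lemma orthogonal_conjugate_cancel:
  assumes "orthogonal_matrix (U :: real^'n^'n)" "orthogonal_matrix (V :: real^'n^'n)"
  shows "transpose U ** (U ** M ** V) ** transpose V = M"
  using assms by (simp add: matrix_mul_assoc orthogonal_matrixD)
    (simp add: orthogonal_matrixD flip: matrix_mul_assoc)

text \<open>The reflection in the hyperplane orthogonal to \<open>x\<close>. For
  \<open>x = 0\<close> the quotient and the outer product are 0, so it is the identity and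
  orthogonality holds for every \<open>x\<close>.\<close>

definition householder :: "real^'n \<Rightarrow> real^'n^'n" where
  "householder x = mat 1 - (2 / (x \<bullet> x)) *\<^sub>R outer x x"

lemma householder_vec: "householder x *v y = y - (2 * (x \<bullet> y) / (x \<bullet> x)) *\<^sub>R x"
  by (simp add: householder_def matrix_vector_mult_diff_rdistrib scaleR_matrix_vector_assoc[symmetric] outer_vec)

lemma transpose_householder: "transpose (householder x) = householder x"
proof -
  have "transpose (A - c *\<^sub>R B) = transpose A - c *\<^sub>R transpose B" for A B :: "real^'a^'a" and c
    by (simp add: transpose_def vec_eq_iff)
  then show ?thesis by (simp add: householder_def transpose_outer)
qed

lemma orthogonal_householder: "orthogonal_matrix (householder x)"
proof -
  have "householder x *v (householder x *v y) = y" for y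
    by (simp add: householder_vec inner_diff_right field_simps flip: scaleR_diff_left)
  then have "householder x ** householder x = mat 1"
    by (simp add: matrix_eq matrix_vector_mul_assoc)
  then show ?thesis by (simp add: orthogonal_matrix transpose_householder)
qed

lemma householder_swap:
  assumes "x \<bullet> x = y \<bullet> y"
  shows "householder (x - y) *v x = y"
proof (cases "x = y")
  case True
  then show ?thesis by (simp add: householder_vec)
next
  case False
  then have "(x - y) \<bullet> (x - y) \<noteq> 0" by simp
  moreover have "2 * ((x - y) \<bullet> x) = (x - y) \<bullet> (x - y)"
    using assms by (simp add: inner_diff_left inner_diff_right inner_commute)
  ultimately show ?thesis by (simp add: householder_vec)
qed

lemma householder_fix: "x \<bullet> y = 0 \<Longrightarrow> householder x *v y = y"
  by (simp add: householder_vec)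

text \<open>Two reflections suffice: the first carries \<open>v\<close> to \<open>u\<close>. The
  image of \<open>y\<close> and the target \<open>x\<close> have the same inner product with
  \<open>u\<close>, so the second reflection, which swaps them, leaves \<open>u\<close> in
  place.\<close>

lemma orthogonal_matrix_pair:
  fixes u v x y :: "real^'n"
  assumes "u \<bullet> u = v \<bullet> v" "x \<bullet> x = y \<bullet> y" "u \<bullet> x = v \<bullet> y"
  obtains Q where "orthogonal_matrix Q" "Q *v v = u" "Q *v y = x"
proof -
  define H where "H = householder (v - u)"
  have H: "orthogonal_matrix H" "H *v v = u"
    using assms by (auto simp: H_def orthogonal_householder householder_swap)
  define y' where "y' = H *v y"
  have y': "y' \<bullet> y' = x \<bullet> x" "u \<bullet> y' = u \<bullet> x"
    using orthogonal_matrix_inner[OF H(1), of y y] orthogonal_matrix_inner[OF H(1), of v y] H(2) assms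
    by (simp_all add: y'_def)
  define K where "K = householder (y' - x)"
  have "K *v y' = x" using y' by (simp add: K_def householder_swap)
  moreover have "K *v u = u"
    unfolding K_def by (rule householder_fix) (simp add: y' inner_diff_left inner_diff_right inner_commute)
  moreover have "orthogonal_matrix K" by (simp add: K_def orthogonal_householder)
  ultimately show thesis
    using that[of "K ** H"] H by (simp add: orthogonal_matrix_mul y'_def flip: matrix_vector_mul_assoc)
qed

text \<open>Products of two Householder reflections already detect the antisymmetric part of \<open>G\<close>:
  they give \<open>2 (x \<bullet> y) (x \<bullet> G y) \<le> \<bar>y\<bar>\<^sup>2 (x \<bullet> G x) + \<bar>x\<bar>\<^sup>2 (y \<bullet> G y)\<close>, to be used with \<open>y = x + \<epsilon> z\<close>.\<close>

lemma maximal_trace_psd: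
  fixes G :: "real^'n^'n"
  assumes max: "\<And>Q. orthogonal_matrix Q \<Longrightarrow> G \<bullet> Q \<le> G \<bullet> mat 1"
  shows "0 \<le> x \<bullet> (G *v x)"
proof (cases "x = 0")
  case False
  have "G \<bullet> householder x \<le> G \<bullet> mat 1" by (rule max[OF orthogonal_householder])
  then have "0 \<le> 2 / (x \<bullet> x) * (x \<bullet> (G *v x))"
    by (simp add: householder_def inner_diff_right inner_outer_right)
  moreover have "0 < 2 / (x \<bullet> x)" using False by simp
  ultimately show ?thesis by (metis mult_le_cancel_left_pos mult_zero_right)
qed simp

lemma maximal_trace_symmetric:
  fixes G :: "real^'n^'n"
  assumes max: "\<And>Q. orthogonal_matrix Q \<Longrightarrow> G \<bullet> Q \<le> G \<bullet> mat 1"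
  shows "x \<bullet> (G *v y) = y \<bullet> (G *v x)"
proof -
  define g where "g x y = x \<bullet> (G *v y)" for x y
  have *: "2 * (x \<bullet> y) * g x y \<le> (y \<bullet> y) * g x x + (x \<bullet> x) * g y y" for x y
  proof (cases "x = 0 \<or> y = 0")
    case False
    have "householder x ** householder y = mat 1 - (2 / (x \<bullet> x)) *\<^sub>R outer x x - (2 / (y \<bullet> y)) *\<^sub>R outer y y
        + (4 * (x \<bullet> y) / ((x \<bullet> x) * (y \<bullet> y))) *\<^sub>R outer x y"
      by (simp add: matrix_eq matrix_vector_mul_assoc[symmetric] householder_vec outer_vec
           matrix_vector_mult_diff_rdistrib matrix_vector_mult_add_rdistrib scaleR_matrix_vector_assoc[symmetric]
           inner_diff_right algebra_simps)
    moreover have "G \<bullet> (householder x ** householder y) \<le> G \<bullet> mat 1"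
      by (intro max orthogonal_matrix_mul orthogonal_householder)
    ultimately have "4 * (x \<bullet> y) / ((x \<bullet> x) * (y \<bullet> y)) * g x y \<le> 2 / (x \<bullet> x) * g x x + 2 / (y \<bullet> y) * g y y"
      by (simp add: inner_diff_right inner_add_right inner_outer_right g_def)
    then have "(x \<bullet> x) * (y \<bullet> y) * (4 * (x \<bullet> y) / ((x \<bullet> x) * (y \<bullet> y)) * g x y)
       \<le> (x \<bullet> x) * (y \<bullet> y) * (2 / (x \<bullet> x) * g x x + 2 / (y \<bullet> y) * g y y)"
      by (intro mult_left_mono) auto
    then have "2 * (2 * (x \<bullet> y) * g x y) \<le> 2 * ((y \<bullet> y) * g x x + (x \<bullet> x) * g y y)"
      using False by (simp add: algebra_simps)
    then show ?thesis by simp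
  qed (auto simp: g_def)
  have add: "g (x + e *\<^sub>R z) w = g x w + e * g z w" "g w (x + e *\<^sub>R z) = g w x + e * g w z" for x e z w
    by (simp_all add: g_def inner_add_left matrix_vector_right_distrib inner_add_right matrix_vector_mult_scaleR)
  \<comment> \<open>Expansion at \<open>y = x + e z\<close>: the terms without \<open>e\<close>
    cancel and the coefficient of \<open>e\<close> is \<open>D\<close>, a multiple of the
    antisymmetric part. Both signs of \<open>e\<close> are admissible, which squeezes
    \<open>D\<close> to 0.\<close>
  have orth: "g x z = g z x" if xz: "x \<bullet> z = 0" for x z
  proof -
    define X where "X = x \<bullet> x"
    define B where "B = (z \<bullet> z) * g x x + X * g z z"
    have X: "X \<ge> 0" by (simp add: X_def)
    have 1: "X * e * (g x z - g z x) \<le> e\<^sup>2 * B" for e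
    proof -
      have "2 * X * (g x x + e * g x z) \<le>
         (X + e\<^sup>2 * (z \<bullet> z)) * g x x + X * (g x x + e * g x z + e * g z x + e\<^sup>2 * g z z)"
        using *[of x "x + e *\<^sub>R z"] xz
        by (simp add: inner_add_left inner_add_right inner_commute add X_def power2_eq_square algebra_simps)
      then show ?thesis by (simp add: algebra_simps B_def)
    qed
    define D where "D = X * (g x z - g z x)"
    have 2: "e * D \<le> e\<^sup>2 * B" for e
      using 1[of e] by (simp add: D_def algebra_simps)
    have "D \<le> e * B" "- D \<le> e * B" if "e > 0" for e
      using 2[of e] 2[of "-e"] mult_le_cancel_left_pos[OF that, of D "e * B"]
        mult_le_cancel_left_pos[OF that, of "- D" "e * B"] by (simp_all add: power2_eq_square mult.assoc)
    then have "\<bar>D\<bar> \<le> e * \<bar>B\<bar>" if "e > 0" for e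
      using that by (smt (verit) mult_left_mono)
    then have "\<bar>D\<bar> \<le> 0 + e" if "e > 0" for e
    proof -
      have "\<bar>D\<bar> \<le> (e / (\<bar>B\<bar> + 1)) * \<bar>B\<bar>" using \<open>\<And>e. e > 0 \<Longrightarrow> \<bar>D\<bar> \<le> e * \<bar>B\<bar>\<close>[of "e / (\<bar>B\<bar> + 1)"] that
        by simp
      also have "\<dots> \<le> e" using that by (simp add: field_simps)
      finally show ?thesis by simp
    qed
    then have "\<bar>D\<bar> \<le> 0" by (rule field_le_epsilon)
    then have "x = 0 \<or> g x z = g z x" by (simp add: D_def X_def)
    then show ?thesis by (auto simp: g_def)
  qed
  show ?thesis
  proof (cases "x = 0")
    case False
    define c where "c = (x \<bullet> y) / (x \<bullet> x)"
    define z where "z = y - c *\<^sub>R x"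
    have "x \<bullet> z = 0" using False by (simp add: z_def c_def inner_diff_right)
    then have "g x z = g z x" by (rule orth)
    moreover have "y = z + c *\<^sub>R x" by (simp add: z_def)
    ultimately have "g x y = g y x" by (simp add: add)
    then show ?thesis by (simp add: g_def)
  qed simp
qed

section \<open>Singular values\<close>

lemma compact_orthogonal_matrices: "compact {U :: real^'n^'n. orthogonal_matrix U}"
proof -
  have eq: "{U :: real^'n^'n. orthogonal_matrix U} =
      {U. \<forall>i j. (\<Sum>l\<in>UNIV. U $ l $ i * U $ l $ j) = (if i = j then 1 else 0)}"
    by (simp add: orthogonal_matrix matrix_matrix_mult_def transpose_def mat_def vec_eq_iff)
  have "closed {U :: real^'n^'n. orthogonal_matrix U}"
    unfolding eq by (intro closed_Collect_all closed_Collect_eq continuous_intros)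
  moreover have "bounded {U :: real^'n^'n. orthogonal_matrix U}"
  proof (rule boundedI)
    fix U :: "real^'n^'n" assume "U \<in> {U. orthogonal_matrix U}"
    then have "transpose U ** U = mat 1" by (simp add: orthogonal_matrix)
    then have "U \<bullet> U = mat 1 \<bullet> (mat 1 :: real^'n^'n)"
      using inner_mult_left_matrix[of U "mat 1" U] by simp
    then show "norm U \<le> norm (mat 1 :: real^'n^'n)" by (simp add: norm_eq_sqrt_inner)
  qed
  ultimately show ?thesis by (simp add: compact_eq_bounded_closed)
qed

lemma inner_axis_matrix: "axis i 1 \<bullet> (A *v axis j 1) = A $ i $ j" for A :: "real^'n^'m"
  by (simp add: inner_axis' matrix_vector_mul_component inner_axis)

lemma diag_mult: "(diag w ** A) $ i $ j = w $ i * A $ i $ j"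
proof -
  have "(diag w ** A) $ i $ j = (\<Sum>l\<in>UNIV. if i = l then w $ i * A $ l $ j else 0)"
    by (simp only: matrix_matrix_mult_def diag_def vec_lambda_beta) (rule sum.cong, auto)
  then show ?thesis by simp
qed

lemma mult_diag: "(A ** diag w) $ i $ j = A $ i $ j * w $ j"
proof -
  have "(A ** diag w) $ i $ j = (\<Sum>l\<in>UNIV. if l = j then A $ i $ l * w $ l else 0)"
    by (simp only: matrix_matrix_mult_def diag_def vec_lambda_beta) (rule sum.cong, auto)
  then show ?thesis by simp
qed

lemma mult_diag_mult: "P ** diag w ** Q = (\<Sum>i\<in>UNIV. w $ i *\<^sub>R outer (P *v axis i 1) (axis i 1 v* Q))"
  for P Q :: "real^'n^'n"
proof -
  have "(P ** diag w ** Q) $ a $ b = (\<Sum>i\<in>UNIV. P $ a $ i * w $ i * Q $ i $ b)" for a b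
    by (simp add: matrix_matrix_mult_def[of "P ** diag w"] mult_diag)
  then show ?thesis
    by (simp add: vec_eq_iff outer_def matrix_vector_mult_basis column_def mult_ac
        flip: transpose_matrix_vector row_transpose) (simp add: transpose_def mult_ac)
qed

lemma axis_1_component: "axis i 1 $ j = (if j = i then 1 else 0)"
  by (simp add: axis_def)

lemma mult_diag_axis: "P ** diag (axis i 1) ** Q = outer (P *v axis i 1) (axis i 1 v* Q)"
  for P Q :: "real^'n^'n"
proof -
  have "P ** diag (axis i 1) ** Q = (\<Sum>l\<in>UNIV. if l = i then outer (P *v axis i 1) (axis i 1 v* Q) else 0)"
    unfolding mult_diag_mult by (intro sum.cong) (auto simp: axis_1_component)
  then show ?thesis by simp
qed

lemma diag_add: "diag (x + y) = diag x + diag y"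
  by (simp add: diag_def vec_eq_iff)
lemma diag_scaleR: "diag (c *\<^sub>R x) = c *\<^sub>R diag x"
  by (simp add: diag_def vec_eq_iff)

lemma mult_diag_add: "P ** diag (x + y) ** Q = P ** diag x ** Q + P ** diag y ** Q"
  by (simp add: diag_add matrix_add_ldistrib matrix_mult_add_rdistrib)

lemma mult_diag_scaleR: "P ** diag (c *\<^sub>R x) ** Q = c *\<^sub>R (P ** diag x ** Q)"
  by (simp add: diag_scaleR matrix_scalar_ac scalar_matrix_assoc)

text \<open>The singular value decomposition arises by maximising \<open>(U, V) \<mapsto> A \<bullet> (U ** diag w ** V)\<close>
  for distinct positive weights \<open>w\<close>: at a maximum both \<open>M ** diag w\<close> and \<open>diag w ** M\<close> are symmetric,
  where \<open>M = U\<^sup>T ** A ** V\<^sup>T\<close>, which forces \<open>M\<close> to be diagonal.\<close>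

lemma singular_value_decomposition:
  fixes A :: "real^'n^'n"
  obtains U V d where "orthogonal_matrix U" "orthogonal_matrix V" "A = U ** diag d ** V" "\<And>i. 0 \<le> d $ i"
proof -
  obtain f :: "'n \<Rightarrow> nat" where f: "inj f"
    using finite_imp_inj_to_nat_seg[of "UNIV :: 'n set"] by auto
  define w :: "real^'n" where "w = (\<chi> i. real (f i) + 1)"
  have w_pos: "w $ i > 0" for i by (simp add: w_def)
  have w_inj: "w $ i = w $ j \<Longrightarrow> i = j" for i j using f by (simp add: w_def inj_eq)
  let ?O = "{U :: real^'n^'n. orthogonal_matrix U}"
  let ?g = "\<lambda>p. A \<bullet> (fst p ** diag w ** snd p)"
  have "compact (?O \<times> ?O)" by (intro compact_Times compact_orthogonal_matrices)
  moreover have "?O \<times> ?O \<noteq> {}" using orthogonal_matrix_id by blast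
  moreover have "continuous_on (?O \<times> ?O) ?g"
    unfolding inner_matrix matrix_matrix_mult_def
    by (simp only: vec_lambda_beta) (intro continuous_intros)
  ultimately obtain p where p: "p \<in> ?O \<times> ?O" "\<forall>q\<in>?O \<times> ?O. ?g q \<le> ?g p"
    using continuous_attains_sup[of "?O \<times> ?O" ?g] by auto
  obtain U V where UV: "orthogonal_matrix U" "orthogonal_matrix V" and
    max: "\<And>U' V'. orthogonal_matrix U' \<Longrightarrow> orthogonal_matrix V' \<Longrightarrow>
       A \<bullet> (U' ** diag w ** V') \<le> A \<bullet> (U ** diag w ** V)"
    using p by force
  define M where "M = transpose U ** A ** transpose V"
  have M: "M \<bullet> B = A \<bullet> (U ** B ** V)" for B
    by (simp only: M_def inner_mult_left_matrix[of "transpose U"] inner_mult_right_matrix[of _ "transpose V"]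
        transpose_transpose flip: matrix_mul_assoc)
  have tw: "transpose (diag w) = diag w" by (auto simp: diag_def transpose_def vec_eq_iff)
  \<comment> \<open>\<open>U ** Q\<close>, and below \<open>Q ** V\<close>, are competitors in the
    maximisation, so both products pair with orthogonal matrices most strongly at the
    identity.\<close>
  have 1: "(M ** diag w) \<bullet> Q \<le> (M ** diag w) \<bullet> mat 1" if "orthogonal_matrix Q" for Q
  proof -
    have "(M ** diag w) \<bullet> Q = A \<bullet> ((U ** Q) ** diag w ** V)"
      by (simp add: inner_mult_right_matrix tw M matrix_mul_assoc)
    also have "\<dots> \<le> A \<bullet> (U ** diag w ** V)" by (intro max orthogonal_matrix_mul UV that)
    also have "\<dots> = (M ** diag w) \<bullet> mat 1" by (simp add: inner_mult_right_matrix tw M)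
    finally show ?thesis .
  qed
  have 2: "(diag w ** M) \<bullet> Q \<le> (diag w ** M) \<bullet> mat 1" if "orthogonal_matrix Q" for Q
  proof -
    have "(diag w ** M) \<bullet> Q = A \<bullet> (U ** diag w ** (Q ** V))"
      by (simp add: inner_mult_left_matrix tw M matrix_mul_assoc)
    also have "\<dots> \<le> A \<bullet> (U ** diag w ** V)" by (intro max orthogonal_matrix_mul UV that)
    also have "\<dots> = (diag w ** M) \<bullet> mat 1" by (simp add: inner_mult_left_matrix tw M)
    finally show ?thesis .
  qed
  have s1: "M $ i $ j * w $ j = M $ j $ i * w $ i" for i j
    using maximal_trace_symmetric[OF 1, of "axis i 1" "axis j 1"] by (simp add: inner_axis_matrix mult_diag)
  have s2: "w $ i * M $ i $ j = w $ j * M $ j $ i" for i j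
    using maximal_trace_symmetric[OF 2, of "axis i 1" "axis j 1"] by (simp add: inner_axis_matrix diag_mult)
  \<comment> \<open>Combining both symmetries gives \<open>w_i^2 M_ij = w_j^2 M_ij\<close>.\<close>
  have off: "M $ i $ j = 0" if "i \<noteq> j" for i j
  proof -
    have "w $ i * (M $ i $ j * w $ i) = w $ j * (M $ i $ j * w $ j)"
      using s1[of i j] s2[of i j] by (simp add: mult_ac)
    then have "M $ i $ j = 0 \<or> (w $ i)\<^sup>2 = (w $ j)\<^sup>2" by (auto simp: power2_eq_square)
    moreover have "(w $ i)\<^sup>2 \<noteq> (w $ j)\<^sup>2"
      using w_pos[of i] w_pos[of j] w_inj that by (auto simp: power2_eq_iff)
    ultimately show ?thesis by simp
  qed
  have nonneg: "0 \<le> M $ i $ i" for i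
    using maximal_trace_psd[OF 1, of "axis i 1"] w_pos[of i]
    by (simp add: inner_axis_matrix mult_diag zero_le_mult_iff)
  have "M = diag (\<chi> i. M $ i $ i)" using off by (simp add: diag_def vec_eq_iff)
  moreover have "A = U ** M ** V"
    using UV by (simp add: M_def matrix_mul_assoc orthogonal_matrixD)
      (simp add: orthogonal_matrixD flip: matrix_mul_assoc)
  ultimately show thesis
    using that[OF UV, of "\<chi> i. M $ i $ i"] nonneg by simp
qed

section \<open>From the decomposition to the list of singular values\<close>

definition const_mat :: "real^'n^'m \<Rightarrow> real poly ^ 'n ^ 'm" where
  "const_mat A = (\<chi> i j. [:A $ i $ j:])"

lemma const_mat_mult: "const_mat (A ** B) = const_mat A ** const_mat B"
proof -
  have const_sum: "[:sum f I:] = (\<Sum>i\<in>I. [:f i:])" for f :: "'i \<Rightarrow> real" and I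
    by (induction I rule: infinite_finite_induct) (simp_all, metis add_0 add_pCons)
  show ?thesis by (simp add: const_mat_def matrix_matrix_mult_def vec_eq_iff const_sum mult.commute)
qed

lemma const_mat_id: "const_mat (mat 1 :: real^'n^'n) = mat 1"
  by (simp add: const_mat_def mat_def vec_eq_iff pCons_one)

lemma charpoly_conjugate:
  fixes M :: "real^'n^'n"
  assumes V: "orthogonal_matrix V"
  shows "charpoly (transpose V ** M ** V) = charpoly M"
proof -
  let ?X = "mat [:0, 1:] :: real poly ^ 'n ^ 'n"
  let ?c = "const_mat :: real^'n^'n \<Rightarrow> _"
  have comm: "A ** ?X = ?X ** A" for A
  proof -
    have "(A ** ?X) $ i $ j = (\<Sum>l\<in>UNIV. if l = j then A $ i $ l * [:0, 1:] else 0)" for i j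
      by (simp only: matrix_matrix_mult_def mat_def vec_lambda_beta) (rule sum.cong, auto)
    moreover have "(?X ** A) $ i $ j = (\<Sum>l\<in>UNIV. if i = l then [:0, 1:] * A $ l $ j else 0)" for i j
      by (simp only: matrix_matrix_mult_def mat_def vec_lambda_beta) (rule sum.cong, auto)
    ultimately show ?thesis by (simp add: vec_eq_iff mult.commute)
  qed
  have dist: "A ** (B - C) ** D = A ** B ** D - A ** C ** D" for A B C D :: "real poly ^ 'n ^ 'n"
    by (simp add: matrix_matrix_mult_def vec_eq_iff algebra_simps sum_subtractf)
  have VV: "?c (transpose V) ** ?c V = mat 1"
    using V by (simp add: orthogonal_matrix const_mat_id flip: const_mat_mult)
  have "?X - ?c (transpose V ** M ** V) = ?c (transpose V) ** (?X - ?c M) ** ?c V"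
    unfolding dist comm by (simp add: const_mat_mult VV flip: matrix_mul_assoc)
  then have "charpoly (transpose V ** M ** V) = det (?c (transpose V)) * det (?X - ?c M) * det (?c V)"
    by (simp add: charpoly_def const_mat_def[symmetric] det_mul)
  also have "\<dots> = det (?c (transpose V) ** ?c V) * det (?X - ?c M)" by (simp add: det_mul mult_ac)
  also have "\<dots> = charpoly M" by (simp only: VV det_I mult_1) (simp add: charpoly_def const_mat_def)
  finally show ?thesis .
qed

lemma charpoly_diag: "charpoly (diag d) = (\<Prod>i\<in>UNIV. [:- d $ i, 1:])"
  unfolding charpoly_def by (subst det_diagonal) (auto simp: mat_def diag_def)

lemma singular_values_diag:
  assumes U: "orthogonal_matrix U" and V: "orthogonal_matrix V"
  shows "singular_values (U ** diag d ** V) =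
    rev (sorted_list_of_multiset (image_mset (\<lambda>i. \<bar>d $ i\<bar>) (mset_set UNIV)))"
proof -
  let ?A = "U ** diag d ** V"
  have td: "transpose (diag d) = diag d" by (auto simp: diag_def transpose_def vec_eq_iff)
  have "transpose ?A ** ?A = transpose V ** (diag d ** (transpose U ** U) ** diag d) ** V"
    by (simp add: matrix_transpose_mul td matrix_mul_assoc)
  also have "\<dots> = transpose V ** diag (\<chi> i. (d $ i)\<^sup>2) ** V"
  proof -
    have "diag d ** diag d = diag (\<chi> i. (d $ i)\<^sup>2)"
      by (simp add: vec_eq_iff diag_mult) (simp add: diag_def power2_eq_square)
    then show ?thesis using U by (simp add: orthogonal_matrix)
  qed
  finally have "charpoly (transpose ?A ** ?A) = (\<Prod>i\<in>UNIV. [:- ((d $ i)\<^sup>2), 1:])"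
    by (simp add: charpoly_conjugate[OF V] charpoly_diag)
  then have "proots (charpoly (transpose ?A ** ?A)) = image_mset (\<lambda>i. (d $ i)\<^sup>2) (mset_set UNIV)"
    by (simp add: proots_prod sum_unfold_sum_mset)
  then show ?thesis by (simp add: singular_values_def multiset.map_comp comp_def)
qed

text \<open>Replaces the sorted list by a set of \<open>k\<close> leading positions, the form in
  which the norm is used from here on. Ties leave \<open>S\<close> ambiguous, so it is only
  characterised by dominating its complement.\<close>

lemma ky_fan_diag:
  fixes d :: "real^'n"
  assumes U: "orthogonal_matrix U" and V: "orthogonal_matrix V" and k: "k \<le> CARD('n)"
  obtains S where "card S = k" "ky_fan k (U ** diag d ** V) = (\<Sum>i\<in>S. \<bar>d $ i\<bar>)"
    "\<And>i j. i \<in> S \<Longrightarrow> j \<notin> S \<Longrightarrow> \<bar>d $ j\<bar> \<le> \<bar>d $ i\<bar>"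
proof -
  let ?a = "\<lambda>i. \<bar>d $ i\<bar>"
  obtain ys :: "'n list" where ys: "set ys = UNIV" "distinct ys"
    using finite_distinct_list[of "UNIV :: 'n set"] by auto
  define xs where "xs = rev (sort_key ?a ys)"
  have xs: "set xs = UNIV" "distinct xs" by (simp_all add: xs_def ys)
  have len: "length xs = CARD('n)" using xs by (metis distinct_card)
  have "mset_set (UNIV :: 'n set) = mset ys" using ys by (metis mset_set_set)
  then have "sorted_list_of_multiset (image_mset ?a (mset_set UNIV)) = sort (map ?a ys)"
    by (simp flip: mset_map)
  also have "\<dots> = map ?a (sort_key ?a ys)"
    by (rule properties_for_sort) (auto simp: sorted_sort_key)
  finally have sv: "singular_values (U ** diag d ** V) = map ?a xs"
    by (simp add: singular_values_diag[OF U V] xs_def rev_map)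
  define S where "S = set (take k xs)"
  have dt: "distinct (take k xs)" using xs by simp
  have "card S = k" unfolding S_def using distinct_card[OF dt] k len by simp
  moreover have "ky_fan k (U ** diag d ** V) = (\<Sum>i\<in>S. ?a i)"
    by (simp add: ky_fan_def sv S_def take_map sum_list_distinct_conv_sum_set[OF dt])
  moreover have "?a j \<le> ?a i" if "i \<in> S" "j \<notin> S" for i j
  proof -
    have "sorted (map ?a (sort_key ?a ys))" by (rule sorted_sort_key)
    then have "sorted_wrt (\<ge>) (rev (map ?a (sort_key ?a ys)))" by (simp add: sorted_wrt_rev)
    then have "sorted_wrt (\<lambda>x y. ?a y \<le> ?a x) (take k xs @ drop k xs)"
      by (simp add: xs_def rev_map sorted_wrt_map)
    then have "\<forall>x\<in>set (take k xs). \<forall>y\<in>set (drop k xs). ?a y \<le> ?a x"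
      unfolding sorted_wrt_append by blast
    moreover have "j \<in> set (drop k xs)"
      using that xs by (metis S_def Un_iff UNIV_I append_take_drop_id set_append)
    ultimately show ?thesis using that by (auto simp: S_def)
  qed
  ultimately show thesis by (rule that)
qed

section \<open>The dual ball of the Ky-Fan norm\<close>

text \<open>Linear programming duality: a threshold \<open>\<mu>\<close> between the entries on
  \<open>S\<close> and those off \<open>S\<close> is a multiplier for the constraint on the total
  weight.\<close>

lemma diag_ky_fan_ge:
  fixes d w :: "real^'n"
  assumes U: "orthogonal_matrix U" and V: "orthogonal_matrix V" and k: "k \<le> CARD('n)"
    and w: "\<And>i. \<bar>w $ i\<bar> \<le> 1" "(\<Sum>i\<in>UNIV. \<bar>w $ i\<bar>) \<le> k"
  shows "w \<bullet> d \<le> ky_fan k (U ** diag d ** V)"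
proof -
  obtain S where S: "card S = k" "ky_fan k (U ** diag d ** V) = (\<Sum>i\<in>S. \<bar>d $ i\<bar>)"
    "\<And>i j. i \<in> S \<Longrightarrow> j \<notin> S \<Longrightarrow> \<bar>d $ j\<bar> \<le> \<bar>d $ i\<bar>"
    using ky_fan_diag[OF U V k, of d] by blast
  \<comment> \<open>For empty \<open>S\<close>, that is \<open>k = 0\<close>, there is no smallest
    leading entry, and any upper bound of all entries serves as threshold.\<close>
  obtain \<mu> where mu: "\<mu> \<ge> 0" "\<And>i. i \<in> S \<Longrightarrow> \<mu> \<le> \<bar>d $ i\<bar>" "\<And>j. j \<notin> S \<Longrightarrow> \<bar>d $ j\<bar> \<le> \<mu>"
  proof (cases "S = {}")
    case True
    then show ?thesis
      using that[of "\<Sum>i\<in>UNIV. \<bar>d $ i\<bar>"] member_le_sum[of _ UNIV "\<lambda>i. \<bar>d $ i\<bar>"] by (auto simp: sum_nonneg)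
  next
    case False
    show ?thesis
      by (rule that[of "Min ((\<lambda>i. \<bar>d $ i\<bar>) ` S)"]) (use False S(3) in \<open>auto simp: Min_ge_iff\<close>)
  qed
  have eq: "(\<Sum>i\<in>UNIV. f i) = (\<Sum>i\<in>S. f i) + (\<Sum>i\<in>-S. f i)" for f :: "'n \<Rightarrow> real"
    by (metis Compl_partition finite Int_commute sum.union_disjoint Compl_disjoint)
  have "w \<bullet> d \<le> (\<Sum>i\<in>UNIV. \<bar>w $ i\<bar> * \<bar>d $ i\<bar>)"
    unfolding inner_vec_def by (rule sum_mono) (metis abs_ge_self abs_mult inner_real_def)
  also have "\<dots> = (\<Sum>i\<in>S. \<bar>w $ i\<bar> * \<bar>d $ i\<bar>) + (\<Sum>i\<in>-S. \<bar>w $ i\<bar> * \<bar>d $ i\<bar>)" by (rule eq)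
  also have "\<dots> \<le> (\<Sum>i\<in>S. \<bar>d $ i\<bar> - (1 - \<bar>w $ i\<bar>) * \<mu>) + (\<Sum>i\<in>-S. \<bar>w $ i\<bar> * \<mu>)"
  proof (intro add_mono sum_mono)
    fix i assume "i \<in> S"
    then have "(1 - \<bar>w $ i\<bar>) * \<mu> \<le> (1 - \<bar>w $ i\<bar>) * \<bar>d $ i\<bar>"
      using mu w by (intro mult_left_mono) auto
    then show "\<bar>w $ i\<bar> * \<bar>d $ i\<bar> \<le> \<bar>d $ i\<bar> - (1 - \<bar>w $ i\<bar>) * \<mu>" by (simp add: algebra_simps)
  next
    fix i assume "i \<in> -S"
    then show "\<bar>w $ i\<bar> * \<bar>d $ i\<bar> \<le> \<bar>w $ i\<bar> * \<mu>" using mu by (intro mult_left_mono) auto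
  qed
  also have "\<dots> = (\<Sum>i\<in>S. \<bar>d $ i\<bar>) - k * \<mu> + ((\<Sum>i\<in>S. \<bar>w $ i\<bar>) + (\<Sum>i\<in>-S. \<bar>w $ i\<bar>)) * \<mu>"
    by (simp add: sum_subtractf sum.distrib left_diff_distrib distrib_right S flip: sum_distrib_right)
  also have "\<dots> \<le> (\<Sum>i\<in>S. \<bar>d $ i\<bar>)"
    using mult_right_mono[OF w(2) mu(1)] by (simp add: eq[symmetric])
  finally show ?thesis by (simp add: S)
qed

text \<open>The unit ball of the dual norm: operator norm at most 1 and trace norm at most
  \<open>k\<close>. Members with \<open>Z \<bullet> A = ky_fan k A\<close> are the supporting
  functionals at \<open>A\<close>.\<close>

definition dual_ball :: "nat \<Rightarrow> (real^'n^'n) set" where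
  "dual_ball k = {Z. \<forall>A. Z \<bullet> A \<le> ky_fan k A}"

lemma dual_ballD: "Z \<in> dual_ball k \<Longrightarrow> Z \<bullet> A \<le> ky_fan k A"
  by (simp add: dual_ball_def)

lemma transpose_diag: "transpose (diag d) = diag d"
  by (auto simp: diag_def transpose_def vec_eq_iff)

lemma inner_diag: "M \<bullet> diag d = (\<Sum>i\<in>UNIV. d $ i * M $ i $ i)"
  by (simp add: inner_matrix diag_def if_distrib cong: if_cong) (simp add: mult.commute)

lemma inner_mult3: "Z \<bullet> (U ** D ** V) = (transpose U ** Z ** transpose V) \<bullet> D"
  for Z U V D :: "real^'n^'n"
proof -
  have "Z \<bullet> (U ** D ** V) = (U ** D ** V) \<bullet> Z" by (rule inner_commute)
  also have "\<dots> = (U ** D) \<bullet> (Z ** transpose V)" by (rule inner_mult_right_matrix)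
  also have "\<dots> = D \<bullet> (transpose U ** (Z ** transpose V))" by (rule inner_mult_left_matrix)
  finally show ?thesis by (simp add: inner_commute matrix_mul_assoc)
qed

lemma mult3_entry: "(A ** Z ** B) $ i $ j = (axis i 1 v* A) \<bullet> (Z *v (B *v axis j 1))" for A Z B :: "real^'n^'n"
  by (simp only: inner_axis_matrix[of i "A ** Z ** B" j, symmetric] dot_lmul_matrix matrix_vector_mul_assoc matrix_mul_assoc)

lemma norm_orthogonal_axis:
  assumes "orthogonal_matrix (A :: real^'n^'n)"
  shows "norm (A *v axis i 1) = 1" "norm (axis i 1 v* A) = 1"
  using assms orthogonal_matrix_norm[of A] orthogonal_matrix_norm[of "transpose A"] by simp_all

text \<open>In singular bases of \<open>A\<close> only the diagonal of \<open>Z\<close> pairs with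
  \<open>A\<close>. The two conditions bound the operator norm and the trace norm of
  \<open>Z\<close>, and so make this diagonal an admissible weight vector.\<close>

lemma dual_ballI:
  fixes Z :: "real^'n^'n"
  assumes k: "k \<le> CARD('n)"
    and 1: "\<And>u v. norm u = 1 \<Longrightarrow> norm v = 1 \<Longrightarrow> \<bar>u \<bullet> (Z *v v)\<bar> \<le> 1"
    and 2: "\<And>U V. orthogonal_matrix U \<Longrightarrow> orthogonal_matrix V \<Longrightarrow>
      (\<Sum>i\<in>UNIV. \<bar>(U ** Z ** V) $ i $ i\<bar>) \<le> k"
  shows "Z \<in> dual_ball k"
  unfolding dual_ball_def
proof safe
  fix A :: "real^'n^'n"
  obtain U V d where A: "orthogonal_matrix U" "orthogonal_matrix V" "A = U ** diag d ** V"
    using singular_value_decomposition[of A] by blast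
  define w where "w = (\<chi> i. (transpose U ** Z ** transpose V) $ i $ i)"
  have "Z \<bullet> A = w \<bullet> d"
    by (simp add: A inner_mult3 inner_diag w_def) (simp add: inner_vec_def mult.commute)
  also have "\<dots> \<le> ky_fan k A"
    unfolding A(3)
  proof (rule diag_ky_fan_ge)
    show "\<bar>w $ i\<bar> \<le> 1" for i
      unfolding w_def vec_lambda_beta mult3_entry using A by (intro 1 norm_orthogonal_axis) simp_all
    show "(\<Sum>i\<in>UNIV. \<bar>w $ i\<bar>) \<le> k"
      using 2[of "transpose U" "transpose V"] A by (simp add: w_def)
  qed (use A k in auto)
  finally show "Z \<bullet> A \<le> ky_fan k A" .
qed

lemma sum_abs_le_norm: "(\<Sum>i\<in>UNIV. \<bar>a $ i * b $ i\<bar>) \<le> norm a * norm b" for a b :: "real^'n"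
proof -
  have "(\<Sum>i\<in>UNIV. \<bar>a $ i * b $ i\<bar>) = (\<chi> i. \<bar>a $ i\<bar>) \<bullet> (\<chi> i. \<bar>b $ i\<bar>)"
    by (simp add: inner_vec_def abs_mult)
  also have "\<dots> \<le> norm (\<chi> i. \<bar>a $ i\<bar>) * norm (\<chi> i. \<bar>b $ i\<bar>)" by (rule norm_cauchy_schwarz)
  also have "\<dots> = norm a * norm b" by (simp add: norm_vec_def)
  finally show ?thesis .
qed

text \<open>For the trace norm, each weight is multiplied by a sum over a column of one orthogonal
  matrix and a row of another, which Cauchy-Schwarz bounds by 1.\<close>

lemma diag_in_dual_ball:
  fixes w :: "real^'n"
  assumes P: "orthogonal_matrix P" and Q: "orthogonal_matrix Q" and k: "k \<le> CARD('n)"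
    and w: "\<And>i. \<bar>w $ i\<bar> \<le> 1" "(\<Sum>i\<in>UNIV. \<bar>w $ i\<bar>) \<le> k"
  shows "P ** diag w ** Q \<in> dual_ball k"
proof (rule dual_ballI[OF k])
  fix u v :: "real^'n" assume uv: "norm u = 1" "norm v = 1"
  have dv: "diag w *v x = (\<chi> i. w $ i * x $ i)" for x
    by (simp add: diag_def matrix_vector_mult_def vec_eq_iff if_distrib cong: if_cong)
       (simp add: if_distribR cong: if_cong)
  let ?a = "u v* P" and ?b = "Q *v v"
  have "u \<bullet> ((P ** diag w ** Q) *v v) = ?a \<bullet> (diag w *v ?b)"
    by (simp add: dot_lmul_matrix matrix_vector_mul_assoc matrix_mul_assoc)
  also have "\<bar>\<dots>\<bar> \<le> (\<Sum>i\<in>UNIV. \<bar>?a $ i * (w $ i * ?b $ i)\<bar>)"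
    unfolding dv inner_vec_def by (simp add: sum_abs)
  also have "\<dots> \<le> (\<Sum>i\<in>UNIV. \<bar>?a $ i * ?b $ i\<bar>)"
  proof (rule sum_mono)
    fix i
    have "\<bar>w $ i\<bar> * \<bar>?a $ i * ?b $ i\<bar> \<le> 1 * \<bar>?a $ i * ?b $ i\<bar>"
      by (intro mult_right_mono w) auto
    then show "\<bar>?a $ i * (w $ i * ?b $ i)\<bar> \<le> \<bar>?a $ i * ?b $ i\<bar>"
      by (simp add: abs_mult mult_ac)
  qed
  also have "\<dots> \<le> norm ?a * norm ?b" by (rule sum_abs_le_norm)
  also have "\<dots> = 1"
    using orthogonal_matrix_norm[OF Q, of v] orthogonal_matrix_norm[of "transpose P" u] P uv by simp
  finally show "\<bar>u \<bullet> ((P ** diag w ** Q) *v v)\<bar> \<le> 1" .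
next
  fix U V :: "real^'n^'n" assume UV: "orthogonal_matrix U" "orthogonal_matrix V"
  define R T where "R = U ** P" and "T = Q ** V"
  have R: "orthogonal_matrix R" and T: "orthogonal_matrix T"
    using UV P Q by (simp_all add: R_def T_def orthogonal_matrix_mul)
  have "U ** (P ** diag w ** Q) ** V = R ** (diag w ** T)"
    by (simp add: R_def T_def matrix_mul_assoc)
  then have "(\<Sum>i\<in>UNIV. \<bar>(U ** (P ** diag w ** Q) ** V) $ i $ i\<bar>)
      = (\<Sum>i\<in>UNIV. \<bar>\<Sum>j\<in>UNIV. R $ i $ j * (w $ j * T $ j $ i)\<bar>)"
    by (simp add: diag_mult) (simp add: matrix_matrix_mult_def diag_mult[unfolded matrix_matrix_mult_def, simplified])
  also have "\<dots> \<le> (\<Sum>i\<in>UNIV. \<Sum>j\<in>UNIV. \<bar>w $ j\<bar> * \<bar>R $ i $ j * T $ j $ i\<bar>)"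
    by (intro sum_mono order.trans[OF sum_abs]) (simp add: abs_mult mult_ac)
  also have "\<dots> = (\<Sum>j\<in>UNIV. \<bar>w $ j\<bar> * (\<Sum>i\<in>UNIV. \<bar>column j R $ i * row j T $ i\<bar>))"
    by (subst sum.swap) (simp add: column_def row_def sum_distrib_left)
  also have "\<dots> \<le> (\<Sum>j\<in>UNIV. \<bar>w $ j\<bar> * (norm (column j R) * norm (row j T)))"
    by (intro sum_mono mult_left_mono sum_abs_le_norm) auto
  also have "\<dots> = (\<Sum>j\<in>UNIV. \<bar>w $ j\<bar>)"
    using R T by (simp add: orthogonal_matrix_orthonormal_columns[of R] orthogonal_matrix_orthonormal_rows[of T])
  finally show "(\<Sum>i\<in>UNIV. \<bar>(U ** (P ** diag w ** Q) ** V) $ i $ i\<bar>) \<le> k"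
    using w by simp
qed

text \<open>With orthogonal \<open>P\<close> and \<open>Q\<close>, the matrices
  \<open>P ** diag (ind S) ** Q\<close> are the partial isometries of rank
  \<open>card S\<close>.\<close>

definition ind :: "'n set \<Rightarrow> real^'n" where
  "ind S = (\<chi> i. if i \<in> S then 1 else 0)"

lemma ind_pair: "i \<noteq> j \<Longrightarrow> ind {i, j} = axis i 1 + axis j 1"
  by (auto simp: ind_def vec_eq_iff axis_1_component)

lemma ind_in_dual_ball:
  fixes S :: "'n::finite set"
  assumes "orthogonal_matrix P" "orthogonal_matrix Q" "card S \<le> k" "k \<le> CARD('n)"
  shows "P ** diag (ind S) ** Q \<in> dual_ball k"
proof (rule diag_in_dual_ball)
  have "(\<Sum>i\<in>UNIV. \<bar>ind S $ i\<bar>) = (\<Sum>i\<in>UNIV. if i \<in> S then 1 else 0)"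
    by (intro sum.cong) (auto simp: ind_def)
  also have "\<dots> = card S" by (simp add: sum.If_cases)
  finally show "(\<Sum>i\<in>UNIV. \<bar>ind S $ i\<bar>) \<le> k" using assms by simp
qed (use assms in \<open>auto simp: ind_def\<close>)

text \<open>The partial isometry that matches the singular vectors of the \<open>k\<close> largest
  singular values attains the norm.\<close>

lemma ky_fan_attained:
  fixes A :: "real^'n^'n"
  assumes k: "k \<le> CARD('n)"
  obtains P Q S where "orthogonal_matrix P" "orthogonal_matrix Q" "card S = k"
    "P ** diag (ind S) ** Q \<in> dual_ball k" "(P ** diag (ind S) ** Q) \<bullet> A = ky_fan k A"
proof -
  obtain U V d where A: "orthogonal_matrix U" "orthogonal_matrix V" "A = U ** diag d ** V" "\<And>i. 0 \<le> d $ i"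
    using singular_value_decomposition[of A] by blast
  obtain S where S: "card S = k" "ky_fan k (U ** diag d ** V) = (\<Sum>i\<in>S. \<bar>d $ i\<bar>)"
    using ky_fan_diag[OF A(1,2) k, of d] by blast
  have "(U ** diag (ind S) ** V) \<bullet> A = (transpose U ** (U ** diag (ind S) ** V) ** transpose V) \<bullet> diag d"
    by (simp add: A inner_mult3)
  also have "transpose U ** (U ** diag (ind S) ** V) ** transpose V = diag (ind S)"
    by (rule orthogonal_conjugate_cancel[OF A(1,2)])
  also have "diag (ind S) \<bullet> diag d = (\<Sum>i\<in>UNIV. if i \<in> S then d $ i else 0)"
    unfolding inner_diag by (intro sum.cong) (auto simp: diag_def ind_def)
  also have "\<dots> = ky_fan k A" using A(3,4) S by (simp add: sum.If_cases)
  finally show thesis using that[OF A(1,2) S(1)] A S k by (simp add: ind_in_dual_ball)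
qed

section \<open>Invariance, triangle inequality and additive pairs\<close>

lemma ky_fan_orthogonal:
  assumes "orthogonal_matrix P" "orthogonal_matrix Q"
  shows "ky_fan k (P ** A ** Q) = ky_fan k A"
proof -
  obtain U V d where A: "orthogonal_matrix U" "orthogonal_matrix V" "A = U ** diag d ** V"
    using singular_value_decomposition[of A] by blast
  have eq: "P ** A ** Q = (P ** U) ** diag d ** (V ** Q)" by (simp add: A matrix_mul_assoc)
  show ?thesis
    unfolding ky_fan_def eq
    unfolding A(3) singular_values_diag[OF A(1,2)]
      singular_values_diag[OF orthogonal_matrix_mul[OF assms(1) A(1)] orthogonal_matrix_mul[OF A(2) assms(2)]] ..
qed

lemma ky_fan_transpose: "ky_fan k (transpose A) = ky_fan k A"
proof -
  obtain U V d where A: "orthogonal_matrix U" "orthogonal_matrix V" "A = U ** diag d ** V"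
    using singular_value_decomposition[of A] by blast
  have eq: "transpose A = transpose V ** diag d ** transpose U"
    by (simp add: A matrix_transpose_mul matrix_mul_assoc transpose_diag)
  show ?thesis
    unfolding ky_fan_def eq using A(1,2) by (simp add: A(3) singular_values_diag)
qed

lemma matrix_mult_minus_left: "(- A) ** B = - (A ** B)" for A :: "real^'n^'m"
  by (simp add: matrix_matrix_mult_def vec_eq_iff sum_negf)

lemma orthogonal_matrix_minus: "orthogonal_matrix U \<Longrightarrow> orthogonal_matrix (- U)" for U :: "real^'n^'n"
  by (simp add: orthogonal_matrix_orthonormal_columns column_def orthogonal_def inner_vec_def norm_vec_def)

lemma ky_fan_minus: "ky_fan k (- A) = ky_fan k A"
  using ky_fan_orthogonal[OF orthogonal_matrix_minus[OF orthogonal_matrix_id] orthogonal_matrix_id, of k A]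
  by (simp add: matrix_mult_minus_left)

context
  fixes k :: nat
  assumes k: "k \<le> CARD('n::finite)"
begin

lemma ky_fan_triangle: "ky_fan k (A + B) \<le> ky_fan k A + ky_fan k B" for A B :: "real^'n^'n"
proof -
  obtain P Q S where Z: "orthogonal_matrix P" "orthogonal_matrix Q" "card S = k"
    "P ** diag (ind S) ** Q \<in> dual_ball k" "(P ** diag (ind S) ** Q) \<bullet> (A + B) = ky_fan k (A + B)"
    using ky_fan_attained[OF k, of "A + B"] by blast
  from dual_ballD[OF Z(4), of A] dual_ballD[OF Z(4), of B] Z(5) show ?thesis
    by (simp add: inner_add_right)
qed

lemma additive_pairI:
  assumes "Z \<in> dual_ball k" "Z \<bullet> A = ky_fan k A" "Z \<bullet> B = ky_fan k B"
  shows "ky_fan k (A + B) = ky_fan k A + ky_fan k (B :: real^'n^'n)"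
  using dual_ballD[OF assms(1), of "A + B"] assms(2,3) ky_fan_triangle[of A B]
  by (simp add: inner_add_right)

text \<open>A functional attaining the norm of \<open>A + B\<close> is bounded by the norm on each
  summand, and additivity forces equality in both. It is kept as an explicit partial isometry,
  because its kernel and \<open>Z ** transpose Z ** Z = Z\<close> are exploited later.\<close>

lemma additive_pairD:
  fixes A B :: "real^'n^'n"
  assumes "ky_fan k (A + B) = ky_fan k A + ky_fan k B"
  obtains P Q S where "orthogonal_matrix P" "orthogonal_matrix Q" "card S = k"
    "P ** diag (ind S) ** Q \<in> dual_ball k"
    "(P ** diag (ind S) ** Q) \<bullet> A = ky_fan k A" "(P ** diag (ind S) ** Q) \<bullet> B = ky_fan k B"
proof -
  obtain P Q S where Z: "orthogonal_matrix P" "orthogonal_matrix Q" "card S = k"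
    "P ** diag (ind S) ** Q \<in> dual_ball k" "(P ** diag (ind S) ** Q) \<bullet> (A + B) = ky_fan k (A + B)"
    using ky_fan_attained[OF k, of "A + B"] by blast
  from dual_ballD[OF Z(4), of A] dual_ballD[OF Z(4), of B] Z assms show ?thesis
    by (intro that[of P Q S]) (auto simp: inner_add_right)
qed

lemma ky_fan_zero [simp]: "ky_fan k (0 :: real^'n^'n) = 0"
  using ky_fan_attained[OF k, of 0] by auto

lemma ky_fan_nonneg: "0 \<le> ky_fan k (A :: real^'n^'n)"
  using ky_fan_triangle[of A "- A"] by (simp add: ky_fan_minus)

lemma ky_fan_scaleR: "ky_fan k (c *\<^sub>R A) = \<bar>c\<bar> * ky_fan k (A :: real^'n^'n)"
proof -
  have pos: "ky_fan k (c *\<^sub>R A) \<le> c * ky_fan k A" if "c > 0" for c and A :: "real^'n^'n"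
  proof -
    obtain P Q S where Z: "orthogonal_matrix P" "orthogonal_matrix Q" "card S = k"
      "P ** diag (ind S) ** Q \<in> dual_ball k" "(P ** diag (ind S) ** Q) \<bullet> (c *\<^sub>R A) = ky_fan k (c *\<^sub>R A)"
      using ky_fan_attained[OF k, of "c *\<^sub>R A"] by blast
    from dual_ballD[OF Z(4), of A] Z(5) that show ?thesis
      by (metis inner_scaleR_right mult_le_cancel_left_pos)
  qed
  have pos_eq: "ky_fan k (c *\<^sub>R A) = c * ky_fan k A" if "c > 0" for c
    using pos[OF that, of A] pos[of "1 / c" "c *\<^sub>R A"] that by (simp add: field_simps)
  show ?thesis
    using pos_eq[of c] pos_eq[of "- c"] by (cases c "0 :: real" rule: linorder_cases) (auto simp: ky_fan_minus)
qed

end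

lemma vec_transpose_norm: "orthogonal_matrix Q \<Longrightarrow> norm (x v* Q) = norm x" for Q :: "real^'n^'n"
  using orthogonal_matrix_norm[of "transpose Q" x] by simp

lemma outer_as_diag:
  assumes "norm u = 1" "norm v = 1"
  obtains P Q where "orthogonal_matrix P" "orthogonal_matrix Q" "outer u v = P ** diag (ind {i}) ** Q"
proof -
  obtain P where P: "orthogonal_matrix P" "P *v axis i 1 = u" using orthogonal_matrix_exists_basis[OF assms(1)] by blast
  obtain Q where Q: "orthogonal_matrix Q" "Q *v axis i 1 = v" using orthogonal_matrix_exists_basis[OF assms(2)] by blast
  have "ind {i} = axis i 1" by (simp add: ind_def axis_def vec_eq_iff)
  then have "outer u v = P ** diag (ind {i}) ** transpose Q" by (simp add: mult_diag_axis P Q)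
  with P Q show thesis using that[of P "transpose Q"] by simp
qed

lemma ky_fan_outer:
  fixes u v :: "real^'n"
  assumes k: "1 \<le> k" "k \<le> CARD('n)"
  shows "ky_fan k (outer u v) = norm u * norm v"
proof -
  have unit: "ky_fan k (outer u v) = 1" if uv: "norm u = 1" "norm v = 1" for u v :: "real^'n"
  proof -
    fix i :: 'n
    obtain P Q where PQ: "orthogonal_matrix P" "orthogonal_matrix Q" "outer u v = P ** diag (ind {i}) ** Q"
      using outer_as_diag[OF uv] by blast
    obtain S where S: "card S = k" "ky_fan k (P ** diag (ind {i}) ** Q) = (\<Sum>j\<in>S. \<bar>ind {i} $ j\<bar>)"
      "\<And>a b. a \<in> S \<Longrightarrow> b \<notin> S \<Longrightarrow> \<bar>(ind {i} :: real^'n) $ b\<bar> \<le> \<bar>(ind {i} :: real^'n) $ a\<bar>"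
      using ky_fan_diag[OF PQ(1,2) k(2)] by blast
    have "i \<in> S"
    proof (rule ccontr)
      assume "i \<notin> S"
      moreover obtain a where "a \<in> S" using S(1) k by fastforce
      ultimately show False using S(3)[of a i] by (auto simp: ind_def split: if_splits)
    qed
    then have "(\<Sum>j\<in>S. \<bar>(ind {i} :: real^'n) $ j\<bar>) = (\<Sum>j\<in>S. if j = i then 1 else 0)"
      by (intro sum.cong) (auto simp: ind_def)
    with S PQ \<open>i \<in> S\<close> show ?thesis by simp
  qed
  show ?thesis
  proof (cases "u = 0 \<or> v = 0")
    case True
    then show ?thesis using k by (auto simp: ky_fan_zero)
  next
    case False
    then show ?thesis
      using outer_normalize[of u v] k by (simp add: ky_fan_scaleR unit abs_mult)
  qed
qed

section \<open>The dual ball consists of contractions\<close>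

lemma dual_ball_orthogonal:
  assumes "Z \<in> dual_ball k" "orthogonal_matrix P" "orthogonal_matrix Q"
  shows "P ** Z ** Q \<in> dual_ball k"
  unfolding dual_ball_def
proof safe
  fix A
  have "(P ** Z ** Q) \<bullet> A = Z \<bullet> (transpose P ** (A ** transpose Q))"
    by (metis inner_mult_left_matrix inner_mult_right_matrix)
  also have "\<dots> \<le> ky_fan k (transpose P ** A ** transpose Q)"
    using dual_ballD[OF assms(1)] by (simp add: matrix_mul_assoc)
  also have "\<dots> = ky_fan k A" using assms by (simp add: ky_fan_orthogonal)
  finally show "(P ** Z ** Q) \<bullet> A \<le> ky_fan k A" .
qed

lemma dual_ball_transpose: "Z \<in> dual_ball k \<Longrightarrow> transpose Z \<in> dual_ball k"
  by (simp add: dual_ball_def) (metis inner_transpose' ky_fan_transpose)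

lemma dual_ball_bound:
  fixes Z :: "real^'n^'n"
  assumes k: "1 \<le> k" "k \<le> CARD('n)" and Z: "Z \<in> dual_ball k"
  shows "u \<bullet> (Z *v v) \<le> norm u * norm v"
  using dual_ballD[OF Z, of "outer u v"] k by (simp add: inner_outer_right ky_fan_outer)

lemma dual_ball_norm:
  fixes Z :: "real^'n^'n"
  assumes k: "1 \<le> k" "k \<le> CARD('n)" and Z: "Z \<in> dual_ball k"
  shows "norm (Z *v v) \<le> norm v"
  using dual_ball_bound[OF assms, of "Z *v v" v]
  by (cases "Z *v v = 0") (auto simp: power2_norm_eq_inner[symmetric] power2_eq_square)

text \<open>Equality in Cauchy-Schwarz: the squared distance from \<open>x\<close> to
  \<open>\<beta> *\<^sub>R y\<close> is at most 0.\<close>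

lemma inner_attains_norm:
  fixes x y :: "'a::real_inner"
  assumes "norm x \<le> \<beta>" "norm y = 1" "y \<bullet> x = \<beta>"
  shows "x = \<beta> *\<^sub>R y"
proof -
  have "x \<bullet> x \<le> \<beta>\<^sup>2" using assms(1) by (metis norm_ge_zero power2_norm_eq_inner power_mono)
  moreover have "y \<bullet> y = 1" using assms by (simp add: norm_eq_1)
  ultimately have "(x - \<beta> *\<^sub>R y) \<bullet> (x - \<beta> *\<^sub>R y) \<le> 0"
    using assms by (simp add: inner_diff_left inner_diff_right inner_commute power2_eq_square)
  then show ?thesis by (metis eq_iff_diff_eq_0 inner_eq_zero_iff inner_ge_zero order_antisym)
qed

text \<open>\<open>Z\<close> and its transpose are contractions, so
  \<open>u \<bullet> (Z *v v) = 1\<close> is an equality case of Cauchy-Schwarz for both.\<close>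

lemma dual_ball_fix:
  fixes Z :: "real^'n^'n"
  assumes k: "1 \<le> k" "k \<le> CARD('n)" and Z: "Z \<in> dual_ball k"
    and uv: "norm u = 1" "norm v = 1" and eq: "u \<bullet> (Z *v v) = 1"
  shows "Z *v v = u" "u v* Z = v"
proof -
  have *: "x = y" if "norm x \<le> 1" "norm y = 1" "y \<bullet> x = 1" for x y :: "real^'n"
    using inner_attains_norm[OF that] by simp
  show "Z *v v = u" using dual_ball_norm[OF k Z, of v] uv eq by (intro *) auto
  show "u v* Z = v"
    using dual_ball_norm[OF k dual_ball_transpose[OF Z], of u] uv eq
    by (intro *) (auto simp: dot_lmul_matrix inner_commute[of v])
qed

lemma outer_in_dual_ball:
  fixes u v :: "real^'n"
  assumes k: "1 \<le> k" "k \<le> CARD('n)" and uv: "norm u = 1" "norm v = 1"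
  shows "outer u v \<in> dual_ball k"
proof -
  fix i :: 'n
  obtain P Q where "orthogonal_matrix P" "orthogonal_matrix Q" "outer u v = P ** diag (ind {i}) ** Q"
    using outer_as_diag[OF uv] by blast
  then show ?thesis using k by (simp add: ind_in_dual_ball)
qed

lemma norm_le_ky_fan:
  fixes M :: "real^'n^'n"
  assumes k: "1 \<le> k" "k \<le> CARD('n)" and y: "norm y = 1"
  shows "norm (M *v y) \<le> ky_fan k M"
proof (cases "M *v y = 0")
  case True
  then show ?thesis using k by (simp add: ky_fan_nonneg)
next
  case False
  then have "outer ((M *v y) /\<^sub>R norm (M *v y)) y \<in> dual_ball k"
    using y by (intro outer_in_dual_ball k) simp_all
  from dual_ballD[OF this, of M] False show ?thesis
    by (simp add: inner_outer power2_norm_eq_inner[symmetric] power2_eq_square field_simps)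
qed

section \<open>Additive partners of rank one matrices\<close>

lemma exists_ne_index:
  assumes "2 \<le> CARD('n::finite)"
  obtains i j :: "'n::finite" where "i \<noteq> j"
proof (rule ccontr)
  assume "\<not> thesis"
  then have "\<And>i j :: 'n. i = j" using that by blast
  then have "(UNIV :: 'n set) \<subseteq> {undefined}" by auto
  then have "CARD('n) \<le> 1" by (metis card_mono card.empty card_insert_disjoint empty_iff finite.emptyI finite.insertI One_nat_def)
  then show False using assms by simp
qed

lemma orthogonal_matrix_two_columns:
  fixes u x :: "real^'n"
  assumes "i \<noteq> j" "norm u = 1" "norm x = 1" "u \<bullet> x = 0"
  obtains P where "orthogonal_matrix P" "P *v axis i 1 = u" "P *v axis j 1 = x"
proof (rule orthogonal_matrix_pair[of u "axis i 1" x "axis j 1"])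
  show "u \<bullet> u = axis i 1 \<bullet> (axis i 1 :: real^'n)" "x \<bullet> x = axis j 1 \<bullet> (axis j 1 :: real^'n)"
    using assms by (simp_all add: norm_eq_1 inner_axis_axis)
  show "u \<bullet> x = axis i 1 \<bullet> (axis j 1 :: real^'n)"
    using assms by (simp add: inner_axis_axis)
qed (use that in blast)

lemma outer_add_in_dual_ball:
  fixes u v x y :: "real^'n"
  assumes k: "2 \<le> k" "k \<le> CARD('n)" and "norm u = 1" "norm v = 1" "norm x = 1" "norm y = 1"
    and "u \<bullet> x = 0" "v \<bullet> y = 0"
  shows "outer u v + outer x y \<in> dual_ball k"
proof -
  obtain i j :: 'n where ij: "i \<noteq> j" using exists_ne_index k by (meson order.trans)
  obtain P where P: "orthogonal_matrix P" "P *v axis i 1 = u" "P *v axis j 1 = x"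
    using orthogonal_matrix_two_columns[OF ij] assms by metis
  obtain Q where Q: "orthogonal_matrix Q" "Q *v axis i 1 = v" "Q *v axis j 1 = y"
    using orthogonal_matrix_two_columns[OF ij] assms by metis
  have "outer u v + outer x y = P ** diag (ind {i, j}) ** transpose Q"
    by (simp add: ind_pair[OF ij] mult_diag_add mult_diag_axis P Q)
  moreover have "card {i, j} \<le> k" using k ij by simp
  ultimately show ?thesis using P Q k by (simp add: ind_in_dual_ball)
qed

lemma exists_unit_orthogonal:
  fixes u :: "real^'n"
  assumes "2 \<le> CARD('n)"
  obtains x where "norm x = 1" "u \<bullet> x = 0"
proof -
  have "\<exists>x. x \<noteq> 0 \<and> orthogonal u x"
    using assms orthogonal_to_vector_exists[of u] by auto
  then obtain x where "x \<noteq> 0" "u \<bullet> x = 0" by (auto simp: orthogonal_def)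
  then show thesis using that[of "x /\<^sub>R norm x"] by simp
qed

lemma unit_direction:
  fixes u p :: "real^'n"
  assumes "2 \<le> CARD('n)" "u \<bullet> p = 0"
  obtains p' a where "norm p' = 1" "u \<bullet> p' = 0" "p = a *\<^sub>R p'"
proof (cases "p = 0")
  case True
  then show ?thesis using exists_unit_orthogonal[OF assms(1), of u] that by (metis scaleR_zero_left)
next
  case False
  then have "p = norm p *\<^sub>R (p /\<^sub>R norm p)" by simp
  with False show ?thesis using assms(2) by (intro that[of "p /\<^sub>R norm p" "norm p"]) auto
qed

text \<open>The pairs \<open>v, y\<close> and \<open>u, x\<close> have the same Gram matrix, so one
  orthogonal \<open>Q\<close> maps the first to the second. The projection onto a plane containing
  \<open>v\<close> and \<open>y\<close>, followed by \<open>Q\<close>, is a rank two partial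
  isometry that attains both norms.\<close>

lemma rank_one_partners:
  fixes u v x y :: "real^'n"
  assumes k: "2 \<le> k" "k \<le> CARD('n)" and unit: "norm u = 1" "norm v = 1" "norm x = 1" "norm y = 1"
    and eq: "u \<bullet> x = v \<bullet> y"
  shows "ky_fan k (outer u v + outer x y) = ky_fan k (outer u v) + ky_fan k (outer x y)"
proof -
  obtain Q where Q: "orthogonal_matrix Q" "Q *v v = u" "Q *v y = x"
    using orthogonal_matrix_pair[of u v x y] unit eq by (metis norm_eq_1)
  have "2 \<le> CARD('n)" "v \<bullet> (y - (v \<bullet> y) *\<^sub>R v) = 0"
    using k unit by (simp_all add: inner_diff_right norm_eq_1)
  then obtain z b where zb: "norm z = 1" "v \<bullet> z = 0" "y - (v \<bullet> y) *\<^sub>R v = b *\<^sub>R z"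
    using unit_direction by blast
  define a where "a = v \<bullet> y"
  have z: "norm z = 1" "v \<bullet> z = 0" "y = a *\<^sub>R v + b *\<^sub>R z"
    using zb by (simp_all add: a_def algebra_simps)
  define Z where "Z = outer v v + outer z z"
  have Z: "Z \<in> dual_ball k" unfolding Z_def using k unit z by (intro outer_add_in_dual_ball)
  have "Z *v v = v" "Z *v z = z"
    using z unit by (simp_all add: Z_def matrix_vector_mult_add_rdistrib outer_vec norm_eq_1 inner_commute)
  then have "Z *v y = y" by (simp add: z matrix_vector_right_distrib matrix_vector_mult_scaleR)
  have ip: "u \<bullet> u = 1" "x \<bullet> x = 1" using unit by (simp_all add: norm_eq_1)
  have "Q ** Z ** mat 1 \<in> dual_ball k"
    by (rule dual_ball_orthogonal[OF Z Q(1) orthogonal_matrix_id])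
  then show ?thesis
  proof (rule additive_pairI[OF k(2)])
    show "(Q ** Z ** mat 1) \<bullet> outer u v = ky_fan k (outer u v)"
      using k unit by (simp add: inner_outer_right ky_fan_outer Q \<open>Z *v v = v\<close> ip flip: matrix_vector_mul_assoc)
    show "(Q ** Z ** mat 1) \<bullet> outer x y = ky_fan k (outer x y)"
      using k unit by (simp add: inner_outer_right ky_fan_outer Q \<open>Z *v y = y\<close> ip flip: matrix_vector_mul_assoc)
  qed
qed

text \<open>The dual form of the claim that the partners of \<open>outer u v\<close> span
  everything. The bilinear form \<open>g\<close> of \<open>X\<close> vanishes on unit pairs at equal
  angles to \<open>u\<close> and \<open>v\<close>, which is enough to kill each block of the
  splitting along \<open>u\<close>, \<open>v\<close> and their complements.\<close>

lemma rank_one_partners_span: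
  fixes u v :: "real^'n"
  assumes k: "2 \<le> k" "k \<le> CARD('n)" and uv: "norm u = 1" "norm v = 1"
    and X: "\<And>B. ky_fan k (outer u v + B) = ky_fan k (outer u v) + ky_fan k B \<Longrightarrow> X \<bullet> B = 0"
  shows "X = 0"
proof -
  define g where "g x y = x \<bullet> (X *v y)" for x y
  have add: "g (x + x') y = g x y + g x' y" "g x (y + y') = g x y + g x y'"
    "g (c *\<^sub>R x) y = c * g x y" "g x (c *\<^sub>R y) = c * g x y" "g x (- y) = - g x y" for x x' y y' c
    by (simp_all add: g_def inner_add_left inner_add_right matrix_vector_right_distrib matrix_vector_mult_scaleR)
       (simp add: matrix_vector_mult_def inner_vec_def sum_negf)
  have g0: "g x y = 0" if "norm x = 1" "norm y = 1" "u \<bullet> x = v \<bullet> y" for x y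
    using X[OF rank_one_partners[OF k uv that]] by (simp add: g_def inner_outer_right)
  have uv0: "g u v = 0" using uv by (intro g0) (auto simp: norm_eq_1)
  have *: "g p q = 0 \<and> g u q + g p v = 0"
    if "norm p = 1" "norm q = 1" "u \<bullet> p = 0" "v \<bullet> q = 0" for p q
  proof
    show pq: "g p q = 0" using that by (intro g0) auto
    \<comment> \<open>A rational point on the unit circle: both arguments are unit vectors, with
      inner product \<open>3/5\<close> with \<open>u\<close> and \<open>v\<close>
      respectively.\<close>
    have "g ((3/5) *\<^sub>R u + (4/5) *\<^sub>R p) ((3/5) *\<^sub>R v + (4/5) *\<^sub>R q) = 0"
      by (rule g0) (use that uv in \<open>auto simp: norm_eq_1 inner_add_left inner_add_right inner_commute\<close>)
    then show "g u q + g p v = 0" by (simp add: add uv0 pq)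
  qed
  \<comment> \<open>Replacing \<open>q\<close> by \<open>-q\<close> changes the sign of only one
    summand, so both vanish.\<close>
  have **: "g p q = 0 \<and> g u q = 0 \<and> g p v = 0"
    if "norm p = 1" "norm q = 1" "u \<bullet> p = 0" "v \<bullet> q = 0" for p q
    using *[of p q] *[of p "- q"] that by (simp add: add)
  have 2: "2 \<le> CARD('n)" using k by simp
  have unit_zero: "g p q = 0 \<and> g u q = 0 \<and> g p v = 0" if "u \<bullet> p = 0" "v \<bullet> q = 0" for p q
  proof -
    obtain p' a where p': "norm p' = 1" "u \<bullet> p' = 0" "p = a *\<^sub>R p'"
      using unit_direction[OF 2 \<open>u \<bullet> p = 0\<close>] by blast
    obtain q' b where q': "norm q' = 1" "v \<bullet> q' = 0" "q = b *\<^sub>R q'"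
      using unit_direction[OF 2 \<open>v \<bullet> q = 0\<close>] by blast
    from **[of p' q'] p' q' show ?thesis by (auto simp: add)
  qed
  have "g x y = 0" for x y
  proof -
    define p q where "p = x - (u \<bullet> x) *\<^sub>R u" and "q = y - (v \<bullet> y) *\<^sub>R v"
    have "u \<bullet> p = 0" "v \<bullet> q = 0" using uv by (simp_all add: p_def q_def inner_diff_right norm_eq_1)
    from unit_zero[OF this] have "g ((u \<bullet> x) *\<^sub>R u + p) ((v \<bullet> y) *\<^sub>R v + q) = 0" by (simp add: add uv0)
    then show ?thesis by (simp add: p_def q_def)
  qed
  then have "X *v y = 0" for y unfolding g_def by (metis inner_eq_zero_iff)
  then show ?thesis by (simp add: matrix_eq)
qed

text \<open>The dual ball is invariant under \<open>Z \<mapsto> Z ** Q\<close>, so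
  \<open>transpose Z ** A\<close> pairs most strongly with the identity among orthogonal matrices;
  hence it is symmetric and positive semidefinite. Applied to the transposes, this makes
  \<open>Z ** transpose A\<close> symmetric as well.\<close>

lemma attained_symmetric:
  fixes Z A :: "real^'n^'n"
  assumes Z: "Z \<in> dual_ball k" and eq: "Z \<bullet> A = ky_fan k A"
  shows "(Z *v x) \<bullet> (A *v y) = (Z *v y) \<bullet> (A *v x)"
    and "0 \<le> (Z *v x) \<bullet> (A *v x)"
    and "(x v* Z) \<bullet> (y v* A) = (y v* Z) \<bullet> (x v* A)"
proof -
  have max: "(transpose Z ** A) \<bullet> Q \<le> (transpose Z ** A) \<bullet> mat 1"
    if "Z \<in> dual_ball k" "Z \<bullet> A = ky_fan k A" "orthogonal_matrix Q" for Z A Q :: "real^'n^'n"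
  proof -
    have "(transpose Z ** A) \<bullet> Q = A \<bullet> (Z ** Q)"
      by (simp add: inner_mult_left_matrix)
    also have "\<dots> = (mat 1 ** Z ** Q) \<bullet> A" by (simp add: inner_commute)
    also have "\<dots> \<le> ky_fan k A"
      by (intro dual_ballD dual_ball_orthogonal that orthogonal_matrix_id)
    also have "\<dots> = (transpose Z ** A) \<bullet> mat 1"
      using that(2) by (simp add: inner_mult_left_matrix inner_commute[of A Z])
    finally show ?thesis .
  qed
  have eval: "x \<bullet> ((transpose Z ** A) *v y) = (Z *v x) \<bullet> (A *v y)" for Z A :: "real^'n^'n" and x y
    by (metis dot_lmul_matrix matrix_vector_mul_assoc vector_transpose_matrix)
  have sym: "(Z *v x) \<bullet> (A *v y) = (Z *v y) \<bullet> (A *v x)"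
    if "Z \<in> dual_ball k" "Z \<bullet> A = ky_fan k A" for Z A :: "real^'n^'n" and x y
    using maximal_trace_symmetric[OF max[OF that], of x y] unfolding eval by simp
  show "(Z *v x) \<bullet> (A *v y) = (Z *v y) \<bullet> (A *v x)" by (rule sym[OF Z eq])
  show "0 \<le> (Z *v x) \<bullet> (A *v x)"
    using maximal_trace_psd[OF max[OF Z eq], of x] unfolding eval by simp
  show "(x v* Z) \<bullet> (y v* A) = (y v* Z) \<bullet> (x v* A)"
    using sym[OF dual_ball_transpose[OF Z], of "transpose A" x y] eq
    by (simp add: inner_transpose ky_fan_transpose)
qed

section \<open>Linear preservers of rank one matrices\<close>

lemma separating_vector:
  fixes a c :: "'a::real_inner"
  assumes "\<nexists>t. c = t *\<^sub>R a"
  obtains x where "a \<bullet> x = 0" "c \<bullet> x \<noteq> 0"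
proof -
  define x where "x = c - ((a \<bullet> c) / (a \<bullet> a)) *\<^sub>R a"
  have "x \<noteq> 0" using assms by (auto simp: x_def)
  have "a \<bullet> x = 0" by (simp add: x_def inner_diff_right)
  moreover have "c \<bullet> x = x \<bullet> x"
    using \<open>a \<bullet> x = 0\<close> by (subst (1) x_def) (simp add: x_def inner_diff_left)
  ultimately show thesis using that \<open>x \<noteq> 0\<close> by simp
qed

text \<open>If neither factor pair is parallel, test vectors that kill \<open>a\<close> and
  \<open>b\<close> but not \<open>c\<close> and \<open>d\<close> show that \<open>outer c d\<close>
  is a multiple of the right-hand side; comparing coefficients leaves
  \<open>outer a b = 0\<close>.\<close>

lemma rank_one_sum:
  assumes nz: "a \<noteq> 0" "b \<noteq> 0" "c \<noteq> 0" and eq: "outer a b + outer c d = outer e f"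
  shows "(\<exists>t. c = t *\<^sub>R a) \<or> (\<exists>t. d = t *\<^sub>R b)"
proof (rule ccontr)
  assume contra: "\<not> ?thesis"
  obtain x where "a \<bullet> x = 0" "c \<bullet> x \<noteq> 0" using separating_vector contra by blast
  obtain y where "b \<bullet> y = 0" "d \<bullet> y \<noteq> 0" using separating_vector contra by blast
  have "(outer a b + outer c d) *v y = outer e f *v y" by (simp only: eq)
  then have 1: "(d \<bullet> y) *\<^sub>R c = (f \<bullet> y) *\<^sub>R e"
    using \<open>b \<bullet> y = 0\<close> by (simp add: matrix_vector_mult_add_rdistrib outer_vec)
  have "x v* (outer a b + outer c d) = x v* outer e f" by (simp only: eq)
  then have 2: "(c \<bullet> x) *\<^sub>R d = (e \<bullet> x) *\<^sub>R f"
    using \<open>a \<bullet> x = 0\<close> by (simp add: vector_matrix_mult_add_rdistrib vec_outer)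
  have "((d \<bullet> y) * (c \<bullet> x)) *\<^sub>R outer c d = outer ((d \<bullet> y) *\<^sub>R c) ((c \<bullet> x) *\<^sub>R d)"
    by (simp add: outer_bilinear)
  also have "\<dots> = ((f \<bullet> y) * (e \<bullet> x)) *\<^sub>R outer e f"
    by (simp add: 1 2 outer_bilinear)
  finally have 3: "((d \<bullet> y) * (c \<bullet> x)) *\<^sub>R outer c d = ((f \<bullet> y) * (e \<bullet> x)) *\<^sub>R (outer a b + outer c d)"
    by (simp only: eq)
  from arg_cong[OF 3, of "\<lambda>M. M *v y"] have "((d \<bullet> y) * (c \<bullet> x) * (d \<bullet> y)) *\<^sub>R c = ((f \<bullet> y) * (e \<bullet> x) * (d \<bullet> y)) *\<^sub>R c"
    using \<open>b \<bullet> y = 0\<close>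
    by (simp add: matrix_vector_mult_add_rdistrib outer_vec scaleR_matrix_vector_assoc[symmetric])
  then have "(d \<bullet> y) * (c \<bullet> x) = (f \<bullet> y) * (e \<bullet> x)"
    using nz \<open>d \<bullet> y \<noteq> 0\<close> by simp
  with 3 have "((d \<bullet> y) * (c \<bullet> x)) *\<^sub>R outer a b = 0"
    by (simp add: scaleR_right_distrib)
  then show False
    using nz \<open>c \<bullet> x \<noteq> 0\<close> \<open>d \<bullet> y \<noteq> 0\<close> by (simp add: outer_eq_0_iff)
qed

text \<open>For \<open>w\<close> independent of \<open>v0\<close>, the factors at \<open>w\<close>
  and at \<open>v0\<close> both agree with the factor at \<open>w + v0\<close>, since
  \<open>g\<close> is injective.\<close>

lemma linear_pointwise_parallel:
  fixes g g' :: "'a::real_vector \<Rightarrow> 'b::real_vector"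
  assumes g: "linear g" "inj g" and g': "linear g'" and par: "\<And>v. v \<noteq> 0 \<Longrightarrow> \<exists>t. g' v = t *\<^sub>R g v"
  shows "\<exists>t. \<forall>v. g' v = t *\<^sub>R g v"
proof (cases "\<exists>v0::'a. v0 \<noteq> 0")
  case True
  then obtain v0 :: 'a where v0: "v0 \<noteq> 0" by blast
  obtain t0 where t0: "g' v0 = t0 *\<^sub>R g v0" using par v0 by blast
  have "g' w = t0 *\<^sub>R g w" for w
  proof (cases "\<exists>c. w = c *\<^sub>R v0")
    case True
    then show ?thesis by (auto simp: linear_cmul[OF g(1)] linear_cmul[OF g'] t0)
  next
    case False
    then have "w \<noteq> 0" "w + v0 \<noteq> 0" by (metis scaleR_zero_left, metis add_eq_0_iff2 scaleR_minus1_left)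
    obtain t where t: "g' w = t *\<^sub>R g w" using par \<open>w \<noteq> 0\<close> by blast
    obtain s where s: "g' (w + v0) = s *\<^sub>R g (w + v0)" using par \<open>w + v0 \<noteq> 0\<close> by blast
    have "g ((s - t) *\<^sub>R w + (s - t0) *\<^sub>R v0) = 0"
      using s by (simp add: linear_add[OF g(1)] linear_add[OF g'] linear_diff[OF g(1)] linear_cmul[OF g(1)] t t0 algebra_simps)
    then have z: "(s - t) *\<^sub>R w + (s - t0) *\<^sub>R v0 = 0"
      using g by (simp add: linear_injective_0)
    have "s = t"
    proof (rule ccontr)
      assume "s \<noteq> t"
      then have "w = (1 / (s - t)) *\<^sub>R ((s - t) *\<^sub>R w)" by simp
      also have "(s - t) *\<^sub>R w = (t0 - s) *\<^sub>R v0" using z by (simp add: algebra_simps)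
      finally have "w = ((t0 - s) / (s - t)) *\<^sub>R v0" by simp
      with False show False by blast
    qed
    with z v0 have "t = t0" by simp
    with t show ?thesis by simp
  qed
  then show ?thesis by blast
next
  case False
  then have "g' v = 0 *\<^sub>R g v" for v using linear_0[OF g'] by (metis scaleR_zero_left)
  then show ?thesis by blast
qed

lemma vector_matrix_linear_right: "linear (\<lambda>M. x v* M)" for x :: "real^'m"
  by (rule linearI) (simp_all add: vector_matrix_mult_def vec_eq_iff algebra_simps sum.distrib sum_distrib_left)

lemma matrix_vector_linear_left: "linear (\<lambda>M. M *v x)" for x :: "real^'n"
  by (rule linearI) (simp_all add: matrix_vector_mult_add_rdistrib scaleR_matrix_vector_assoc)

text \<open>Contraction with \<open>x\<close> recovers the right factor, which makes it linear in
  \<open>v\<close>.\<close>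

lemma left_factor_map:
  fixes F :: "'a::real_vector \<Rightarrow> real^'n^'m"
  assumes F: "linear F" "x \<noteq> 0" "\<And>v. \<exists>y. F v = outer x y" "\<And>v. v \<noteq> 0 \<Longrightarrow> F v \<noteq> 0"
  obtains g where "linear g" "inj g" "\<And>v. F v = outer x (g v)"
proof
  let ?g = "\<lambda>v. (1 / (x \<bullet> x)) *\<^sub>R (x v* F v)"
  show lin_g: "linear ?g"
    by (intro linear_compose_scale_right)
       (rule linear_compose[OF F(1) vector_matrix_linear_right, unfolded comp_def])
  show eq: "F v = outer x (?g v)" for v
    using F(2) F(3)[of v] by (auto simp: vec_outer)
  show "inj ?g"
    unfolding linear_injective_0[OF lin_g] using eq F(4) by (metis outer_0(2))
qed

text \<open>The maximal linear spaces of matrices of rank at most one fix either the column factor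
  or the row factor. This definition and the next record which kind receives the images of all
  \<open>outer u v\<close> with \<open>u\<close> fixed.\<close>

definition common_left :: "(real^'n^'n \<Rightarrow> real^'n^'n) \<Rightarrow> real^'n \<Rightarrow> real^'n \<Rightarrow> bool" where
  "common_left T u x \<longleftrightarrow> x \<noteq> 0 \<and> (\<forall>v. \<exists>y. T (outer u v) = outer x y)"

definition common_right :: "(real^'n^'n \<Rightarrow> real^'n^'n) \<Rightarrow> real^'n \<Rightarrow> real^'n \<Rightarrow> bool" where
  "common_right T u y \<longleftrightarrow> y \<noteq> 0 \<and> (\<forall>v. \<exists>x. T (outer u v) = outer x y)"

context
  fixes T :: "real^'n^'n \<Rightarrow> real^'n^'n"
  assumes n: "2 \<le> CARD('n)" and lin: "linear T" and bij: "bij T"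
    and rank_one: "\<And>u v. \<exists>x y. T (outer u v) = outer x y"
begin

lemma image_nonzero: "u \<noteq> 0 \<Longrightarrow> v \<noteq> 0 \<Longrightarrow> T (outer u v) \<noteq> 0"
  by (rule linear_outer_nonzero[OF lin bij_is_inj[OF bij]])

lemma common_left_map:
  assumes "common_left T u x" "u \<noteq> 0"
  obtains g where "linear g" "inj g" "\<And>v. T (outer u v) = outer x (g v)"
  by (rule left_factor_map[of "\<lambda>v. T (outer u v)" x])
    (use assms linear_compose[OF linear_outer_right lin] image_nonzero in \<open>auto simp: common_left_def comp_def\<close>)

lemma common_right_map:
  assumes "common_right T u y" "u \<noteq> 0"
  obtains f where "linear f" "inj f" "\<And>v. T (outer u v) = outer (f v) y"
proof -
  obtain f where f: "linear f" "inj f" "\<And>v. transpose (T (outer u v)) = outer y (f v)"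
  proof (rule left_factor_map[of "\<lambda>v. transpose (T (outer u v))" y])
    show "linear (\<lambda>v. transpose (T (outer u v)))"
      using linear_compose[OF linear_compose[OF linear_outer_right lin] linear_transpose] by (simp add: comp_def)
    show "y \<noteq> 0" using assms(1) by (simp add: common_right_def)
    show "\<exists>z. transpose (T (outer u v)) = outer y z" for v
      using assms(1) unfolding common_right_def by (metis transpose_outer)
    show "transpose (T (outer u v)) \<noteq> 0" if "v \<noteq> 0" for v
      using image_nonzero[OF assms(2) that] by (metis outer_0(1) transpose_outer transpose_transpose)
  qed blast
  then have "T (outer u v) = outer (f v) y" for v by (metis transpose_outer transpose_transpose)
  with f show thesis by (intro that)
qed

text \<open>If the right factor is not constant, two images share the left direction
  \<open>x1\<close> and have independent right factors. A third image with another left direction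
  would need a right factor parallel to both.\<close>

lemma common_left_or_right:
  assumes u: "u \<noteq> 0"
  shows "(\<exists>x. common_left T u x) \<or> (\<exists>y. common_right T u y)"
proof -
  fix i :: 'n
  define v1 :: "real^'n" where "v1 = axis i 1"
  have v1: "v1 \<noteq> 0" by (simp add: v1_def)
  obtain x1 y1 where 1: "T (outer u v1) = outer x1 y1" using rank_one by blast
  have nz1: "x1 \<noteq> 0" "y1 \<noteq> 0" using image_nonzero[OF u v1] 1 by auto
  have key: "(\<exists>t. a = t *\<^sub>R x) \<or> (\<exists>t. b = t *\<^sub>R y)"
    if "T (outer u v) = outer x y" "T (outer u w) = outer a b" "x \<noteq> 0" "y \<noteq> 0" "a \<noteq> 0" for v w x y a b
  proof -
    obtain e f where "T (outer u (v + w)) = outer e f" using rank_one by blast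
    then have "outer x y + outer a b = outer e f"
      using that by (simp add: outer_add_right linear_add[OF lin])
    then show ?thesis using rank_one_sum that by blast
  qed
  show ?thesis
  proof (cases "\<forall>v. \<exists>x. T (outer u v) = outer x y1")
    case True
    then show ?thesis using nz1 by (auto simp: common_right_def)
  next
    case False
    then obtain v2 where v2: "\<And>x. T (outer u v2) \<noteq> outer x y1" by blast
    obtain x2 y2 where 2: "T (outer u v2) = outer x2 y2" using rank_one by blast
    have npar: "y2 \<noteq> t *\<^sub>R y1" for t
      using v2[of "t *\<^sub>R x2"] 2 by (auto simp: outer_bilinear)
    have nz2: "x2 \<noteq> 0" "y2 \<noteq> 0" using v2[of 0] 2 by auto
    obtain t where t: "x2 = t *\<^sub>R x1" using key[OF 1 2 nz1 nz2(1)] npar by blast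
    have "\<exists>y. T (outer u v) = outer x1 y" for v
    proof (cases "v = 0")
      case True
      then show ?thesis by (metis linear_0[OF lin] outer_0(2))
    next
      case False
      obtain a b where ab: "T (outer u v) = outer a b" using rank_one by blast
      then have nz: "a \<noteq> 0" "b \<noteq> 0" using image_nonzero[OF u False] by auto
      have "\<exists>t. a = t *\<^sub>R x1"
      proof (rule ccontr)
        assume *: "\<not> (\<exists>t. a = t *\<^sub>R x1)"
        then obtain s where s: "b = s *\<^sub>R y1" using key[OF 1 ab nz1 nz(1)] by blast
        have "\<not> (\<exists>r. a = r *\<^sub>R x2)" using * t by auto
        then obtain r where r: "b = r *\<^sub>R y2" using key[OF 2 ab nz2 nz(1)] by blast
        with nz have "r \<noteq> 0" by auto
        have "y2 = (s / r) *\<^sub>R y1" using r s \<open>r \<noteq> 0\<close>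
          by (metis divide_inverse_commute left_inverse scaleR_one scaleR_scaleR)
        with npar show False by blast
      qed
      then show ?thesis using ab by (metis outer_scaleR_left outer_scaleR_right)
    qed
    then show ?thesis using nz1 by (auto simp: common_left_def)
  qed
qed

text \<open>Pigeonhole: since \<open>outer (u + u') v\<close> has an image of rank at most one,
  \<open>f v\<close> is parallel to \<open>x\<close> or \<open>g v\<close> is parallel to
  \<open>y\<close>. Among \<open>a\<close>, \<open>b\<close> and \<open>a + b\<close> one
  alternative occurs twice, and injectivity would make two of these pairwise independent vectors
  proportional.\<close>

lemma not_left_and_right:
  assumes "common_left T u x" "common_right T u' y" "u \<noteq> 0" "u' \<noteq> 0"
  shows False
proof -
  obtain g where g: "linear g" "inj g" "\<And>v. T (outer u v) = outer x (g v)"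
    using common_left_map assms by blast
  obtain f where f: "linear f" "inj f" "\<And>v. T (outer u' v) = outer (f v) y"
    using common_right_map assms by blast
  have x: "x \<noteq> 0" and y: "y \<noteq> 0" using assms by (auto simp: common_left_def common_right_def)
  have g0: "g v \<noteq> 0" and f0: "f v \<noteq> 0" if "v \<noteq> 0" for v
    using that g(2) f(2) unfolding linear_injective_0[OF g(1)] linear_injective_0[OF f(1)] by blast+
  have key: "(\<exists>t. f v = t *\<^sub>R x) \<or> (\<exists>t. g v = t *\<^sub>R y)" if "v \<noteq> 0" for v
  proof -
    obtain a b where "T (outer (u + u') v) = outer a b" using rank_one by blast
    then have "outer x (g v) + outer (f v) y = outer a b"
      by (simp add: outer_add_left linear_add[OF lin] f g)
    then have "(\<exists>t. f v = t *\<^sub>R x) \<or> (\<exists>t. y = t *\<^sub>R g v)"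
      using rank_one_sum[OF x g0[OF that] f0[OF that]] by blast
    then show ?thesis
    proof
      assume "\<exists>t. y = t *\<^sub>R g v"
      then obtain t where t: "y = t *\<^sub>R g v" by blast
      with y have "t \<noteq> 0" by auto
      with t have "g v = (1 / t) *\<^sub>R y" by simp
      then show ?thesis by blast
    qed blast
  qed
  have dep: "\<exists>t. w = t *\<^sub>R v"
    if h: "linear h" "inj h" "h v = s *\<^sub>R z" "h w = r *\<^sub>R z" and v: "v \<noteq> 0" for h :: "real^'n \<Rightarrow> real^'n" and v w z s r
  proof -
    have "h (s *\<^sub>R w - r *\<^sub>R v) = 0"
      using h by (simp add: linear_diff linear_cmul)
    then have "s *\<^sub>R w - r *\<^sub>R v = 0" using h(2) unfolding linear_injective_0[OF h(1)] by blast
    then have "s *\<^sub>R w = r *\<^sub>R v" by simp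
    moreover have "s \<noteq> 0" using h(2,3) v unfolding linear_injective_0[OF h(1)] by auto
    ultimately have "w = (r / s) *\<^sub>R v"
      by (metis divide_inverse_commute left_inverse scaleR_one scaleR_scaleR)
    then show ?thesis by blast
  qed
  define a :: "real^'n" where "a = axis undefined 1"
  obtain b where ab: "a \<bullet> a = 1" "b \<bullet> b = 1" "a \<bullet> b = 0"
    using exists_unit_orthogonal[OF n, of a] by (auto simp: a_def norm_eq_1)
  have np: "b \<noteq> t *\<^sub>R a" "a + b \<noteq> t *\<^sub>R a" "a + b \<noteq> t *\<^sub>R b" for t
    using ab inner_commute[of b a] by (auto dest: arg_cong[of _ _ "inner b"] arg_cong[of _ _ "inner a"] simp: inner_add_right)
  have nz: "a \<noteq> 0" "b \<noteq> 0" "a + b \<noteq> 0" using ab np(2)[of 0] by auto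
  have one: "\<not> ((\<exists>t. h a = t *\<^sub>R z) \<and> (\<exists>t. h b = t *\<^sub>R z)) \<and>
     \<not> ((\<exists>t. h a = t *\<^sub>R z) \<and> (\<exists>t. h (a + b) = t *\<^sub>R z)) \<and>
     \<not> ((\<exists>t. h b = t *\<^sub>R z) \<and> (\<exists>t. h (a + b) = t *\<^sub>R z))"
    if h: "linear h" "inj h" for h :: "real^'n \<Rightarrow> real^'n" and z
    using dep[OF h _ _ nz(1)] dep[OF h _ _ nz(2)] np by blast
  from one[OF f(1,2), of x] one[OF g(1,2), of y] key[OF nz(1)] key[OF nz(2)] key[OF nz(3)]
  show False by blast
qed

text \<open>When the left factors of \<open>u\<close> and \<open>w\<close> are independent,
  \<open>rank_one_sum\<close> makes their right maps proportional. Every \<open>u\<close> is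
  independent in this sense of \<open>u0\<close> or of \<open>u1\<close>, so one right map
  \<open>G\<close> serves for all.\<close>

lemma rank_one_preserver_left:
  assumes left: "\<And>u. u \<noteq> 0 \<Longrightarrow> \<exists>x. common_left T u x"
  obtains f g where "linear f" "linear g" "\<And>u v. T (outer u v) = outer (f u) (g v)"
proof -
  have "\<exists>x g. x \<noteq> 0 \<and> linear g \<and> inj g \<and> (\<forall>v. T (outer u v) = outer x (g v))" if "u \<noteq> 0" for u
    using left[OF that] common_left_map that by (metis common_left_def)
  then obtain x g where xg: "\<And>u. u \<noteq> 0 \<Longrightarrow> x u \<noteq> 0 \<and> linear (g u) \<and> inj (g u)"
    "\<And>u v. u \<noteq> 0 \<Longrightarrow> T (outer u v) = outer (x u) (g u v)" by metis
  define u0 :: "real^'n" where "u0 = axis undefined 1"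
  have u0: "u0 \<noteq> 0" by (simp add: u0_def)
  have g_par: "\<exists>t. \<forall>v. g w v = t *\<^sub>R g u v" if u: "u \<noteq> 0" and w: "w \<noteq> 0" and np: "\<nexists>t. x w = t *\<^sub>R x u" for u w
  proof (rule linear_pointwise_parallel)
    fix v :: "real^'n" assume v: "v \<noteq> 0"
    obtain a b where "T (outer (u + w) v) = outer a b" using rank_one by blast
    then have "outer (x u) (g u v) + outer (x w) (g w v) = outer a b"
      by (simp add: outer_add_left linear_add[OF lin] xg(2) u w)
    then show "\<exists>t. g w v = t *\<^sub>R g u v"
      using rank_one_sum[of "x u" "g u v" "x w" "g w v"] xg(1)[OF u] xg(1)[OF w] np v
      by (metis linear_injective_0)
  qed (use xg u w in auto)
  \<comment> \<open>Otherwise a vector orthogonal to \<open>x u0\<close> would annihilate all images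
    from the left, contrary to surjectivity.\<close>
  obtain u1 where u1: "u1 \<noteq> 0" "\<nexists>t. x u1 = t *\<^sub>R x u0"
  proof (rule ccontr)
    assume "\<not> thesis"
    then have all: "\<And>u. u \<noteq> 0 \<Longrightarrow> \<exists>t. x u = t *\<^sub>R x u0" using that by blast
    obtain z where z: "norm z = 1" "x u0 \<bullet> z = 0" using exists_unit_orthogonal[OF n] by blast
    have "(\<lambda>X. z v* T X) = (\<lambda>X. 0)"
    proof (rule linear_eq_on_outer)
      show "linear (\<lambda>X. z v* T X)"
        using linear_compose[OF lin vector_matrix_linear_right[of z]] by (simp add: comp_def)
      show "z v* T (outer u v) = 0" for u v
      proof (cases "u = 0")
        case False
        then show ?thesis using all[OF False] z by (auto simp: xg(2) vec_outer)
      qed (simp add: linear_0[OF lin])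
    qed (rule linear_zero)
    moreover obtain X where "T X = outer z z" using bij by (metis bij_pointE)
    ultimately have "z v* outer z z = 0" by metis
    then show False using z by (auto simp: vec_outer norm_eq_1)
  qed
  have all_par: "\<exists>t. \<forall>v. g u v = t *\<^sub>R g u0 v" if u: "u \<noteq> 0" for u
  proof (cases "\<exists>t. x u = t *\<^sub>R x u0")
    case False
    then show ?thesis using g_par u0 u by blast
  next
    case True
    have "\<nexists>t. x u = t *\<^sub>R x u1"
    proof
      assume "\<exists>t. x u = t *\<^sub>R x u1"
      then obtain t where t: "x u = t *\<^sub>R x u1" by blast
      then have "t \<noteq> 0" using xg(1)[OF u] by auto
      with t have "x u1 = (1 / t) *\<^sub>R x u" by simp
      with True u1(2) show False by auto
    qed
    then obtain t where "\<forall>v. g u v = t *\<^sub>R g u1 v" using g_par[OF u1(1) u] by blast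
    moreover obtain s where "\<forall>v. g u1 v = s *\<^sub>R g u0 v" using g_par[OF u0 u1] by blast
    ultimately show ?thesis by auto
  qed
  define G where "G = g u0"
  have G: "linear G" "inj G" using xg(1)[OF u0] by (auto simp: G_def)
  have "\<exists>a. \<forall>v. T (outer u v) = outer a (G v)" for u
  proof (cases "u = 0")
    case True
    then show ?thesis by (intro exI[of _ 0]) (simp add: linear_0[OF lin])
  next
    case False
    then obtain t where "\<forall>v. g u v = t *\<^sub>R G v" using all_par by (auto simp: G_def)
    then show ?thesis by (intro exI[of _ "t *\<^sub>R x u"]) (simp add: xg(2)[OF False] outer_bilinear)
  qed
  then obtain a where a: "\<And>u v. T (outer u v) = outer (a u) (G v)" by metis
  define w where "w = G u0"
  have w: "w \<noteq> 0" using G(2) u0 unfolding w_def linear_injective_0[OF G(1)] by blast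
  have a_eq: "a u = (1 / (w \<bullet> w)) *\<^sub>R (T (outer u u0) *v w)" for u
    using w by (simp add: a outer_vec flip: w_def)
  have "linear (\<lambda>u. (1 / (w \<bullet> w)) *\<^sub>R (T (outer u u0) *v w))"
    by (intro linear_compose_scale_right)
       (rule linear_compose[OF linear_compose[OF linear_outer_left lin] matrix_vector_linear_left, unfolded comp_def])
  then have "linear a" by (subst a_eq[abs_def])
  then show thesis using that G(1) a by blast
qed

end

text \<open>A functional supporting both matrices maps the normalised \<open>y\<close> and
  \<open>w\<close> to the normalised \<open>x\<close> and \<open>z\<close>, and its transpose maps
  them back, so the two angles coincide.\<close>

lemma rank_one_partnersD:
  fixes x y z w :: "real^'n"
  assumes k: "1 \<le> k" "k \<le> CARD('n)" and nz: "x \<noteq> 0" "y \<noteq> 0" "z \<noteq> 0" "w \<noteq> 0"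
    and eq: "ky_fan k (outer x y + outer z w) = ky_fan k (outer x y) + ky_fan k (outer z w)"
  shows "(x \<bullet> z) * (norm y * norm w) = (y \<bullet> w) * (norm x * norm z)"
proof -
  obtain P Q S where PQ: "orthogonal_matrix P" "orthogonal_matrix Q" "card S = k"
    "P ** diag (ind S) ** Q \<in> dual_ball k"
    "(P ** diag (ind S) ** Q) \<bullet> outer x y = ky_fan k (outer x y)"
    "(P ** diag (ind S) ** Q) \<bullet> outer z w = ky_fan k (outer z w)"
    using additive_pairD[OF k(2) eq] by blast
  define Z where "Z = P ** diag (ind S) ** Q"
  have Z: "Z \<in> dual_ball k" unfolding Z_def by (rule PQ(4))
  have dual: "Z *v (y /\<^sub>R norm y) = x /\<^sub>R norm x \<and> (x /\<^sub>R norm x) v* Z = y /\<^sub>R norm y"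
    if "x \<noteq> 0" "y \<noteq> 0" "Z \<bullet> outer x y = ky_fan k (outer x y)" for x y
  proof -
    have "(x /\<^sub>R norm x) \<bullet> (Z *v (y /\<^sub>R norm y)) = 1"
      using that k by (simp add: inner_outer_right ky_fan_outer matrix_vector_mult_scaleR field_simps)
    then show ?thesis
      using dual_ball_fix[OF k Z, of "x /\<^sub>R norm x" "y /\<^sub>R norm y"] that by simp
  qed
  have "(x /\<^sub>R norm x) \<bullet> (z /\<^sub>R norm z) = (x /\<^sub>R norm x) \<bullet> (Z *v (w /\<^sub>R norm w))"
    using dual[of z w] PQ nz by (simp add: Z_def)
  also have "\<dots> = (y /\<^sub>R norm y) \<bullet> (w /\<^sub>R norm w)"
    using dual[of x y] PQ nz by (simp add: Z_def flip: dot_lmul_matrix)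
  finally show ?thesis using nz by (simp add: field_simps)
qed

text \<open>For \<open>u\<close> and \<open>v\<close> of equal length, \<open>u + v\<close> and
  \<open>u - v\<close> are orthogonal; orthogonality of their images says that \<open>f u\<close>
  and \<open>f v\<close> have equal length. So all lengths are scaled by one constant.\<close>

lemma orthogonality_preserver:
  fixes f :: "real^'n \<Rightarrow> real^'n"
  assumes f: "linear f" and orth: "\<And>u v. norm u = 1 \<Longrightarrow> norm v = 1 \<Longrightarrow> u \<bullet> v = 0 \<Longrightarrow> f u \<bullet> f v = 0"
    and nz: "\<And>u. u \<noteq> 0 \<Longrightarrow> f u \<noteq> 0"
  obtains c U where "c > 0" "orthogonal_matrix U" "\<And>u. f u = c *\<^sub>R (U *v u)"
proof -
  have orth': "f u \<bullet> f v = 0" if "u \<bullet> v = 0" for u v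
  proof (cases "u = 0 \<or> v = 0")
    case True
    then show ?thesis using linear_0[OF f] by auto
  next
    case False
    with that have "f (u /\<^sub>R norm u) \<bullet> f (v /\<^sub>R norm v) = 0" by (intro orth) auto
    with False show ?thesis by (simp add: linear_cmul[OF f])
  qed
  have eq_norm: "norm (f u) = norm (f v)" if "norm u = norm v" for u v
  proof -
    have "(u + v) \<bullet> (u - v) = 0"
      using that by (simp add: inner_add_left inner_diff_right inner_commute[of v u] norm_eq)
    from orth'[OF this] have "f u \<bullet> f u = f v \<bullet> f v"
      by (simp add: linear_add[OF f] linear_diff[OF f] inner_add_left inner_diff_right inner_commute[of "f v" "f u"])
    then show ?thesis by (simp add: norm_eq)
  qed
  define e :: "real^'n" where "e = axis undefined 1"
  define c where "c = norm (f e)"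
  have c: "c > 0" using nz[of e] by (simp add: c_def e_def)
  have norm_f: "norm (f u) = c * norm u" for u
  proof (cases "u = 0")
    case False
    then have "norm (f (u /\<^sub>R norm u)) = c" unfolding c_def by (intro eq_norm) (simp add: e_def)
    with False show ?thesis by (simp add: linear_cmul[OF f] field_simps)
  qed (simp add: linear_0[OF f])
  have "orthogonal_transformation (\<lambda>u. (1 / c) *\<^sub>R f u)"
    unfolding orthogonal_transformation using c by (simp add: linear_compose_scale_right[OF f] norm_f)
  then have ot: "linear (\<lambda>u. (1 / c) *\<^sub>R f u)" "orthogonal_matrix (matrix (\<lambda>u. (1 / c) *\<^sub>R f u))"
    by (simp_all add: orthogonal_transformation_matrix)
  have "f u = c *\<^sub>R (matrix (\<lambda>u. (1 / c) *\<^sub>R f u) *v u)" for u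
    using c matrix_vector_mul(2)[OF ot(1)] by (simp add: fun_eq_iff flip: matrix_scaleR)
  then show thesis using that c ot by blast
qed

context
  fixes T :: "real^'n^'n \<Rightarrow> real^'n^'n" and k :: nat
  assumes k: "2 \<le> k" "k \<le> CARD('n)" and lin: "linear T" and bij: "bij T"
    and additive: "\<And>A B. ky_fan k (A + B) = ky_fan k A + ky_fan k B
           \<Longrightarrow> ky_fan k (T A + T B) = ky_fan k (T A) + ky_fan k (T B)"
begin

lemma product_form_orthogonal:
  assumes fg: "linear f" "linear g" "\<And>u v. T (outer u v) = outer (f u) (g v)"
  obtains \<gamma> U V where "\<gamma> > 0" "orthogonal_matrix U" "orthogonal_matrix V" "T = (\<lambda>X. \<gamma> *\<^sub>R (U ** X ** V))"
proof -
  have T0: "T (outer u v) \<noteq> 0" if "u \<noteq> 0" "v \<noteq> 0" for u v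
    by (rule linear_outer_nonzero[OF lin bij_is_inj[OF bij] that])
  define e :: "real^'n" where "e = axis undefined 1"
  have e: "e \<noteq> 0" "norm e = 1" by (simp_all add: e_def)
  have f0: "f u \<noteq> 0" if "u \<noteq> 0" for u using T0[OF that e(1)] by (auto simp: fg(3))
  have g0: "g v \<noteq> 0" if "v \<noteq> 0" for v using T0[OF e(1) that] by (auto simp: fg(3))
  have orth: "f u \<bullet> f u' = 0 \<and> g v \<bullet> g v' = 0"
    if "norm u = 1" "norm v = 1" "norm u' = 1" "norm v' = 1" "u \<bullet> u' = 0" "v \<bullet> v' = 0" for u v u' v'
  proof -
    have nz: "u \<noteq> 0" "v \<noteq> 0" "u' \<noteq> 0" "v' \<noteq> 0" using that by auto
    have k1: "1 \<le> k" using k by simp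
    have main: "(f u \<bullet> f u') * (norm (g v) * norm (g v')) = (g v \<bullet> g v') * (norm (f u) * norm (f u'))"
      if "norm u' = 1" "u \<bullet> u' = 0" for u'
    proof (rule rank_one_partnersD[OF k1 k(2)])
      show "ky_fan k (outer (f u) (g v) + outer (f u') (g v')) =
          ky_fan k (outer (f u) (g v)) + ky_fan k (outer (f u') (g v'))"
        unfolding fg(3)[symmetric]
        by (rule additive, rule rank_one_partners) (use that k \<open>norm u = 1\<close> \<open>norm v = 1\<close> \<open>norm v' = 1\<close> \<open>v \<bullet> v' = 0\<close> in auto)
      show "f u' \<noteq> 0" using that by (intro f0) auto
    qed (rule f0[OF nz(1)] g0[OF nz(2)] g0[OF nz(4)])+
    \<comment> \<open>Passing from \<open>u'\<close> to \<open>-u'\<close> reverses the left side of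
      the angle equation and keeps the right side, so both are 0.\<close>
    from main[of u'] main[of "- u'"] that have "(f u \<bullet> f u') * (norm (g v) * norm (g v')) = 0"
      "(g v \<bullet> g v') * (norm (f u) * norm (f u')) = 0"
      by (simp_all add: linear_neg[OF fg(1)])
    then show ?thesis using f0[OF nz(1)] f0[OF nz(3)] g0[OF nz(2)] g0[OF nz(4)] by simp
  qed
  have n: "2 \<le> CARD('n)" using k by simp
  obtain e' where e': "norm e' = 1" "e \<bullet> e' = 0" using exists_unit_orthogonal[OF n] by blast
  obtain c U where U: "c > 0" "orthogonal_matrix U" "\<And>u. f u = c *\<^sub>R (U *v u)"
    by (rule orthogonality_preserver[of f]) (use fg orth[of _ e _ e'] e e' f0 in auto)
  obtain d V where V: "d > 0" "orthogonal_matrix V" "\<And>v. g v = d *\<^sub>R (V *v v)"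
    by (rule orthogonality_preserver[of g]) (use fg orth[of e _ e' _] e e' g0 in auto)
  have "T = (\<lambda>X. (c * d) *\<^sub>R (U ** X ** transpose V))"
    by (rule linear_eq_on_outer[OF lin])
       (simp_all add: linear_compose_scale_right matrix_mul_linear_both fg U V outer_bilinear mult_outer outer_mult mult.commute)
  then show thesis using that[of "c * d" U "transpose V"] U V by simp
qed

end

text \<open>The left and the right type cannot occur together, even for different \<open>u\<close>,
  and composition with the transpose exchanges them.\<close>

lemma rank_one_to_rank_one_form:
  fixes T :: "real^'n^'n \<Rightarrow> real^'n^'n" and k :: nat
  assumes k: "2 \<le> k" "k \<le> CARD('n)" and lin: "linear T" and bij: "bij T"
    and additive: "\<And>A B. ky_fan k (A + B) = ky_fan k A + ky_fan k B
           \<Longrightarrow> ky_fan k (T A + T B) = ky_fan k (T A) + ky_fan k (T B)"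
    and rank_one: "\<And>u v. \<exists>x y. T (outer u v) = outer x y"
  shows "\<exists>\<gamma>>0. \<exists>U V. orthogonal_matrix U \<and> orthogonal_matrix V \<and>
           (T = (\<lambda>X. \<gamma> *\<^sub>R (U ** X ** V)) \<or> T = (\<lambda>X. \<gamma> *\<^sub>R (U ** transpose X ** V)))"
proof -
  have n: "2 \<le> CARD('n)" using k by simp
  note facts = n lin bij rank_one
  show ?thesis
  proof (cases "\<forall>u. u \<noteq> 0 \<longrightarrow> (\<exists>x. common_left T u x)")
    case True
    then obtain f g where fg: "linear f" "linear g" "\<And>u v. T (outer u v) = outer (f u) (g v)"
      using rank_one_preserver_left[OF facts] by metis
    show ?thesis using product_form_orthogonal[OF k lin bij additive fg] by metis
  next
    case False
    then obtain u0 where u0: "u0 \<noteq> 0" "\<And>x. \<not> common_left T u0 x" by blast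
    then obtain y0 where y0: "common_right T u0 y0" using common_left_or_right[OF facts u0(1)] by blast
    define T' where "T' = (\<lambda>X. transpose (T X))"
    have lin': "linear T'" unfolding T'_def using linear_compose[OF lin linear_transpose] by (simp add: comp_def)
    have bij_t: "bij (transpose :: real^'n^'n \<Rightarrow> real^'n^'n)"
      by (rule o_bij[of transpose]) (auto simp: fun_eq_iff)
    have bij': "bij T'" unfolding T'_def using bij_comp[OF bij bij_t] by (simp add: comp_def)
    have rank_one': "\<exists>x y. T' (outer u v) = outer x y" for u v
      using rank_one[of u v] unfolding T'_def by (metis transpose_outer)
    have additive': "ky_fan k (T' A + T' B) = ky_fan k (T' A) + ky_fan k (T' B)"
      if "ky_fan k (A + B) = ky_fan k A + ky_fan k B" for A B
      using additive[OF that] ky_fan_transpose[of k "T A + T B"]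
      by (simp add: T'_def linear_add[OF linear_transpose] ky_fan_transpose)
    have "\<exists>x. common_left T' u x" if u: "u \<noteq> 0" for u
    proof -
      have "\<not> common_left T u x" for x
        using not_left_and_right[OF facts _ y0 u u0(1)] by blast
      then obtain y where "common_right T u y" using common_left_or_right[OF facts u] by blast
      then have "common_left T' u y"
        unfolding common_right_def common_left_def T'_def by (metis transpose_outer)
      then show ?thesis by blast
    qed
    then obtain f g where fg: "linear f" "linear g" "\<And>u v. T' (outer u v) = outer (f u) (g v)"
      using rank_one_preserver_left[OF n lin' bij' rank_one'] by metis
    obtain \<gamma> U V where *: "\<gamma> > 0" "orthogonal_matrix U" "orthogonal_matrix V" "T' = (\<lambda>X. \<gamma> *\<^sub>R (U ** X ** V))"
      using product_form_orthogonal[OF k lin' bij' additive' fg] by metis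
    have "T X = \<gamma> *\<^sub>R (transpose V ** transpose X ** transpose U)" for X
    proof -
      have "T X = transpose (T' X)" by (simp add: T'_def)
      then show ?thesis
        by (simp add: * linear_cmul[OF linear_transpose] matrix_transpose_mul matrix_mul_assoc)
    qed
    then show ?thesis using * by (intro exI[of _ \<gamma>] conjI exI[of _ "transpose V"] exI[of _ "transpose U"]) auto
  qed
qed

section \<open>Additive partners for \<open>k \<ge> n - 1\<close>\<close>

text \<open>This is where \<open>k \<ge> n - 1\<close> acts: the supporting partial isometry kills
  at most a line. If \<open>S\<close> is everything, \<open>l\<close> is arbitrary.\<close>

lemma partial_isometry_kernel:
  fixes S :: "'n::finite set"
  assumes Q: "orthogonal_matrix Q" and P: "orthogonal_matrix P" and S: "CARD('n) \<le> card S + 1"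
  obtains w where "\<And>x. (P ** diag (ind S) ** Q) *v x = 0 \<Longrightarrow> \<exists>a. x = a *\<^sub>R w"
proof -
  have "card (- S) \<le> 1" using S by (simp add: Compl_eq_Diff_UNIV card_Diff_subset)
  then obtain l where l: "- S \<subseteq> {l}" 
    by (metis card_le_Suc0_iff_eq finite One_nat_def subsetI insertCI singletonI all_not_in_conv)
  show thesis
  proof (rule that[of "transpose Q *v axis l 1"])
    fix x assume "(P ** diag (ind S) ** Q) *v x = 0"
    then have "norm (P *v (diag (ind S) *v (Q *v x))) = 0" by (simp add: matrix_vector_mul_assoc matrix_mul_assoc)
    then have "diag (ind S) *v (Q *v x) = 0" by (simp add: orthogonal_matrix_norm[OF P])
    moreover have "(diag (ind S) *v y) $ i = ind S $ i * y $ i" for y i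
      by (simp add: diag_def matrix_vector_mult_def if_distribR if_distrib cong: if_cong)
    ultimately have "ind S $ i * (Q *v x) $ i = 0" for i by (metis zero_index)
    then have "(Q *v x) $ i = 0" if "i \<noteq> l" for i
    proof -
      have "i \<in> S" using that l by blast
      with \<open>\<And>i. ind S $ i * (Q *v x) $ i = 0\<close>[of i] show ?thesis by (simp add: ind_def)
    qed
    then have "Q *v x = ((Q *v x) $ l) *\<^sub>R axis l 1" by (auto simp: vec_eq_iff axis_def)
    moreover have "x = transpose Q *v (Q *v x)"
      using Q by (simp add: matrix_vector_mul_assoc orthogonal_matrixD del: transpose_matrix_vector)
    ultimately show "\<exists>a. x = a *\<^sub>R (transpose Q *v axis l 1)"
      by (metis matrix_vector_mult_scaleR)
  qed
qed

lemma partial_isometry_triple: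
  assumes "orthogonal_matrix P" "orthogonal_matrix Q" "Z = P ** diag (ind S) ** Q"
  shows "Z ** transpose Z ** Z = Z"
proof -
  have "Z ** transpose Z ** Z = P ** diag (ind S) ** (Q ** transpose Q) ** diag (ind S) ** (transpose P ** P) ** diag (ind S) ** Q"
    by (simp add: assms matrix_transpose_mul transpose_diag matrix_mul_assoc)
  also have "\<dots> = P ** (diag (ind S) ** diag (ind S) ** diag (ind S)) ** Q"
    using assms by (simp add: orthogonal_matrixD matrix_mul_assoc)
  also have "diag (ind S) ** diag (ind S) ** diag (ind S) = diag (ind S)"
    by (simp add: vec_eq_iff mult_diag) (simp add: diag_def ind_def)
  finally show ?thesis by (simp add: assms)
qed

text \<open>On the eigenspaces of \<open>diag s\<close> with positive eigenvalue, a partial isometry attaining the norm of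
  \<open>diag s\<close> is an orthogonal projection.\<close>

lemma attained_projection:
  fixes Z :: "real^'n^'n"
  assumes Z: "Z \<in> dual_ball k" and eq: "Z \<bullet> diag s = ky_fan k (diag s)"
    and triple: "Z ** transpose Z ** Z = Z" and pos: "\<And>i. 0 \<le> s $ i" "0 < s $ i"
  obtains p q where "axis i 1 = p + q" "Z *v p = p" "p v* Z = p" "Z *v q = 0" "q v* Z = 0"
proof -
  have sym1: "s $ m * Z $ m $ i = s $ i * Z $ i $ m" for i m
    using attained_symmetric(1)[OF Z eq, of "axis i 1" "axis m 1"]
    by (simp add: matrix_vector_mult_basis column_def inner_vec_def diag_def if_distrib cong: if_cong)
       (simp add: mult.commute)
  have sym2: "s $ m * Z $ i $ m = s $ i * Z $ m $ i" for i m
    using attained_symmetric(3)[OF Z eq, of "axis i 1" "axis m 1"]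
    by (simp add: matrix_vector_mult_basis column_def inner_vec_def diag_def transpose_def if_distrib
         cong: if_cong flip: transpose_matrix_vector) (simp add: mult.commute)
  \<comment> \<open>The two symmetries combine to \<open>s_m^2 Z_mi = s_i^2 Z_mi\<close>, so
    \<open>Z\<close> respects the eigenspaces of \<open>diag s\<close> with positive
    eigenvalue.\<close>
  have zero: "Z $ m $ i = 0" if "0 < s $ i" "s $ m \<noteq> s $ i" for i m
  proof -
    have "s $ m * (s $ m * Z $ m $ i) = s $ i * (s $ i * Z $ m $ i)"
      using sym1[of m i] sym2[of m i] by simp
    then have "Z $ m $ i = 0 \<or> (s $ m)\<^sup>2 = (s $ i)\<^sup>2" by (auto simp: power2_eq_square)
    moreover have "(s $ m)\<^sup>2 \<noteq> (s $ i)\<^sup>2" using that pos(1)[of m] by (auto simp: power2_eq_iff)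
    ultimately show ?thesis by simp
  qed
  have comm: "Z $ m $ i = Z $ i $ m" if "0 < s $ i" for i m
  proof (cases "s $ m = s $ i")
    case True
    then show ?thesis using sym1[of m i] that by simp
  next
    case False
    then show ?thesis using zero[OF that False] sym2[of m i] that sym1[of i m] by auto
  qed
  define p where "p = Z *v axis i 1"
  have p: "p $ m = Z $ m $ i" for m by (simp add: p_def matrix_vector_mult_basis column_def)
  have p': "axis i 1 v* Z = p"
    by (simp add: vec_eq_iff p comm[OF pos(2)] matrix_vector_mult_basis column_def transpose_def flip: transpose_matrix_vector)
  have Zp: "p v* Z = Z *v p"
  proof -
    have eq: "p $ l * Z $ l $ m = Z $ m $ l * p $ l" for l m
    proof (cases "s $ l = s $ i")
      case True
      then show ?thesis using comm[of l m] pos(2) by simp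
    next
      case False
      then show ?thesis using zero[OF pos(2)] by (simp add: p)
    qed
    show ?thesis
      by (simp only: vec_eq_iff vector_matrix_mult_def matrix_vector_mult_def vec_lambda_beta eq) simp
  qed
  have "Z *v (p v* Z) = p"
    using arg_cong[OF triple, of "\<lambda>M. M *v axis i 1"]
    by (simp add: p_def flip: matrix_vector_mul_assoc)
  then have ZZp: "Z *v (Z *v p) = p" by (simp add: Zp)
  \<comment> \<open>\<open>Z\<close> is an involution on \<open>p\<close>, so
    \<open>Z *v w = - w\<close>. As \<open>diag s\<close> acts on \<open>w\<close> as the positive
    scalar \<open>s $ i\<close>, positivity of \<open>transpose Z ** diag s\<close> forces
    \<open>w = 0\<close>.\<close>
  define w where "w = Z *v p - p"
  have Zw: "Z *v w = - w" by (simp add: w_def matrix_vector_mult_diff_distrib ZZp)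
  have w0: "w $ m = 0" if "s $ m \<noteq> s $ i" for m
  proof -
    have zero_term: "Z $ m $ l * p $ l = 0" for l
      using zero[of l m] zero[of i l] that pos(2) by (cases "s $ l = s $ i") (auto simp: p)
    have "(Z *v p) $ m = 0"
      unfolding matrix_vector_mult_def vec_lambda_beta by (simp only: zero_term) simp
    moreover have "p $ m = 0" using zero[OF pos(2) that] by (simp add: p)
    ultimately show ?thesis by (simp add: w_def)
  qed
  have "diag s *v w = s $ i *\<^sub>R w"
  proof -
    have "(diag s *v w) $ m = s $ m * w $ m" for m
      by (simp add: diag_def matrix_vector_mult_def if_distribR if_distrib cong: if_cong)
    then show ?thesis using w0 by (auto simp: vec_eq_iff)
  qed
  then have "0 \<le> - (s $ i * (w \<bullet> w))"
    using attained_symmetric(2)[OF Z eq, of w] by (simp add: Zw)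
  then have "w = 0" using pos(2) by (metis inner_ge_zero inner_eq_zero_iff less_le_not_le mult_pos_pos neg_0_le_iff_le linorder_not_less order_le_less)
  then have "Z *v p = p" by (simp add: w_def)
  show thesis
  proof (rule that[of p "axis i 1 - p"])
    show "Z *v (axis i 1 - p) = 0" by (simp add: matrix_vector_mult_diff_distrib \<open>Z *v p = p\<close> flip: p_def)
    show "(axis i 1 - p) v* Z = 0" by (simp add: vector_matrix_mult_diff_distrib p' Zp \<open>Z *v p = p\<close>)
  qed (use \<open>Z *v p = p\<close> Zp in auto)
qed

text \<open>Each axis vector splits into a part fixed by the common supporting isometry and a part
  in its kernel. The symmetries from \<open>attained_symmetric\<close> settle the fixed parts and
  kill the mixed terms; the kernel parts lie on one line, where any bilinear form is
  symmetric.\<close>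

lemma diag_partner_symmetric:
  fixes B :: "real^'n^'n"
  assumes k: "k \<le> CARD('n)" "CARD('n) \<le> k + 1" and pos: "\<And>i. 0 \<le> s $ i" "0 < s $ i" "0 < s $ j"
    and eq: "ky_fan k (diag s + B) = ky_fan k (diag s) + ky_fan k B"
  shows "B $ i $ j = B $ j $ i"
proof -
  obtain P Q S where PQ: "orthogonal_matrix P" "orthogonal_matrix Q" "card S = k"
    "P ** diag (ind S) ** Q \<in> dual_ball k"
    "(P ** diag (ind S) ** Q) \<bullet> diag s = ky_fan k (diag s)"
    "(P ** diag (ind S) ** Q) \<bullet> B = ky_fan k B"
    using additive_pairD[OF k(1) eq] by blast
  define Z where "Z = P ** diag (ind S) ** Q"
  have Z: "Z \<in> dual_ball k" unfolding Z_def by (rule PQ(4))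
  have Zs: "Z \<bullet> diag s = ky_fan k (diag s)" and ZB: "Z \<bullet> B = ky_fan k B" using PQ by (simp_all add: Z_def)
  have triple: "Z ** transpose Z ** Z = Z" by (rule partial_isometry_triple[OF PQ(1,2) Z_def])
  obtain p q where i: "axis i 1 = p + q" "Z *v p = p" "p v* Z = p" "Z *v q = 0" "q v* Z = 0"
    using attained_projection[OF Z Zs triple pos(1,2)] by blast
  obtain p' q' where j: "axis j 1 = p' + q'" "Z *v p' = p'" "p' v* Z = p'" "Z *v q' = 0" "q' v* Z = 0"
    using attained_projection[OF Z Zs triple pos(1,3)] by blast
  obtain w where w: "\<And>x. Z *v x = 0 \<Longrightarrow> \<exists>a. x = a *\<^sub>R w"
    using partial_isometry_kernel[OF PQ(2,1), of S] PQ(3) k unfolding Z_def by auto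
  obtain a a' where a: "q = a *\<^sub>R w" "q' = a' *\<^sub>R w" using w[OF i(4)] w[OF j(4)] by blast
  note sym1 = attained_symmetric(1)[OF Z ZB] and sym2 = attained_symmetric(3)[OF Z ZB]
  have "p \<bullet> (B *v p') = p' \<bullet> (B *v p)" using sym1[of p p'] by (simp add: i j)
  moreover have "p \<bullet> (B *v q') = 0" using sym1[of p q'] by (simp add: i j)
  moreover have "p' \<bullet> (B *v q) = 0" using sym1[of p' q] by (simp add: i j)
  moreover have "q \<bullet> (B *v p') = 0" using sym2[of q p'] by (simp add: i j dot_lmul_matrix inner_commute[of p'])
  moreover have "q' \<bullet> (B *v p) = 0" using sym2[of q' p] by (simp add: i j dot_lmul_matrix inner_commute[of p])
  moreover have "q \<bullet> (B *v q') = q' \<bullet> (B *v q)" by (simp add: a matrix_vector_mult_scaleR)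
  ultimately have "axis i 1 \<bullet> (B *v axis j 1) = axis j 1 \<bullet> (B *v axis i 1)"
    by (simp add: i(1) j(1) inner_add_left inner_add_right matrix_vector_right_distrib)
  then show ?thesis by (simp add: inner_axis_matrix)
qed

text \<open>With two positive singular values, a nonzero matrix that is skew in the singular bases
  is orthogonal to the images of all partners of \<open>outer u v\<close>. The adjoint of
  \<open>T\<close> makes it orthogonal to the partners, which span everything; so it is orthogonal
  to the range of \<open>T\<close>, contrary to surjectivity.\<close>

lemma rank_one_image:
  fixes T :: "real^'n^'n \<Rightarrow> real^'n^'n" and k :: nat
  assumes k: "2 \<le> k" "k \<le> CARD('n)" "CARD('n) \<le> k + 1" and lin: "linear T" and bij: "bij T"
    and additive: "\<And>A B. ky_fan k (A + B) = ky_fan k A + ky_fan k B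
           \<Longrightarrow> ky_fan k (T A + T B) = ky_fan k (T A) + ky_fan k (T B)"
    and uv: "norm u = 1" "norm v = 1"
  shows "\<exists>x y. T (outer u v) = outer x y"
proof -
  obtain U V s where A: "orthogonal_matrix U" "orthogonal_matrix V" "T (outer u v) = U ** diag s ** V" "\<And>i. 0 \<le> s $ i"
    using singular_value_decomposition by blast
  note conj = orthogonal_conjugate_cancel[OF A(1,2)]
  have le1: "i = j" if ij: "0 < s $ i" "0 < s $ j" for i j
  proof (rule ccontr)
    assume "i \<noteq> j"
    define E :: "real^'n^'n" where "E = outer (axis i 1) (axis j 1) - outer (axis j 1) (axis i 1)"
    define X where "X = U ** E ** V"
    have "X \<bullet> T B = 0" if B: "ky_fan k (outer u v + B) = ky_fan k (outer u v) + ky_fan k B" for B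
    proof -
      define B' where "B' = transpose U ** T B ** transpose V"
      have "diag s = transpose U ** T (outer u v) ** transpose V" using conj by (simp add: A(3))
      then have "ky_fan k (diag s + B') = ky_fan k (transpose U ** (T (outer u v) + T B) ** transpose V)"
        by (simp add: B'_def matrix_add_ldistrib matrix_mult_add_rdistrib)
      also have "\<dots> = ky_fan k (T (outer u v)) + ky_fan k (T B)"
        using A additive[OF B] by (simp add: ky_fan_orthogonal)
      also have "\<dots> = ky_fan k (transpose U ** T (outer u v) ** transpose V) + ky_fan k B'"
        using A by (simp add: ky_fan_orthogonal B'_def)
      also have "transpose U ** T (outer u v) ** transpose V = diag s" using conj by (simp add: A(3))
      finally have "B' $ i $ j = B' $ j $ i"
        using diag_partner_symmetric[OF k(2,3) A(4) ij] by blast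
      have "X \<bullet> T B = B' \<bullet> E"
        unfolding X_def B'_def by (simp add: inner_commute[of _ "T B"] inner_mult3)
      also have "\<dots> = B' $ i $ j - B' $ j $ i"
        by (simp add: E_def inner_diff_right inner_outer_right inner_axis_matrix)
      finally show ?thesis using \<open>B' $ i $ j = B' $ j $ i\<close> by simp
    qed
    then have "adjoint T X \<bullet> B = 0" if "ky_fan k (outer u v + B) = ky_fan k (outer u v) + ky_fan k B" for B
      using that by (simp add: adjoint_clauses[OF lin] inner_commute)
    then have "adjoint T X = 0" using rank_one_partners_span[OF k(1,2) uv] by blast
    then have "X \<bullet> T B = 0" for B using adjoint_works[OF lin, of B X] by (simp add: inner_commute)
    moreover obtain B where "T B = X" using bij by (metis bij_pointE)
    ultimately have "X = 0" by (metis inner_eq_zero_iff)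
    then have "E = 0" using conj[of E] by (simp add: X_def)
    then have "E $ i $ j = 0" by simp
    then show False using \<open>i \<noteq> j\<close> by (simp add: E_def outer_axis)
  qed
  obtain i where i: "\<And>l. l \<noteq> i \<Longrightarrow> s $ l = 0"
    using le1 A(4) by (metis order_le_less)
  then have "s = s $ i *\<^sub>R axis i 1" by (auto simp: vec_eq_iff axis_1_component)
  then have "T (outer u v) = outer (s $ i *\<^sub>R (U *v axis i 1)) (axis i 1 v* V)"
    by (metis A(3) mult_diag_scaleR mult_diag_axis outer_scaleR_left)
  then show ?thesis by blast
qed

lemma scale_rank_one:
  fixes T :: "real^'n^'n \<Rightarrow> real^'n^'n"
  assumes lin: "linear T" and unit: "\<And>u v. norm u = 1 \<Longrightarrow> norm v = 1 \<Longrightarrow> \<exists>x y. T (outer u v) = outer x y"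
  shows "\<exists>x y. T (outer u v) = outer x y"
proof (cases "u = 0 \<or> v = 0")
  case True
  then have "T (outer u v) = outer 0 0" by (auto simp: linear_0[OF lin])
  then show ?thesis by blast
next
  case False
  then obtain x y where xy: "T (outer (u /\<^sub>R norm u) (v /\<^sub>R norm v)) = outer x y"
    using unit[of "u /\<^sub>R norm u" "v /\<^sub>R norm v"] by auto
  have "outer u v = (norm u * norm v) *\<^sub>R outer (u /\<^sub>R norm u) (v /\<^sub>R norm v)"
    using False by (intro outer_normalize) auto
  then have "T (outer u v) = outer ((norm u * norm v) *\<^sub>R x) y"
    using arg_cong[of _ _ T] by (metis linear_cmul[OF lin] xy outer_scaleR_left)
  then show ?thesis by blast
qed

section \<open>Rigidity for \<open>k \<le> n - 2\<close>\<close>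

text \<open>Exchange argument: two leading sets differ by a bijection along which the entries
  compare in both directions.\<close>

lemma ky_fan_top:
  fixes d :: "real^'n"
  assumes U: "orthogonal_matrix U" and V: "orthogonal_matrix V" and k: "k \<le> CARD('n)"
    and S: "card S = k" "\<And>i j. i \<in> S \<Longrightarrow> j \<notin> S \<Longrightarrow> \<bar>d $ j\<bar> \<le> \<bar>d $ i\<bar>"
  shows "ky_fan k (U ** diag d ** V) = (\<Sum>i\<in>S. \<bar>d $ i\<bar>)"
proof -
  obtain S' where S': "card S' = k" "ky_fan k (U ** diag d ** V) = (\<Sum>i\<in>S'. \<bar>d $ i\<bar>)"
    "\<And>i j. i \<in> S' \<Longrightarrow> j \<notin> S' \<Longrightarrow> \<bar>d $ j\<bar> \<le> \<bar>d $ i\<bar>"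
    using ky_fan_diag[OF U V k, of d] by blast
  have le: "(\<Sum>i\<in>B. \<bar>d $ i\<bar>) \<le> (\<Sum>i\<in>A. \<bar>d $ i\<bar>)"
    if "card A = card B" "\<And>i j. i \<in> A \<Longrightarrow> j \<notin> A \<Longrightarrow> \<bar>d $ j\<bar> \<le> \<bar>d $ i\<bar>" for A B :: "'n set"
  proof -
    have "card (B - A) = card (A - B)"
      using that(1) by (metis card_Diff_subset_Int finite Int_commute finite_Int)
    then obtain h where h: "bij_betw h (B - A) (A - B)"
      by (metis finite finite_same_card_bij)
    have "(\<Sum>i\<in>B - A. \<bar>d $ i\<bar>) \<le> (\<Sum>i\<in>B - A. \<bar>d $ h i\<bar>)"
      by (intro sum_mono that(2)) (use h in \<open>auto simp: bij_betw_def\<close>)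
    also have "\<dots> = (\<Sum>i\<in>A - B. \<bar>d $ i\<bar>)" by (rule sum.reindex_bij_betw[OF h])
    finally show ?thesis
      using sum.Int_Diff[of B "\<lambda>i. \<bar>d $ i\<bar>" A] sum.Int_Diff[of A "\<lambda>i. \<bar>d $ i\<bar>" B]
      by (simp add: Int_commute)
  qed
  show ?thesis using le[of S S'] le[of S' S] S S' by (intro antisym) auto
qed

lemma ky_fan_diag_additive:
  fixes x y :: "real^'n"
  assumes U: "orthogonal_matrix U" and V: "orthogonal_matrix V" and k: "k \<le> CARD('n)"
    and S: "card S = k" "\<And>i j. i \<in> S \<Longrightarrow> j \<notin> S \<Longrightarrow> \<bar>x $ j\<bar> \<le> \<bar>x $ i\<bar>"
      "\<And>i j. i \<in> S \<Longrightarrow> j \<notin> S \<Longrightarrow> \<bar>y $ j\<bar> \<le> \<bar>y $ i\<bar>"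
    and sign: "\<And>i. i \<in> S \<Longrightarrow> 0 \<le> x $ i * y $ i"
  shows "ky_fan k (U ** diag x ** V + U ** diag y ** V) =
    ky_fan k (U ** diag x ** V) + ky_fan k (U ** diag y ** V)"
proof -
  have abs_add: "\<bar>x $ i + y $ i\<bar> = \<bar>x $ i\<bar> + \<bar>y $ i\<bar>" if "i \<in> S" for i
    using sign[OF that] by (auto simp: zero_le_mult_iff)
  have "U ** diag x ** V + U ** diag y ** V = U ** diag (x + y) ** V"
    by (simp add: mult_diag_add)
  moreover have "ky_fan k (U ** diag (x + y) ** V) = (\<Sum>i\<in>S. \<bar>(x + y) $ i\<bar>)"
  proof (rule ky_fan_top[OF U V k S(1)])
    fix i j assume "i \<in> S" "j \<notin> S"
    then show "\<bar>(x + y) $ j\<bar> \<le> \<bar>(x + y) $ i\<bar>"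
      using S(2,3)[of i j] abs_add[of i] abs_triangle_ineq[of "x $ j" "y $ j"] by simp
  qed
  ultimately show ?thesis
    using ky_fan_top[OF U V k S(1), of x] ky_fan_top[OF U V k S(1), of y] S abs_add by (simp add: sum.distrib)
qed

section \<open>Functions that are additive wherever the Ky-Fan norm is\<close>

lemma exists_subset_card:
  assumes "m + card (F :: 'n::finite set) \<le> CARD('n)"
  obtains S where "card S = m" "S \<inter> F = {}"
proof -
  have "m \<le> card (- F)" using assms by (simp add: Compl_eq_Diff_UNIV card_Diff_subset)
  then obtain S where "S \<subseteq> - F" "card S = m" by (metis obtain_subset_with_card_n)
  then show thesis using that by blast
qed

text \<open>Fixing the singular bases leaves a function of \<open>n\<close> real variables; it will
  be additive on vectors with a common leading set and compatible signs there.\<close>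

definition on_diag :: "(real^'n^'n \<Rightarrow> real) \<Rightarrow> real^'n^'n \<Rightarrow> real^'n^'n \<Rightarrow> real^'n \<Rightarrow> real"
  where "on_diag N U V x = N (U ** diag x ** V)"

context
  fixes N :: "real^'n^'n \<Rightarrow> real" and k :: nat
  assumes k: "2 \<le> k" "k + 2 \<le> CARD('n)"
    and additive: "\<And>A B. ky_fan k (A + B) = ky_fan k A + ky_fan k B \<Longrightarrow> N (A + B) = N A + N B"
    and scale: "\<And>c A. N (c *\<^sub>R A) = \<bar>c\<bar> * N A"
begin

context
  fixes U V :: "real^'n^'n"
  assumes U: "orthogonal_matrix U" and V: "orthogonal_matrix V"
begin

abbreviation m :: "real^'n \<Rightarrow> real" where "m \<equiv> on_diag N U V"

lemma m_add:
  assumes S: "card S = k" "\<And>i j. i \<in> S \<Longrightarrow> j \<notin> S \<Longrightarrow> \<bar>x $ j\<bar> \<le> \<bar>x $ i\<bar>"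
      "\<And>i j. i \<in> S \<Longrightarrow> j \<notin> S \<Longrightarrow> \<bar>y $ j\<bar> \<le> \<bar>y $ i\<bar>"
    and sign: "\<And>i. i \<in> S \<Longrightarrow> 0 \<le> x $ i * y $ i"
  shows "m (x + y) = m x + m y"
proof -
  have "k \<le> CARD('n)" using k by simp
  from additive[OF ky_fan_diag_additive[OF U V this S sign]] show ?thesis
    by (simp add: on_diag_def mult_diag_add)
qed

lemma m_scale: "m (c *\<^sub>R x) = \<bar>c\<bar> * m x"
  using scale[of c "U ** diag x ** V"]
  by (simp add: on_diag_def mult_diag_scaleR)

lemma m_zero: "m 0 = 0"
  using m_scale[of 0 0] by simp

text \<open>All vectors supported in \<open>S\<close> have \<open>S\<close> as a leading set, so
  coordinates split off one by one.\<close>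

lemma m_sparse:
  assumes S: "card S = k" "F \<subseteq> S"
  shows "m (\<Sum>i\<in>F. x i *\<^sub>R axis i 1) = (\<Sum>i\<in>F. \<bar>x i\<bar> * m (axis i 1))"
proof -
  have "finite F" by simp
  then show ?thesis using S(2)
  proof (induction F)
    case (insert i F)
    have comp: "(\<Sum>i\<in>F. x i *\<^sub>R axis i 1 :: real^'n) $ j = (if j \<in> F then x j else 0)" for j
      by (simp add: axis_def if_distrib cong: if_cong)
    have "m (x i *\<^sub>R axis i 1 + (\<Sum>i\<in>F. x i *\<^sub>R axis i 1)) =
        m (x i *\<^sub>R axis i 1) + m (\<Sum>i\<in>F. x i *\<^sub>R axis i 1)"
      by (rule m_add[OF S(1)], unfold vector_scaleR_component comp axis_1_component) (use insert in auto)
    with insert show ?case by (simp add: m_scale)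
  qed (simp add: m_zero)
qed

text \<open>On the cube of vectors \<open>ind S + x e\<^sub>i + y e\<^sub>j + z e\<^sub>l\<close>, \<open>\<bar>x\<bar>, \<bar>y\<bar>, \<bar>z\<bar> \<le> 1\<close>, the function \<open>m\<close> is affine on every face,
  so opposite corners of a face add up to twice the value at its centre.\<close>

lemma m_corners:
  assumes S: "card S + 1 = k" and ijl: "i \<notin> S" "j \<notin> S" "l \<notin> S" "i \<noteq> j" "i \<noteq> l" "j \<noteq> l"
  shows "m (axis j 1) = m (axis l 1)"
    and "m (ind S + axis i 1 + axis j 1) = m (ind (insert i S))"
proof -
  define v where "v i j l x y z = ind S + x *\<^sub>R axis i 1 + y *\<^sub>R axis j 1 + z *\<^sub>R axis l (1::real)" for i j l x y z
  define f where "f x y z = m (v i j l x y z)" for x y z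
  \<comment> \<open>\<open>b q\<close> is the value at the centres of the two faces on which the
    coordinate of \<open>q\<close> is 1 or -1.\<close>
  define b where "b q = m (ind S) + m (axis q 1)" for q
  have base: "m (ind S + x *\<^sub>R axis q 1) = b q" if "\<bar>x\<bar> = 1" "q \<notin> S" for x q
  proof -
    have "m (ind S + x *\<^sub>R axis q 1) = m (ind S) + m (x *\<^sub>R axis q 1)"
      by (rule m_add[of "insert q S"]) (use S that in \<open>auto simp: ind_def axis_1_component\<close>)
    then show ?thesis using that by (simp add: b_def m_scale)
  qed
  have face: "m (v i j l x y z) + m (v i j l x y' z') = 2 * m (v i j l x ((y + y') / 2) ((z + z') / 2))"
    if ijl: "i \<notin> S" "j \<notin> S" "l \<notin> S" "i \<noteq> j" "i \<noteq> l" "j \<noteq> l"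
      and le: "\<bar>x\<bar> = 1" "\<bar>y\<bar> \<le> 1" "\<bar>z\<bar> \<le> 1" "\<bar>y'\<bar> \<le> 1" "\<bar>z'\<bar> \<le> 1" for i j l x y z y' z'
  proof -
    have comp: "v i j l x y z $ p =
        (if p \<in> S then 1 else if p = i then x else if p = j then y else if p = l then z else 0)" for y z p
      using ijl by (auto simp: v_def ind_def axis_1_component)
    have one: "\<bar>v i j l x y z $ p\<bar> = 1" if "p \<in> insert i S" for y z p
      using that le(1) by (auto simp: comp)
    have "m (v i j l x y z + v i j l x y' z') = m (v i j l x y z) + m (v i j l x y' z')"
    proof (rule m_add)
      show "card (insert i S) = k" using S ijl by simp
      show "\<bar>v i j l x y z $ r\<bar> \<le> \<bar>v i j l x y z $ p\<bar>" "\<bar>v i j l x y' z' $ r\<bar> \<le> \<bar>v i j l x y' z' $ p\<bar>"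
        if "p \<in> insert i S" for p r
        unfolding one[OF that] unfolding comp using le by simp_all
      show "0 \<le> v i j l x y z $ p * v i j l x y' z' $ p" if "p \<in> insert i S" for p
        using that by (auto simp: comp)
    qed
    moreover have "v i j l x y z + v i j l x y' z' = 2 *\<^sub>R v i j l x ((y + y') / 2) ((z + z') / 2)"
      by (simp add: v_def vec_eq_iff algebra_simps add_divide_distrib)
    ultimately show ?thesis by (simp add: m_scale)
  qed
  have perm: "v j i l y x z = v i j l x y z" "v l i j z x y = v i j l x y z" "v i' j' l' x 0 0 = ind S + x *\<^sub>R axis i' 1"
    for x y z i' j' l' by (simp_all add: v_def add_ac)
  have fi: "f x y z + f x (- y) (- z) = 2 * b i" if "\<bar>x\<bar> = 1" "\<bar>y\<bar> = 1" "\<bar>z\<bar> = 1" for x y z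
    using face[of i j l x y z "- y" "- z"] that ijl base[of x i] by (simp add: f_def perm(3))
  have fj: "f x y z + f (- x) y (- z) = 2 * b j" if "\<bar>x\<bar> = 1" "\<bar>y\<bar> = 1" "\<bar>z\<bar> = 1" for x y z
    using face[of j i l y x z "- x" "- z"] that ijl base[of y j] by (simp add: f_def perm(3)) (simp add: perm(1))
  have fl: "f x y z + f (- x) (- y) z = 2 * b l" if "\<bar>x\<bar> = 1" "\<bar>y\<bar> = 1" "\<bar>z\<bar> = 1" for x y z
    using face[of l i j z x y "- x" "- y"] that ijl base[of z l] by (simp add: f_def perm(3)) (simp add: perm(2))
  \<comment> \<open>The corners with an even number of entries -1 form a tetrahedron, any two of
    whose vertices are opposite in a face. Splitting it into two disjoint pairs evaluates the sum
    over all four as \<open>4 * b j\<close> and as \<open>4 * b l\<close>.\<close>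
  have 1: "f 1 1 1 + f 1 (-1) (-1) = 2 * b i" "f 1 1 1 + f (-1) 1 (-1) = 2 * b j"
    "f 1 (-1) (-1) + f (-1) 1 (-1) = 2 * b l" "f 1 1 1 + f (-1) (-1) 1 = 2 * b l"
    "f 1 (-1) (-1) + f (-1) (-1) 1 = 2 * b j"
    using fi[of 1 1 1] fj[of 1 1 1] fl[of 1 "-1" "-1"] fl[of 1 1 1] fj[of 1 "-1" "-1"] by simp_all
  then have bjl: "b j = b l" by linarith
  then show "m (axis j 1) = m (axis l 1)" by (simp add: b_def)
  have 2: "f 1 1 (-1) + f 1 (-1) 1 = 2 * b i" "f 1 1 (-1) + f (-1) 1 1 = 2 * b j"
    "f 1 (-1) 1 + f (-1) 1 1 = 2 * b l"
    using fi[of 1 1 "-1"] fj[of 1 1 "-1"] fl[of 1 "-1" 1] by simp_all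
  \<comment> \<open>An edge midpoint averages one corner from each of the two tetrahedra; given
    \<open>b j = b l\<close>, both corners have the value \<open>b i\<close>.\<close>
  have "f 1 1 0 = (f 1 1 1 + f 1 1 (-1)) / 2" using face[of i j l 1 1 1 1 "-1"] ijl by (simp add: f_def)
  also have "\<dots> = b i"
  proof -
    have "f 1 1 1 = b i" using 1(1-3) bjl by linarith
    moreover have "f 1 1 (-1) = b i" using 2 bjl by linarith
    ultimately show ?thesis by simp
  qed
  also have "\<dots> = m (ind (insert i S))"
  proof -
    have "ind (insert i S) = ind S + 1 *\<^sub>R axis i 1"
      using ijl by (auto simp: vec_eq_iff ind_def axis_def)
    then show ?thesis using base[of 1 i] ijl by simp
  qed
  finally show "m (ind S + axis i 1 + axis j 1) = m (ind (insert i S))" by (simp add: f_def v_def)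
qed

text \<open>The \<open>k - 1\<close> positions of \<open>S\<close> and three further indices fit
  into \<open>n\<close> because \<open>k + 2 \<le> n\<close>.\<close>

lemma m_axis_const: "m (axis j 1) = m (axis l 1)"
proof (cases "j = l")
  case False
  obtain i where i: "i \<noteq> j" "i \<noteq> l"
  proof -
    have "card {j, l} < CARD('n)" using k card_insert_le_m1[of 2 "{l}" j] by (auto intro: le_less_trans[OF card_insert_le_m1])
    then have "{j, l} \<noteq> UNIV" by auto
    then show thesis using that by auto
  qed
  obtain S where "card S = k - 1" "S \<inter> {i, j, l} = {}"
    using exists_subset_card[of "k - 1" "{i, j, l}"] k i False by auto
  with i False k show ?thesis by (intro m_corners(1)[of S i j l]) auto
qed simp

text \<open>One coordinate is interpolated between \<open>ind S\<close> and the edge midpoint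
  evaluated in \<open>m_corners\<close>. Further ones are added by writing one vector as a sum in
  two ways, with the coordinates distributed over both summands or collected in one; all summands
  have the leading set \<open>S\<close>.\<close>

lemma m_top:
  assumes S: "card S = k" and x: "\<And>j. 0 \<le> x j" "\<And>j. x j \<le> 1"
  shows "finite J \<Longrightarrow> J \<inter> S = {} \<Longrightarrow> m (ind S + (\<Sum>j\<in>J. x j *\<^sub>R axis j 1)) = m (ind S)"
proof (induction J rule: finite_induct)
  case (insert j J)
  have comp: "(\<Sum>j\<in>J. x j *\<^sub>R axis j 1 :: real^'n) $ i = (if i \<in> J then x i else 0)" for i J
    by (simp add: axis_def if_distrib cong: if_cong)
  have one: "m (ind S + axis j 1) = m (ind S)"
  proof -
    have "S \<noteq> {}" using S k by auto
    then obtain i where i: "i \<in> S" by blast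
    obtain l where l: "l \<notin> S" "l \<noteq> j"
    proof -
      have "card (insert j S) < CARD('n)" using S k card_insert_le_m1[of "k + 1" S j] by simp
      then have "insert j S \<noteq> UNIV" by auto
      then show thesis using that by auto
    qed
    have "m (ind (S - {i}) + axis i 1 + axis j 1) = m (ind (insert i (S - {i})))"
      by (rule m_corners(2)[of _ _ _ l]) (use S k i l insert in auto)
    moreover have "ind (S - {i}) + axis i 1 = ind S" using i by (auto simp: vec_eq_iff ind_def axis_def)
    ultimately show ?thesis using i by (simp add: insert_absorb)
  qed
  have c: "m (ind S + x j *\<^sub>R axis j 1) = m (ind S)"
  proof -
    have "m ((1 - x j) *\<^sub>R ind S + x j *\<^sub>R (ind S + axis j 1)) =
        m ((1 - x j) *\<^sub>R ind S) + m (x j *\<^sub>R (ind S + axis j 1))"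
      by (rule m_add[OF S]) (use insert x[of j] in \<open>auto simp: ind_def axis_def\<close>)
    also have "\<dots> = (1 - x j) * m (ind S) + x j * m (ind S)"
      using x[of j] by (simp add: m_scale one)
    finally show ?thesis by (simp add: algebra_simps)
  qed
  have "m ((ind S + x j *\<^sub>R axis j 1) + (ind S + (\<Sum>j\<in>J. x j *\<^sub>R axis j 1))) =
      m (ind S + x j *\<^sub>R axis j 1) + m (ind S + (\<Sum>j\<in>J. x j *\<^sub>R axis j 1))"
    by (rule m_add[OF S], unfold vector_add_component comp) (use insert x in \<open>auto simp: ind_def axis_def\<close>)
  also have "\<dots> = 2 * m (ind S)" using insert c by simp
  finally have A: "m ((ind S + x j *\<^sub>R axis j 1) + (ind S + (\<Sum>j\<in>J. x j *\<^sub>R axis j 1))) = 2 * m (ind S)" .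
  have "m (ind S + (ind S + (\<Sum>j\<in>insert j J. x j *\<^sub>R axis j 1))) =
      m (ind S) + m (ind S + (\<Sum>j\<in>insert j J. x j *\<^sub>R axis j 1))"
    by (rule m_add[OF S], unfold vector_add_component comp) (use insert x in \<open>auto simp: ind_def axis_def\<close>)
  moreover have "(ind S + x j *\<^sub>R axis j 1) + (ind S + (\<Sum>j\<in>J. x j *\<^sub>R axis j 1)) =
      ind S + (ind S + (\<Sum>j\<in>insert j J. x j *\<^sub>R axis j 1))"
    using insert by simp
  ultimately show ?case using A by simp
qed simp

text \<open>With \<open>\<mu>\<close> the smallest leading entry, \<open>x\<close> is a vector
  supported in \<open>S\<close> plus \<open>\<mu>\<close> times a vector \<open>q\<close> that is 1
  on \<open>S\<close> and at most 1 elsewhere. The first is evaluated by \<open>m_sparse\<close>,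
  the second by \<open>m_top\<close>.\<close>

lemma m_eq_ky_fan:
  assumes x: "\<And>i. 0 \<le> x $ i"
  shows "N (U ** diag x ** V) = m (axis i 1) * ky_fan k (U ** diag x ** V)"
proof -
  have k': "k \<le> CARD('n)" using k by simp
  obtain S where S: "card S = k" "ky_fan k (U ** diag x ** V) = (\<Sum>i\<in>S. \<bar>x $ i\<bar>)"
    "\<And>i j. i \<in> S \<Longrightarrow> j \<notin> S \<Longrightarrow> \<bar>x $ j\<bar> \<le> \<bar>x $ i\<bar>"
    using ky_fan_diag[OF U V k', of x] by blast
  have ne: "S \<noteq> {}" using S k by auto
  define a where "a = m (axis i 1)"
  define \<mu> where "\<mu> = Min ((\<lambda>i. x $ i) ` S)"
  have mu: "\<mu> \<ge> 0" "\<And>i. i \<in> S \<Longrightarrow> \<mu> \<le> x $ i" "\<And>j. j \<notin> S \<Longrightarrow> x $ j \<le> \<mu>"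
    using ne x S(3) by (auto simp: \<mu>_def Min_ge_iff)
  have sparse: "m (\<Sum>i\<in>S. y i *\<^sub>R axis i 1) = a * (\<Sum>i\<in>S. y i)" if "\<And>i. i \<in> S \<Longrightarrow> 0 \<le> y i" for y
  proof -
    have "(\<Sum>j\<in>S. \<bar>y j\<bar> * m (axis j 1)) = (\<Sum>j\<in>S. a * y j)"
      unfolding a_def by (intro sum.cong refl, subst m_axis_const[of _ i]) (simp add: that mult.commute)
    then show ?thesis using m_sparse[OF S(1), of S y] by (simp add: sum_distrib_left)
  qed
  have comp: "(\<Sum>j\<in>J. y j *\<^sub>R axis j 1 :: real^'n) $ i = (if i \<in> J then y i else 0)" for i J y
    by (simp add: axis_def if_distrib cong: if_cong)
  \<comment> \<open>If \<open>\<mu> = 0\<close>, the entries of \<open>x\<close> outside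
    \<open>S\<close> vanish and \<open>q\<close> is \<open>ind S\<close>.\<close>
  define q where "q = ind S + (\<Sum>j\<in>-S. (if \<mu> = 0 then 0 else x $ j / \<mu>) *\<^sub>R axis j 1)"
  have qc: "q $ p = (if p \<in> S then 1 else if \<mu> = 0 then 0 else x $ p / \<mu>)" for p
    unfolding q_def vector_add_component comp by (simp add: ind_def)
  have "ind S = (\<Sum>i\<in>S. 1 *\<^sub>R axis i 1)"
    by (simp add: vec_eq_iff ind_def axis_def)
  then have "m (ind S) = a * k" using sparse[of "\<lambda>_. 1"] S(1) by simp
  moreover have "m q = m (ind S)"
  proof -
    define y where "y j = (if j \<in> S \<or> \<mu> = 0 then 0 else x $ j / \<mu>)" for j
    have "q = ind S + (\<Sum>j\<in>-S. y j *\<^sub>R axis j 1)"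
      by (simp add: vec_eq_iff qc comp del: sum_component) (auto simp: ind_def y_def)
    moreover have "0 \<le> y j" "y j \<le> 1" for j using x[of j] mu(1) mu(3)[of j] by (auto simp: y_def)
    ultimately show ?thesis using m_top[where x = y and J = "- S", OF S(1)] by simp
  qed
  ultimately have mq: "m q = a * k" by simp
  define y where "y = (\<Sum>i\<in>S. (x $ i - \<mu>) *\<^sub>R axis i 1 :: real^'n)"
  have yc: "y $ p = (if p \<in> S then x $ p - \<mu> else 0)" for p unfolding y_def comp by simp
  have "x = y + \<mu> *\<^sub>R q"
    using mu x by (auto simp: vec_eq_iff yc qc) (metis antisym)
  moreover have "m (y + \<mu> *\<^sub>R q) = m y + m (\<mu> *\<^sub>R q)"
    by (rule m_add[OF S(1)]) (use mu x in \<open>auto simp: yc qc\<close>)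
  moreover have "m y = a * (\<Sum>i\<in>S. (x $ i - \<mu>))" unfolding y_def using mu by (intro sparse) auto
  ultimately have "m x = a * (\<Sum>i\<in>S. (x $ i - \<mu>)) + \<mu> * (a * k)"
    using mu(1) by (simp add: m_scale mq)
  also have "\<dots> = a * (\<Sum>i\<in>S. x $ i)" using S(1) by (simp add: sum_subtractf algebra_simps)
  also have "\<dots> = a * ky_fan k (U ** diag x ** V)" using x S(2) by simp
  finally show ?thesis by (simp add: on_diag_def a_def)
qed

end

end

lemma exists_orthogonal_pair:
  fixes u v :: "real^'n"
  assumes "3 \<le> CARD('n)"
  obtains x where "norm x = 1" "u \<bullet> x = 0" "v \<bullet> x = 0"
proof -
  have "dim {u, v} \<le> card {u, v}" by (rule dim_le_card') simp
  also have "\<dots> \<le> 2" by (simp add: card_insert_if)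
  finally have "dim {u, v} < DIM(real^'n)" using assms by simp
  then obtain x where x: "x \<noteq> 0" "\<And>y. y \<in> span {u, v} \<Longrightarrow> orthogonal x y"
    using orthogonal_to_subspace_exists by blast
  have "u \<bullet> x = 0" "v \<bullet> x = 0"
    using x(2)[of u] x(2)[of v] by (auto simp: orthogonal_def span_base inner_commute)
  with x(1) show thesis by (intro that[of "x /\<^sub>R norm x"]) auto
qed

text \<open>So far the factor may depend on the singular bases. Rank one matrices with orthogonal
  factors lie in common bases, and as \<open>n \<ge> 3\<close> any two are linked through a third
  one orthogonal to both.\<close>

lemma additive_norm_multiple:
  fixes N :: "real^'n^'n \<Rightarrow> real"
  assumes k: "2 \<le> k" "k + 2 \<le> CARD('n)"
    and additive: "\<And>A B. ky_fan k (A + B) = ky_fan k A + ky_fan k B \<Longrightarrow> N (A + B) = N A + N B"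
    and scale: "\<And>c A. N (c *\<^sub>R A) = \<bar>c\<bar> * N A"
  obtains c where "\<And>A. N A = c * ky_fan k A"
proof -
  have n: "3 \<le> CARD('n)" "2 \<le> CARD('n)" using k by auto
  note facts = k additive scale
  have on_diag_axis: "on_diag N U V (axis i 1) = N (outer (U *v axis i 1) (axis i 1 v* V))"
    for U V :: "real^'n^'n" and i
    by (simp add: on_diag_def mult_diag_axis)
  have orth: "N (outer u v) = N (outer u' v')"
    if *: "norm u = 1" "norm v = 1" "norm u' = 1" "norm v' = 1" "u \<bullet> u' = 0" "v \<bullet> v' = 0" for u v u' v'
  proof -
    obtain i j :: 'n where ij: "i \<noteq> j" using exists_ne_index n by blast
    obtain P where P: "orthogonal_matrix P" "P *v axis i 1 = u" "P *v axis j 1 = u'"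
      by (rule orthogonal_matrix_two_columns[OF ij *(1,3,5)])
    obtain Q where Q: "orthogonal_matrix Q" "Q *v axis i 1 = v" "Q *v axis j 1 = v'"
      by (rule orthogonal_matrix_two_columns[OF ij *(2,4,6)])
    have "on_diag N P (transpose Q) (axis i 1) = on_diag N P (transpose Q) (axis j 1)"
      by (rule m_axis_const[OF facts]) (use P Q in simp_all)
    then show ?thesis by (simp add: on_diag_axis P Q)
  qed
  define e :: "real^'n" where "e = axis undefined 1"
  define c where "c = N (outer e e)"
  have const: "N (outer u v) = c" if "norm u = 1" "norm v = 1" for u v
  proof -
    obtain x where "norm x = 1" "u \<bullet> x = 0" "e \<bullet> x = 0" using exists_orthogonal_pair n by blast
    moreover obtain y where "norm y = 1" "v \<bullet> y = 0" "e \<bullet> y = 0" using exists_orthogonal_pair n by blast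
    ultimately show ?thesis
      using orth[of u v x y] orth[of e e x y] that by (simp add: c_def e_def)
  qed
  have "N A = c * ky_fan k A" for A
  proof -
    obtain U V d where A: "orthogonal_matrix U" "orthogonal_matrix V" "A = U ** diag d ** V" "\<And>i. 0 \<le> d $ i"
      using singular_value_decomposition[of A] by blast
    have "on_diag N U V (axis undefined 1) = c"
      unfolding on_diag_axis using A by (intro const norm_orthogonal_axis)
    then show ?thesis
      using m_eq_ky_fan[OF facts A(1,2,4), of undefined] by (simp add: A(3))
  qed
  then show thesis by (rule that)
qed

lemma ky_fan_eq_0:
  fixes A :: "real^'n^'n"
  assumes k: "1 \<le> k" "k \<le> CARD('n)" and "ky_fan k A = 0"
  shows "A = 0"
proof -
  have "A *v v = 0" for v
  proof (cases "v = 0")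
    case False
    then have "norm (A *v (v /\<^sub>R norm v)) \<le> 0"
      using norm_le_ky_fan[OF k, of "v /\<^sub>R norm v" A] assms(3) by simp
    with False show ?thesis by (simp add: matrix_vector_mult_scaleR mult_le_0_iff)
  qed simp
  then show ?thesis by (simp add: matrix_eq)
qed

section \<open>Isometries\<close>

text \<open>For nonzero \<open>A\<close> this says that the normalised \<open>A\<close> is an
  extreme point of the unit ball. In this form it is visibly preserved by bijective linear
  isometries.\<close>

definition atomic :: "nat \<Rightarrow> real^'n^'n \<Rightarrow> bool" where
  "atomic k A \<longleftrightarrow> (\<forall>B C. A = B + C \<longrightarrow> ky_fan k A = ky_fan k B + ky_fan k C \<longrightarrow> (\<exists>b. B = b *\<^sub>R A))"

text \<open>Every \<open>Z\<close> supporting \<open>outer u v\<close> also supports the summand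
  \<open>B\<close>. Adding to \<open>Z\<close> rank one terms orthogonal to \<open>u\<close> and
  \<open>v\<close> shows that \<open>B\<close> vanishes on the complements, and the bound of the
  operator norm of \<open>B\<close> by \<open>\<beta>\<close> removes the mixed blocks.\<close>

lemma atomic_outer:
  fixes u v :: "real^'n"
  assumes k: "2 \<le> k" "k \<le> CARD('n)" and uv: "norm u = 1" "norm v = 1"
  shows "atomic k (outer u v)"
  unfolding atomic_def
proof safe
  fix B C :: "real^'n^'n"
  assume sum: "outer u v = B + C" and eq: "ky_fan k (outer u v) = ky_fan k B + ky_fan k C"
  have k1: "1 \<le> k" using k by simp
  have uu: "u \<bullet> u = 1" "v \<bullet> v = 1" using uv by (simp_all add: norm_eq_1)
  define \<beta> where "\<beta> = ky_fan k B"
  have att: "Z \<bullet> B = \<beta>" if "Z \<in> dual_ball k" "u \<bullet> (Z *v v) = 1" for Z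
  proof -
    have "Z \<bullet> (B + C) = ky_fan k B + ky_fan k C"
      using that k1 k uv by (simp add: sum[symmetric] eq[symmetric] inner_outer_right ky_fan_outer)
    then show ?thesis using dual_ballD[OF that(1), of B] dual_ballD[OF that(1), of C]
      by (simp add: inner_add_right \<beta>_def)
  qed
  have uBv: "u \<bullet> (B *v v) = \<beta>"
    using att[of "outer u v"] outer_in_dual_ball[OF k1 k(2) uv] uu by (simp add: outer_vec inner_outer)
  have perp: "x \<bullet> (B *v y) = 0" if "norm x = 1" "norm y = 1" "u \<bullet> x = 0" "v \<bullet> y = 0" for x y
    using att[of "outer u v + outer x y"] outer_add_in_dual_ball[OF k uv that] uu that uBv
    by (simp add: outer_vec inner_outer inner_add_left matrix_vector_mult_add_rdistrib inner_add_right inner_commute[of y])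
  have perp': "x \<bullet> (B *v y) = 0" if "u \<bullet> x = 0" "v \<bullet> y = 0" for x y
  proof (cases "x = 0 \<or> y = 0")
    case False
    then show ?thesis using perp[of "x /\<^sub>R norm x" "y /\<^sub>R norm y"] that by (simp add: matrix_vector_mult_scaleR)
  qed auto
  have Bv: "B *v v = \<beta> *\<^sub>R u"
    using norm_le_ky_fan[OF k1 k(2) uv(2), of B] uv uBv by (intro inner_attains_norm) (auto simp: \<beta>_def)
  have Bu: "u v* B = \<beta> *\<^sub>R v"
    using norm_le_ky_fan[OF k1 k(2) uv(1), of "transpose B"] uv uBv
    by (intro inner_attains_norm) (auto simp: \<beta>_def ky_fan_transpose inner_commute[of v] dot_lmul_matrix)
  have "B *v y = \<beta> *\<^sub>R (outer u v *v y)" for y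
  proof -
    define y' where "y' = y - (v \<bullet> y) *\<^sub>R v"
    have y': "v \<bullet> y' = 0" "y = y' + (v \<bullet> y) *\<^sub>R v" by (simp_all add: y'_def inner_diff_right uu)
    have "B *v y' = 0"
    proof -
      define z where "z = B *v y'"
      have "u \<bullet> z = (u v* B) \<bullet> y'" by (simp add: z_def dot_lmul_matrix)
      then have "u \<bullet> z = 0" using y' by (simp add: Bu)
      then have "z \<bullet> (B *v y') = 0" using perp' y' by blast
      then show ?thesis by (simp add: z_def)
    qed
    then have "B *v y = (v \<bullet> y) *\<^sub>R (\<beta> *\<^sub>R u)"
      by (subst y'(2)) (simp add: matrix_vector_right_distrib matrix_vector_mult_scaleR Bv)
    then show ?thesis by (simp add: outer_vec mult.commute)
  qed
  then have "B = \<beta> *\<^sub>R outer u v" by (simp add: matrix_eq scaleR_matrix_vector_assoc)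
  then show "\<exists>b. B = b *\<^sub>R outer u v" by blast
qed

lemma diag_component: "diag x $ i $ i = x $ i"
  by (simp add: diag_def)

text \<open>For any other matrix a nontrivial additive decomposition exists among the diagonal
  matrices in its singular bases. It depends on whether the smallest singular value
  \<open>\<mu>\<close> is attained in the leading set, and then on whether it is 0.\<close>

lemma atomic_form:
  fixes A :: "real^'n^'n"
  assumes k: "2 \<le> k" "k \<le> CARD('n)" and A: "atomic k A"
  shows "(\<exists>x y. A = outer x y) \<or> (\<exists>r W. orthogonal_matrix W \<and> A = r *\<^sub>R W)"
proof (rule ccontr)
  assume contra: "\<not> ?thesis"
  obtain U V s where svd: "orthogonal_matrix U" "orthogonal_matrix V" "A = U ** diag s ** V" "\<And>i. 0 \<le> s $ i"
    using singular_value_decomposition[of A] by blast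
  have conj: "M = M'" if "U ** M ** V = U ** M' ** V" for M M' :: "real^'n^'n"
    using orthogonal_conjugate_cancel[OF svd(1,2)] by (metis that)
  have split: "\<exists>b. x = b *\<^sub>R s"
    if xy: "s = x + y" and S: "card S = k" "\<And>i j. i \<in> S \<Longrightarrow> j \<notin> S \<Longrightarrow> \<bar>x $ j\<bar> \<le> \<bar>x $ i\<bar>"
      "\<And>i j. i \<in> S \<Longrightarrow> j \<notin> S \<Longrightarrow> \<bar>y $ j\<bar> \<le> \<bar>y $ i\<bar>" "\<And>i. i \<in> S \<Longrightarrow> 0 \<le> x $ i * y $ i" for x y S
  proof -
    have "A = U ** diag x ** V + U ** diag y ** V"
      by (simp add: svd(3) xy mult_diag_add)
    then obtain b where "U ** diag x ** V = b *\<^sub>R A"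
      using A ky_fan_diag_additive[OF svd(1,2) k(2) S] unfolding atomic_def by metis
    also have "\<dots> = U ** diag (b *\<^sub>R s) ** V"
      by (simp add: svd(3) mult_diag_scaleR)
    finally have "diag x = diag (b *\<^sub>R s)" by (rule conj)
    then have "x $ i = (b *\<^sub>R s) $ i" for i by (metis diag_component)
    then show ?thesis by (auto simp: vec_eq_iff)
  qed
  obtain p where p: "\<And>i. s $ p \<le> s $ i"
    using arg_min_if_finite(1)[of UNIV "\<lambda>i. s $ i"] by (metis arg_min_least finite UNIV_I UNIV_not_empty)
  define \<mu> where "\<mu> = s $ p"
  have \<mu>: "0 \<le> \<mu>" "\<And>i. \<mu> \<le> s $ i" using svd(4) p by (auto simp: \<mu>_def)
  obtain q where q: "\<mu> < s $ q"
  proof (rule ccontr)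
    assume "\<not> thesis"
    then have "s $ i = \<mu>" for i using \<mu>(2)[of i] that[of i] by fastforce
    then have "diag s = \<mu> *\<^sub>R mat 1" by (simp add: diag_def mat_def vec_eq_iff)
    then have "A = \<mu> *\<^sub>R (U ** V)" by (simp add: svd(3) matrix_scalar_ac scalar_matrix_assoc)
    moreover have "orthogonal_matrix (U ** V)" using svd by (simp add: orthogonal_matrix_mul)
    ultimately show False using contra by blast
  qed
  obtain S where S: "card S = k" "\<And>i j. i \<in> S \<Longrightarrow> j \<notin> S \<Longrightarrow> \<bar>s $ j\<bar> \<le> \<bar>s $ i\<bar>"
    using ky_fan_diag[OF svd(1,2) k(2), of s] by blast
  then have top: "\<And>i j. i \<in> S \<Longrightarrow> j \<notin> S \<Longrightarrow> s $ j \<le> s $ i" using svd(4) by simp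
  have "S \<noteq> {}" using S k by auto
  show False
  proof (cases "\<forall>i\<in>S. \<mu> < s $ i")
    case True
    \<comment> \<open>Half the gap: a smallest entry, moved by \<open>\<epsilon>\<close> up or down,
      stays below the leading ones.\<close>
    define \<epsilon> where "\<epsilon> = (Min ((\<lambda>i. s $ i) ` S) - \<mu>) / 2"
    have "\<mu> < Min ((\<lambda>i. s $ i) ` S)" using True \<open>S \<noteq> {}\<close> by simp
    then have \<epsilon>: "\<epsilon> > 0" by (simp add: \<epsilon>_def)
    have \<epsilon>': "\<mu> + 2 * \<epsilon> \<le> s $ i" if "i \<in> S" for i
      using Min_le[of "(\<lambda>i. s $ i) ` S" "s $ i"] that by (simp add: \<epsilon>_def field_simps)
    have "p \<notin> S" using True by (auto simp: \<mu>_def)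
    define x y where "x = (1/2) *\<^sub>R (s + \<epsilon> *\<^sub>R axis p 1)" and "y = (1/2) *\<^sub>R (s - \<epsilon> *\<^sub>R axis p 1)"
    have xc: "x $ i = (if i = p then (\<mu> + \<epsilon>) / 2 else s $ i / 2)" 
      and yc: "y $ i = (if i = p then (\<mu> - \<epsilon>) / 2 else s $ i / 2)" for i
      by (simp_all add: x_def y_def \<mu>_def axis_1_component)
    have "\<exists>b. x = b *\<^sub>R s"
    proof (rule split[OF _ S(1)])
      show "s = x + y" by (simp add: vec_eq_iff xc yc \<mu>_def field_simps)
      fix i assume i: "i \<in> S"
      then have ip: "i \<noteq> p" using \<open>p \<notin> S\<close> by auto
      then show "0 \<le> x $ i * y $ i" using svd(4)[of i] by (simp add: xc yc)
      fix j assume j: "j \<notin> S"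
      show "\<bar>x $ j\<bar> \<le> \<bar>x $ i\<bar>" "\<bar>y $ j\<bar> \<le> \<bar>y $ i\<bar>"
        using ip top[OF i j] \<epsilon>'[OF i] \<mu>(1) \<epsilon> svd(4)[of i] svd(4)[of j] by (auto simp: xc yc)
    qed
    then obtain b where b: "x = b *\<^sub>R s" by blast
    have "q \<noteq> p" using q by (auto simp: \<mu>_def)
    have "b = 1 / 2" using arg_cong[OF b, of "\<lambda>v. v $ q"] q \<mu>(1) \<open>q \<noteq> p\<close> by (simp add: xc)
    then show False
      using arg_cong[OF b[unfolded \<open>b = 1 / 2\<close>], of "\<lambda>v. v $ p"] \<epsilon> by (simp add: xc \<mu>_def)
  next
    case False
    then obtain i0 where "i0 \<in> S" "s $ i0 = \<mu>" using \<mu>(2) by (metis order_le_less)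
    then have out: "s $ j = \<mu>" if "j \<notin> S" for j using top[of i0 j] that \<mu>(2)[of j] by simp
    show False
    proof (cases "\<mu> = 0")
      case False
      \<comment> \<open>All entries outside \<open>S\<close> equal \<open>\<mu>\<close>, so the
        constant vector splits off.\<close>
      define x y where "x = s - (\<chi> i. \<mu>)" and "y = (\<chi> i::'n. \<mu>)"
      have "\<exists>b. x = b *\<^sub>R s"
        by (rule split[of x y, OF _ S(1)]) (use \<mu> out in \<open>auto simp: x_def y_def vec_eq_iff\<close>)
      then obtain b where b: "x = b *\<^sub>R s" by blast
      have "b = 0" using arg_cong[OF b, of "\<lambda>v. v $ p"] False by (simp add: x_def \<mu>_def)
      then show False using arg_cong[OF b, of "\<lambda>v. v $ q"] q by (simp add: x_def)
    next
      case True
      have "\<exists>q'. q' \<noteq> q \<and> s $ q' \<noteq> 0"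
      proof (rule ccontr)
        assume "\<not> ?thesis"
        then have "s = s $ q *\<^sub>R axis q 1" by (auto simp: vec_eq_iff axis_1_component)
        then have "A = s $ q *\<^sub>R outer (U *v axis q 1) (axis q 1 v* V)"
          by (metis svd(3) mult_diag_scaleR mult_diag_axis)
        then have "A = outer (s $ q *\<^sub>R (U *v axis q 1)) (axis q 1 v* V)" by (simp add: outer_bilinear)
        with contra show False by blast
      qed
      then obtain q' where q': "q' \<noteq> q" "s $ q' \<noteq> 0" by blast
      \<comment> \<open>The support lies in \<open>S\<close> and has at least two elements, so one
        entry splits off.\<close>
      define x y where "x = s $ q *\<^sub>R axis q (1::real)" and "y = s - s $ q *\<^sub>R axis q (1::real)"
      have xc: "x $ i = (if i = q then s $ q else 0)" and yc: "y $ i = (if i = q then 0 else s $ i)" for i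
        by (simp_all add: x_def y_def axis_1_component)
      have "q \<in> S" using out[of q] q by auto
      have "\<exists>b. x = b *\<^sub>R s"
        by (rule split[of x y, OF _ S(1)]) (use out True \<open>q \<in> S\<close> in \<open>auto simp: xc yc vec_eq_iff\<close>)
      then obtain b where b: "x = b *\<^sub>R s" by blast
      have "b = 0" using arg_cong[OF b, of "\<lambda>v. v $ q'"] q' by (simp add: xc)
      then show False using arg_cong[OF b, of "\<lambda>v. v $ q"] q True by (simp add: xc)
    qed
  qed
qed

lemma isometry_rank_one_image:
  fixes S :: "real^'n^'n \<Rightarrow> real^'n^'n"
  assumes k: "2 \<le> k" "k \<le> CARD('n)" and lin: "linear S" and bij: "bij S"
    and iso: "\<And>A. ky_fan k (S A) = ky_fan k A"
  shows "(\<exists>x y. S (outer u v) = outer x y) \<or> (\<exists>r W. orthogonal_matrix W \<and> S (outer u v) = r *\<^sub>R W)"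
proof (cases "u = 0 \<or> v = 0")
  case True
  then have "S (outer u v) = outer 0 0" by (auto simp: linear_0[OF lin])
  then show ?thesis by blast
next
  case False
  define u' v' where "u' = u /\<^sub>R norm u" and "v' = v /\<^sub>R norm v"
  have eq: "outer u v = (norm u * norm v) *\<^sub>R outer u' v'"
    unfolding u'_def v'_def using False by (intro outer_normalize) auto
  have "atomic k (outer u' v')" using False by (intro atomic_outer k) (simp_all add: u'_def v'_def)
  have "atomic k (S (outer u' v'))"
    unfolding atomic_def
  proof safe
    fix B C assume *: "S (outer u' v') = B + C" "ky_fan k (S (outer u' v')) = ky_fan k B + ky_fan k C"
    obtain B' C' where BC: "S B' = B" "S C' = C" using bij by (metis bij_pointE)
    then have "S (outer u' v') = S (B' + C')" using * by (simp add: linear_add[OF lin])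
    then have "outer u' v' = B' + C'" using bij by (metis bij_pointE)
    moreover have "ky_fan k (outer u' v') = ky_fan k B' + ky_fan k C'" using * iso BC by metis
    ultimately obtain b where "B' = b *\<^sub>R outer u' v'"
      using \<open>atomic k (outer u' v')\<close> unfolding atomic_def by blast
    then show "\<exists>b. B = b *\<^sub>R S (outer u' v')" using BC by (metis linear_cmul[OF lin])
  qed
  from atomic_form[OF k this] show ?thesis
  proof (elim disjE exE conjE)
    fix x y assume "S (outer u' v') = outer x y"
    then have "S (outer u v) = outer ((norm u * norm v) *\<^sub>R x) y"
      by (simp only: eq linear_cmul[OF lin] outer_scaleR_left)
    then show ?thesis by blast
  next
    fix r W assume "orthogonal_matrix W" "S (outer u' v') = r *\<^sub>R W"
    then have "S (outer u v) = (norm u * norm v * r) *\<^sub>R W"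
      by (simp only: eq linear_cmul[OF lin] scaleR_scaleR)
    then show ?thesis using \<open>orthogonal_matrix W\<close> by blast
  qed
qed

text \<open>Neither \<open>X + Y\<close> nor \<open>X - Y\<close> is an outer product, since
  \<open>Y\<close> would have rank at most two while \<open>n \<ge> 3\<close>. If both are multiples
  of orthogonal matrices, the parallelogram law makes the length of \<open>z v* X\<close>
  proportional to that of \<open>z\<close>, but it vanishes for \<open>z\<close> orthogonal to
  \<open>x\<close>.\<close>

lemma rank_one_plus_orthogonal:
  fixes X Y :: "real^'n^'n"
  assumes n: "3 \<le> CARD('n)" and X: "X = outer x y" "X \<noteq> 0"
    and Y: "Y = r *\<^sub>R W" "orthogonal_matrix W" "Y \<noteq> 0"
    and sum: "(\<exists>a b. X + Y = outer a b) \<or> (\<exists>t V. orthogonal_matrix V \<and> X + Y = t *\<^sub>R V)"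
    and diff: "(\<exists>a b. X - Y = outer a b) \<or> (\<exists>t V. orthogonal_matrix V \<and> X - Y = t *\<^sub>R V)"
  shows False
proof -
  have r: "r \<noteq> 0" using Y by auto
  have no: "Y \<noteq> c *\<^sub>R (outer a b - outer x y)" for a b c
  proof
    assume eq: "Y = c *\<^sub>R (outer a b - outer x y)"
    obtain z where z: "norm z = 1" "b \<bullet> z = 0" "y \<bullet> z = 0" using exists_orthogonal_pair[OF n] by blast
    have "Y *v z = 0"
      using z by (simp add: eq scaleR_matrix_vector_assoc[symmetric] matrix_vector_mult_diff_rdistrib outer_vec)
    then have "norm (W *v z) = 0" using r by (simp add: Y scaleR_matrix_vector_assoc[symmetric])
    then show False using z by (simp add: orthogonal_matrix_norm[OF Y(2)])
  qed
  have "X + Y \<noteq> outer a b" for a b using no[of 1 a b] by (auto simp: X algebra_simps)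
  moreover have "X - Y \<noteq> outer a b" for a b using no[of "-1" a b] by (auto simp: X algebra_simps)
  ultimately obtain s t P Q where P: "orthogonal_matrix P" "X + Y = s *\<^sub>R P" and Q: "orthogonal_matrix Q" "X - Y = t *\<^sub>R Q"
    using sum diff by blast
  have nrm: "(norm (z v* (c *\<^sub>R M)))\<^sup>2 = c\<^sup>2 * (norm z)\<^sup>2" if "orthogonal_matrix M" for z c and M :: "real^'n^'n"
  proof -
    have "z v* (c *\<^sub>R M) = c *\<^sub>R (z v* M)"
      by (simp add: vector_matrix_mult_def vec_eq_iff sum_distrib_left mult_ac)
    then show ?thesis by (simp add: vec_transpose_norm[OF that] power_mult_distrib)
  qed
  have par: "s\<^sup>2 * (norm z)\<^sup>2 + t\<^sup>2 * (norm z)\<^sup>2 = 2 * (x \<bullet> z)\<^sup>2 * (norm y)\<^sup>2 + 2 * r\<^sup>2 * (norm z)\<^sup>2" for z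
  proof -
    have "(norm (z v* (X + Y)))\<^sup>2 + (norm (z v* (X - Y)))\<^sup>2 = 2 * (norm (z v* X))\<^sup>2 + 2 * (norm (z v* Y))\<^sup>2"
      by (simp add: vector_matrix_mult_add_rdistrib vector_matrix_mult_diff_rdistrib power2_norm_eq_inner
          inner_add_left inner_add_right inner_diff_left inner_diff_right)
    moreover have "(norm (z v* (X + Y)))\<^sup>2 = s\<^sup>2 * (norm z)\<^sup>2" by (simp only: P(2) nrm[OF P(1)])
    moreover have "(norm (z v* (X - Y)))\<^sup>2 = t\<^sup>2 * (norm z)\<^sup>2" by (simp only: Q(2) nrm[OF Q(1)])
    moreover have "(norm (z v* Y))\<^sup>2 = r\<^sup>2 * (norm z)\<^sup>2" by (simp only: Y(1) nrm[OF Y(2)])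
    moreover have "(norm (z v* X))\<^sup>2 = (x \<bullet> z)\<^sup>2 * (norm y)\<^sup>2" by (simp add: X vec_outer power_mult_distrib)
    ultimately show ?thesis by simp
  qed
  obtain z where z: "norm z = 1" "x \<bullet> z = 0" using exists_orthogonal_pair[OF n] by blast
  have "s\<^sup>2 + t\<^sup>2 = 2 * r\<^sup>2" using par[of z] z by simp
  then have "(s\<^sup>2 + t\<^sup>2) * (norm x)\<^sup>2 = 2 * r\<^sup>2 * (norm x)\<^sup>2" by simp
  with par[of x] have "(x \<bullet> x)\<^sup>2 * (norm y)\<^sup>2 = 0" by (simp add: algebra_simps)
  then have "X = 0" by (auto simp: X)
  with X show False by simp
qed

text \<open>From \<open>outer u0 v0\<close> to \<open>outer u1 v1\<close> one passes via
  \<open>outer u0 v1\<close>, changing one factor at a time, so sums and differences of neighbours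
  are still outer products. A change of type at either step contradicts
  \<open>rank_one_plus_orthogonal\<close>.\<close>

lemma isometry_rank_one_dichotomy:
  fixes S :: "real^'n^'n \<Rightarrow> real^'n^'n"
  assumes n: "3 \<le> CARD('n)" and k: "2 \<le> k" "k \<le> CARD('n)" and lin: "linear S" and bij: "bij S"
    and iso: "\<And>A. ky_fan k (S A) = ky_fan k A"
  shows "(\<forall>u v. \<exists>x y. S (outer u v) = outer x y) \<or>
    (\<forall>u v. \<exists>r W. orthogonal_matrix W \<and> S (outer u v) = r *\<^sub>R W)"
proof (rule ccontr)
  assume "\<not> ?thesis"
  then obtain u0 v0 u1 v1 where 0: "\<And>x y. S (outer u0 v0) \<noteq> outer x y"
    and 1: "\<And>r W. orthogonal_matrix W \<Longrightarrow> S (outer u1 v1) \<noteq> r *\<^sub>R W" by metis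
  note form = isometry_rank_one_image[OF k lin bij iso]
  have nz: "S (outer u v) \<noteq> 0" if "u \<noteq> 0" "v \<noteq> 0" for u v
    by (rule linear_outer_nonzero[OF lin bij_is_inj[OF bij] that])
  have mix: False
    if *: "S (outer u v) = outer x y" "orthogonal_matrix W" "S (outer u' v') = r *\<^sub>R W"
      and nz': "u \<noteq> 0" "v \<noteq> 0" "u' \<noteq> 0" "v' \<noteq> 0"
      and sum: "outer u v + outer u' v' = outer p q" and diff: "outer u v - outer u' v' = outer p' q'"
    for u v u' v' x y r W p q p' q'
    by (rule rank_one_plus_orthogonal[OF n *(1) nz[OF nz'(1,2)] *(3,2) nz[OF nz'(3,4)]])
      (simp_all only: sum diff form flip: linear_add[OF lin] linear_diff[OF lin])
  have nz0: "u0 \<noteq> 0" "v0 \<noteq> 0" using 0[of 0 0] by (auto simp: linear_0[OF lin])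
  have nz1: "u1 \<noteq> 0" "v1 \<noteq> 0" using 1[OF orthogonal_matrix_id, of 0] by (auto simp: linear_0[OF lin])
  obtain r W where W: "orthogonal_matrix W" "S (outer u0 v0) = r *\<^sub>R W" using form[of u0 v0] 0 by blast
  obtain x y where xy: "S (outer u1 v1) = outer x y" using form[of u1 v1] 1 by blast
  show False
    using form[of u0 v1]
  proof (elim disjE exE conjE)
    fix a b assume "S (outer u0 v1) = outer a b"
    then show False
      using mix[OF _ W, of u0 v1 a b u0 "v0 + v1" u0 "v1 - v0"] nz0 nz1 by (simp add: outer_bilinear)
  next
    fix t V assume "orthogonal_matrix V" "S (outer u0 v1) = t *\<^sub>R V"
    then show False
      using mix[OF xy, of V u0 v1 t "u0 + u1" v1 "u1 - u0" v1] nz0 nz1 by (simp add: outer_bilinear)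
  qed
qed

section \<open>The dimension bound when rank one matrices become multiples of orthogonal
  ones\<close>

lemma card_ordered_pairs:
  fixes f :: "'n::finite \<Rightarrow> nat"
  assumes "inj f"
  shows "2 * card {(i, j). f i < f j} + CARD('n) = CARD('n) * CARD('n)"
proof -
  let ?L = "{(i, j). f i < f j}" and ?G = "{(i, j). f j < f i}" and ?D = "{(i, j). f i = f j}"
  have "bij_betw prod.swap ?L ?G"
    by (rule bij_betw_byWitness[where f' = prod.swap]) auto
  then have G: "card ?G = card ?L" by (simp add: bij_betw_same_card)
  have "?D = (\<lambda>i. (i, i)) ` UNIV" using assms by (auto simp: inj_eq)
  then have D: "card ?D = CARD('n)" by (simp add: card_image inj_on_def)
  have "CARD('n) * CARD('n) = card (UNIV :: ('n \<times> 'n) set)" by simp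
  also have "(UNIV :: ('n \<times> 'n) set) = (?L \<union> ?G) \<union> ?D" by auto
  also have "card \<dots> = card (?L \<union> ?G) + card ?D"
    by (rule card_Un_disjoint) auto
  also have "card (?L \<union> ?G) = card ?L + card ?G"
    by (rule card_Un_disjoint) auto
  finally show ?thesis by (simp add: G D)
qed

text \<open>On the complement of \<open>e\<close> there is room: the operator norm there may reach
  1, and the trace norm may grow from 1 to 2 because \<open>k \<ge> 2\<close>.\<close>

lemma rank_one_perturbation_in_dual_ball:
  fixes W :: "real^'n^'n"
  assumes k: "2 \<le> k" "k \<le> CARD('n)" and e: "norm e = 1"
    and W: "W *v e = 0" "e v* W = 0"
  obtains \<epsilon> where "\<epsilon> > 0" "outer e e + \<epsilon> *\<^sub>R W \<in> dual_ball k" "outer e e - \<epsilon> *\<^sub>R W \<in> dual_ball k"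
proof -
  define C where "C = onorm ((*v) W) + 1"
  have C: "C > 0" using onorm_pos_le[of "(*v) W"] by (simp add: C_def linear_linear)
  have bound: "\<bar>u \<bullet> (W *v v)\<bar> \<le> C * (norm u * norm v)" for u v
  proof -
    have "norm (W *v v) \<le> onorm ((*v) W) * norm v" by (rule onorm) (simp add: linear_linear)
    also have "\<dots> \<le> C * norm v" by (simp add: C_def mult_right_mono)
    finally have "norm u * norm (W *v v) \<le> norm u * (C * norm v)" by (rule mult_left_mono) simp
    then show ?thesis using Cauchy_Schwarz_ineq2[of u "W *v v"] by (simp add: mult_ac)
  qed
  \<comment> \<open>The factor \<open>CARD('n)\<close> lets the \<open>n\<close> diagonal entries of
    the perturbation contribute at most 1 in total.\<close>
  define \<epsilon> where "\<epsilon> = 1 / (C * CARD('n))"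
  have \<epsilon>: "\<epsilon> > 0" "\<epsilon> * C * CARD('n) = 1" using C by (simp_all add: \<epsilon>_def)
  have n1: "1 \<le> real CARD('n)" using k by (simp add: Suc_le_eq)
  have \<epsilon>C: "\<epsilon> * C \<le> 1"
  proof -
    have "\<epsilon> * C * 1 \<le> \<epsilon> * C * CARD('n)" using n1 \<epsilon> C by (intro mult_left_mono) auto
    then show ?thesis using \<epsilon> by simp
  qed
  have mem: "outer e e + t *\<^sub>R W \<in> dual_ball k" if t: "\<bar>t\<bar> = \<epsilon>" for t
  proof (rule dual_ballI[OF k(2)])
    have eval: "u \<bullet> ((outer e e + t *\<^sub>R W) *v v) = (e \<bullet> u) * (e \<bullet> v) + t * (u \<bullet> (W *v v))" for u v
      by (simp add: matrix_vector_mult_add_rdistrib outer_vec inner_add_right inner_commute mult.commute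
          scaleR_matrix_vector_assoc[symmetric])
    show "\<bar>u \<bullet> ((outer e e + t *\<^sub>R W) *v v)\<bar> \<le> 1" if uv: "norm u = 1" "norm v = 1" for u v
    proof -
      define u' v' where "u' = u - (e \<bullet> u) *\<^sub>R e" and "v' = v - (e \<bullet> v) *\<^sub>R e"
      have split: "(e \<bullet> x)\<^sup>2 + (norm (x - (e \<bullet> x) *\<^sub>R e))\<^sup>2 = (norm x)\<^sup>2" for x
        unfolding power2_norm_eq_inner power2_eq_square[of "e \<bullet> x"]
        using e by (simp add: inner_diff_left inner_diff_right inner_commute norm_eq_1)
      have "u \<bullet> (W *v v) = u' \<bullet> (W *v v')"
        using W by (simp add: u'_def v'_def matrix_vector_mult_diff_distrib matrix_vector_mult_scaleR inner_diff_left
            dot_lmul_matrix[symmetric] vector_matrix_mult_diff_distrib scaleR_vector_matrix_assoc)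
      then have "\<bar>t * (u \<bullet> (W *v v))\<bar> \<le> \<epsilon> * (C * (norm u' * norm v'))"
        unfolding abs_mult t using bound[of u' v'] \<epsilon> by (simp add: mult_left_mono)
      also have "\<dots> \<le> 1 * (norm u' * norm v')"
        using mult_right_mono[OF \<epsilon>C, of "norm u' * norm v'"] by (simp add: mult.assoc)
      finally have 1: "\<bar>t * (u \<bullet> (W *v v))\<bar> \<le> norm u' * norm v'" by simp
      have 2: "2 * (norm u' * norm v') \<le> (norm u')\<^sup>2 + (norm v')\<^sup>2"
        using sum_squares_bound[of "norm u'" "norm v'"] by (simp add: mult.assoc)
      have 3: "2 * \<bar>(e \<bullet> u) * (e \<bullet> v)\<bar> \<le> (e \<bullet> u)\<^sup>2 + (e \<bullet> v)\<^sup>2"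
        using sum_squares_bound[of "\<bar>e \<bullet> u\<bar>" "\<bar>e \<bullet> v\<bar>"] by (simp add: abs_mult mult.assoc)
      show ?thesis
        unfolding eval using 1 2 3 split[of u] split[of v] uv by (simp add: u'_def v'_def)
    qed
    show "(\<Sum>i\<in>UNIV. \<bar>(U ** (outer e e + t *\<^sub>R W) ** V) $ i $ i\<bar>) \<le> k"
      if U: "orthogonal_matrix U" and V: "orthogonal_matrix V" for U V
    proof -
      let ?u = "\<lambda>i. axis i 1 v* U" and ?v = "\<lambda>i. V *v axis i 1"
      have "(\<Sum>i\<in>UNIV. \<bar>(U ** (outer e e + t *\<^sub>R W) ** V) $ i $ i\<bar>)
          \<le> (\<Sum>i\<in>UNIV. \<bar>(U *v e) $ i * (e v* V) $ i\<bar> + \<epsilon> * C)"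
      proof (rule sum_mono)
        fix i
        have "e \<bullet> ?u i = (U *v e) $ i"
          by (simp add: inner_commute[of e] dot_lmul_matrix inner_axis')
        moreover have "e \<bullet> ?v i = (e v* V) $ i"
          by (simp add: dot_lmul_matrix[symmetric] inner_axis)
        moreover have "\<bar>t * (?u i \<bullet> (W *v ?v i))\<bar> \<le> \<epsilon> * C"
          unfolding abs_mult t using bound[of "?u i" "?v i"] \<epsilon>
          by (simp add: norm_orthogonal_axis[OF U] norm_orthogonal_axis[OF V])
        ultimately show "\<bar>(U ** (outer e e + t *\<^sub>R W) ** V) $ i $ i\<bar> \<le> \<bar>(U *v e) $ i * (e v* V) $ i\<bar> + \<epsilon> * C"
          unfolding mult3_entry eval by simp
      qed
      also have "\<dots> = (\<Sum>i\<in>UNIV. \<bar>(U *v e) $ i * (e v* V) $ i\<bar>) + 1"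
        using \<epsilon>(2) by (simp add: sum.distrib mult_ac)
      also have "(\<Sum>i\<in>UNIV. \<bar>(U *v e) $ i * (e v* V) $ i\<bar>) \<le> norm (U *v e) * norm (e v* V)"
        by (rule sum_abs_le_norm)
      also have "\<dots> = 1" using e by (simp add: orthogonal_matrix_norm[OF U] vec_transpose_norm[OF V])
      finally show ?thesis using k(1) by simp
    qed
  qed
  show thesis using that[OF \<epsilon>(1)] mem[of \<epsilon>] mem[of "- \<epsilon>"] \<epsilon> by simp
qed

text \<open>If all rank one matrices become multiples of orthogonal matrices, then \<open>S\<close> maps the
  \<open>(2n - 1)\<close>-dimensional span of a row and a column onto a space containing \<open>W X\<close>
  for all skew-symmetric \<open>X\<close>, where \<open>W\<close> is orthogonal.\<close>

lemma orthogonal_type_dimension: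
  fixes S :: "real^'n^'n \<Rightarrow> real^'n^'n"
  assumes k: "2 \<le> k" "k \<le> CARD('n)" and lin: "linear S" and bij: "bij S"
    and iso: "\<And>A. ky_fan k (S A) = ky_fan k A"
    and orth: "\<And>u v. \<exists>r W. orthogonal_matrix W \<and> S (outer u v) = r *\<^sub>R W"
  shows "CARD('n) \<le> 4"
proof -
  define a :: 'n where "a = undefined"
  define e :: "real^'n" where "e = axis a 1"
  have e: "norm e = 1" by (simp add: e_def)
  obtain r W where W: "orthogonal_matrix W" "S (outer e e) = r *\<^sub>R W" using orth by blast
  have k1: "1 \<le> k" using k by simp
  have r: "r \<noteq> 0"
  proof
    assume "r = 0"
    then have "ky_fan k (S (outer e e)) = 0" using W k by (simp add: ky_fan_zero)
    then show False using k1 k e by (simp add: iso ky_fan_outer)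
  qed
  \<comment> \<open>Images of the matrix units in row \<open>a\<close> and column \<open>a\<close>,
    the common one listed once: at most \<open>2n - 1\<close> generators.\<close>
  define B where "B = insert (S (outer e e)) ((\<lambda>j. S (outer e (axis j 1))) ` (- {a}) \<union> (\<lambda>i. S (outer (axis i 1) e)) ` (- {a}))"
  have fin: "finite B" by (simp add: B_def)
  have "card ((\<lambda>j. S (outer e (axis j 1))) ` (- {a})) \<le> CARD('n) - 1"
    by (rule order.trans[OF card_image_le]) (simp_all add: Compl_eq_Diff_UNIV)
  moreover have "card ((\<lambda>i. S (outer (axis i 1) e)) ` (- {a})) \<le> CARD('n) - 1"
    by (rule order.trans[OF card_image_le]) (simp_all add: Compl_eq_Diff_UNIV)
  moreover have "card B \<le> Suc (card ((\<lambda>j. S (outer e (axis j 1))) ` (- {a})) + card ((\<lambda>i. S (outer (axis i 1) e)) ` (- {a})))"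
  proof -
    have "card (insert x (A1 \<union> A2)) \<le> Suc (card A1 + card A2)" if "finite (A1 \<union> A2)" for x :: "real^'n^'n" and A1 A2
      using card_Un_le[of A1 A2] that by (simp add: card_insert_if)
    then show ?thesis unfolding B_def by simp
  qed
  ultimately have card_B: "card B + 1 \<le> 2 * CARD('n)" using k by linarith
  have B: "S (outer e (axis j 1)) \<in> B" "S (outer (axis j 1) e) \<in> B" for j
    by (cases "j = a"; simp add: B_def e_def)+
  \<comment> \<open>\<open>W\<close> times the standard basis of the skew-symmetric
    matrices.\<close>
  define K where "K i j = outer (W *v axis i 1) (axis j 1) - outer (W *v axis j 1) (axis i (1::real))" for i j
  \<comment> \<open>The component \<open>z\<close> of \<open>K i j\<close> orthogonal to
    \<open>span B\<close> pulls back to a matrix \<open>X\<close> whose row and column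
    \<open>a\<close> vanish. Hence small multiples of \<open>X\<close> of both signs can be added to
    \<open>outer e e\<close> within the dual ball.\<close>
  have K_span: "K i j \<in> span B" for i j
  proof -
    obtain y z where yz: "y \<in> span B" "\<And>w. w \<in> span B \<Longrightarrow> orthogonal z w" "K i j = y + z"
      using orthogonal_subspace_decomp_exists[of B "K i j"] by blast
    define X where "X = adjoint S z"
    have X: "M \<bullet> X = S M \<bullet> z" for M by (simp add: X_def adjoint_works[OF lin])
    have "outer e (axis j 1) \<bullet> X = 0" "outer (axis j 1) e \<bullet> X = 0" for j
      unfolding X using yz(2)[OF span_base[OF B(1)]] yz(2)[OF span_base[OF B(2)]] by (simp_all add: orthogonal_def inner_commute)
    then have "e \<bullet> (X *v axis j 1) = 0" "axis j 1 \<bullet> (X *v e) = 0" for j by (simp_all add: inner_outer)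
    moreover have "e \<bullet> (X *v axis j 1) = (e v* X) $ j" "axis j 1 \<bullet> (X *v e) = (X *v e) $ j" for j
      by (simp add: dot_lmul_matrix[symmetric] inner_axis) (simp add: inner_axis')
    ultimately have "(e v* X) $ j = 0" "(X *v e) $ j = 0" for j by metis+
    then have "e v* X = 0" "X *v e = 0" by (simp_all add: vec_eq_iff)
    then obtain \<epsilon> where \<epsilon>: "\<epsilon> > 0" "outer e e + \<epsilon> *\<^sub>R X \<in> dual_ball k" "outer e e - \<epsilon> *\<^sub>R X \<in> dual_ball k"
      using rank_one_perturbation_in_dual_ball[OF k e] by blast
    have lin_inv: "linear (inv S)" using lin bij by (simp add: bij_is_inj bij_is_surj inj_linear_imp_inv_linear)
    have inv: "S (inv S M) = M" "inv S (S M) = M" for M using bij by (simp_all add: bij_is_surj surj_f_inv_f bij_is_inj)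
    \<comment> \<open>The isometry carries a functional supporting \<open>outer e e\<close> to a
      functional \<open>G\<close> supporting a multiple of \<open>W\<close>; symmetry of
      \<open>transpose G ** W\<close> makes \<open>G\<close> orthogonal to
      \<open>K i j\<close>.\<close>
    have zero: "Z \<bullet> inv S (K i j) = 0" if Z: "Z \<in> dual_ball k" "Z \<bullet> outer e e = 1" for Z
    proof -
      define G where "G = adjoint (inv S) Z"
      have G: "G \<bullet> M = Z \<bullet> inv S M" for M
        by (simp add: G_def inner_commute adjoint_works[OF lin_inv])
      have "G \<in> dual_ball k"
        unfolding dual_ball_def using dual_ballD[OF Z(1)] by (auto simp: G) (metis inv(1) iso)
      moreover have "G \<bullet> S (outer e e) = ky_fan k (S (outer e e))"
        using Z k1 k e by (simp add: G inv iso ky_fan_outer)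
      ultimately have "(G *v axis j 1) \<bullet> (S (outer e e) *v axis i 1) = (G *v axis i 1) \<bullet> (S (outer e e) *v axis j 1)"
        by (rule attained_symmetric(1))
      then have "G \<bullet> K i j = 0"
        using r by (simp add: W(2) K_def inner_diff_right inner_outer_right scaleR_matrix_vector_assoc[symmetric] inner_commute)
      then show ?thesis by (simp add: G)
    qed
    have "X \<bullet> outer e e = 0"
      using \<open>X *v e = 0\<close> by (simp add: inner_outer_right)
    moreover have "outer e e \<bullet> outer e e = (1 :: real)"
      using e by (simp add: inner_outer outer_vec norm_eq_1)
    ultimately have "(outer e e + \<epsilon> *\<^sub>R X) \<bullet> inv S (K i j) = 0" "(outer e e - \<epsilon> *\<^sub>R X) \<bullet> inv S (K i j) = 0"
      using zero[OF \<epsilon>(2)] zero[OF \<epsilon>(3)] by (simp_all add: inner_add_left inner_diff_left)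
    then have "X \<bullet> inv S (K i j) = 0" using \<epsilon>(1) by (simp add: inner_add_left inner_diff_left)
    then have "z \<bullet> K i j = 0" using X[of "inv S (K i j)"] by (simp add: inv inner_commute)
    moreover have "z \<bullet> y = 0" using yz(2)[OF yz(1)] by (simp add: orthogonal_def)
    ultimately have "z = 0" by (simp add: yz(3) inner_add_right)
    with yz show ?thesis by simp
  qed
  obtain f :: "'n \<Rightarrow> nat" where f: "inj f"
    using finite_imp_inj_to_nat_seg[of "UNIV :: 'n set"] by auto
  let ?L = "{(i, j). f i < f j}"
  define \<delta> where "\<delta> i j = axis i 1 \<bullet> (axis j 1 :: real^'n)" for i j
  have \<delta>: "\<delta> i j = (if i = j then 1 else 0)" for i j by (simp add: \<delta>_def inner_axis_axis)
  have oo: "outer (W *v axis i 1) (axis j 1) \<bullet> outer (W *v axis i' 1) (axis j' 1) = \<delta> i i' * \<delta> j j'" for i j i' j'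
    by (simp only: inner_outer outer_vec inner_scaleR_right orthogonal_matrix_inner[OF W(1)] \<delta>_def inner_commute[of "axis j' 1"])
      (simp add: mult.commute)
  have KK: "K i j \<bullet> K i' j' = \<delta> i i' * \<delta> j j' - \<delta> i j' * \<delta> j i' - (\<delta> j i' * \<delta> i j' - \<delta> j j' * \<delta> i i')" for i j i' j'
    by (simp only: K_def inner_diff_left inner_diff_right oo)
  have K_orth: "K i j \<bullet> K i' j' = 0" if "f i < f j" "f i' < f j'" "(i, j) \<noteq> (i', j')" for i j i' j'
  proof -
    have "\<not> (i = i' \<and> j = j')" "\<not> (i = j' \<and> j = i')" using that by auto
    then have "\<delta> i i' * \<delta> j j' = 0" "\<delta> i j' * \<delta> j i' = 0" by (simp_all add: \<delta>)
    then show ?thesis unfolding KK by (auto simp: mult.commute)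
  qed
  have K_nz: "K i j \<bullet> K i j = 2" if "f i < f j" for i j
  proof -
    have "i \<noteq> j" using that by auto
    then show ?thesis by (simp add: KK \<delta>)
  qed
  let ?I = "(\<lambda>(i, j). K i j) ` ?L"
  have inj: "inj_on (\<lambda>(i, j). K i j) ?L"
  proof (rule inj_onI, clarify)
    fix i j i' j' assume *: "f i < f j" "f i' < f j'" "K i j = K i' j'"
    show "i = i' \<and> j = j'"
    proof (rule ccontr)
      assume "\<not> (i = i' \<and> j = j')"
      then have "K i j \<bullet> K i' j' = 0" using * by (intro K_orth) auto
      then show False using K_nz[OF *(1)] *(3) by simp
    qed
  qed
  have "independent ?I"
  proof (rule pairwise_orthogonal_independent)
    show "pairwise orthogonal ?I"
      unfolding pairwise_def orthogonal_def by (auto intro!: K_orth)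
    show "0 \<notin> ?I" using K_nz by force
  qed
  moreover have "?I \<subseteq> span B" using K_span by auto
  ultimately have "card ?I \<le> card B" using independent_span_bound[OF fin] by blast
  then have "card ?L \<le> card B" by (simp add: card_image[OF inj])
  then have "CARD('n) * CARD('n) + 2 \<le> 5 * CARD('n)"
    using card_ordered_pairs[OF f] card_B by linarith
  then have "\<not> 5 \<le> CARD('n)" using mult_le_mono1[of 5 "CARD('n)" "CARD('n)"] by linarith
  then show ?thesis by simp
qed

section \<open>The exceptional map\<close>

lemma sum_2_2: "sum f (UNIV :: (2 \<times> 2) set) = f (1, 1) + f (1, 2) + f (2, 1) + f (2, 2)"
proof -
  have "sum f (UNIV :: (2 \<times> 2) set) = (\<Sum>i\<in>UNIV. \<Sum>j\<in>UNIV. f (i, j))"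
    by (simp add: sum.cartesian_product)
  then show ?thesis by (simp add: sum_2 add.assoc)
qed

lemma all_2_2: "(\<forall>i :: 2 \<times> 2. P i) \<longleftrightarrow> P (1, 1) \<and> P (1, 2) \<and> P (2, 1) \<and> P (2, 2)"
  by (auto simp: split_paired_All forall_2)

lemma LL_entries:
  "LL X $ (1, 1) $ (1, 1) = (X $ (1, 1) $ (1, 1) + X $ (1, 2) $ (1, 2) + X $ (2, 1) $ (2, 1) + X $ (2, 2) $ (2, 2)) / 2"
  "LL X $ (1, 1) $ (1, 2) = (X $ (1, 1) $ (1, 2) - X $ (1, 2) $ (1, 1) + X $ (2, 1) $ (2, 2) - X $ (2, 2) $ (2, 1)) / 2"
  "LL X $ (1, 1) $ (2, 1) = (X $ (1, 1) $ (2, 1) - X $ (1, 2) $ (2, 2) - X $ (2, 1) $ (1, 1) + X $ (2, 2) $ (1, 2)) / 2"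
  "LL X $ (1, 1) $ (2, 2) = (X $ (1, 1) $ (2, 2) + X $ (1, 2) $ (2, 1) - X $ (2, 1) $ (1, 2) - X $ (2, 2) $ (1, 1)) / 2"
  "LL X $ (1, 2) $ (1, 1) = (- X $ (1, 1) $ (1, 2) + X $ (1, 2) $ (1, 1) + X $ (2, 1) $ (2, 2) - X $ (2, 2) $ (2, 1)) / 2"
  "LL X $ (1, 2) $ (1, 2) = (X $ (1, 1) $ (1, 1) + X $ (1, 2) $ (1, 2) - X $ (2, 1) $ (2, 1) - X $ (2, 2) $ (2, 2)) / 2"
  "LL X $ (1, 2) $ (2, 1) = (X $ (1, 1) $ (2, 2) + X $ (1, 2) $ (2, 1) + X $ (2, 1) $ (1, 2) + X $ (2, 2) $ (1, 1)) / 2"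
  "LL X $ (1, 2) $ (2, 2) = (- X $ (1, 1) $ (2, 1) + X $ (1, 2) $ (2, 2) - X $ (2, 1) $ (1, 1) + X $ (2, 2) $ (1, 2)) / 2"
  "LL X $ (2, 1) $ (1, 1) = (- X $ (1, 1) $ (2, 1) - X $ (1, 2) $ (2, 2) + X $ (2, 1) $ (1, 1) + X $ (2, 2) $ (1, 2)) / 2"
  "LL X $ (2, 1) $ (1, 2) = (- X $ (1, 1) $ (2, 2) + X $ (1, 2) $ (2, 1) + X $ (2, 1) $ (1, 2) - X $ (2, 2) $ (1, 1)) / 2"
  "LL X $ (2, 1) $ (2, 1) = (X $ (1, 1) $ (1, 1) - X $ (1, 2) $ (1, 2) + X $ (2, 1) $ (2, 1) - X $ (2, 2) $ (2, 2)) / 2"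
  "LL X $ (2, 1) $ (2, 2) = (X $ (1, 1) $ (1, 2) + X $ (1, 2) $ (1, 1) + X $ (2, 1) $ (2, 2) + X $ (2, 2) $ (2, 1)) / 2"
  "LL X $ (2, 2) $ (1, 1) = (- X $ (1, 1) $ (2, 2) + X $ (1, 2) $ (2, 1) - X $ (2, 1) $ (1, 2) + X $ (2, 2) $ (1, 1)) / 2"
  "LL X $ (2, 2) $ (1, 2) = (X $ (1, 1) $ (2, 1) + X $ (1, 2) $ (2, 2) + X $ (2, 1) $ (1, 1) + X $ (2, 2) $ (1, 2)) / 2"
  "LL X $ (2, 2) $ (2, 1) = (- X $ (1, 1) $ (1, 2) - X $ (1, 2) $ (1, 1) + X $ (2, 1) $ (2, 2) + X $ (2, 2) $ (2, 1)) / 2"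
  "LL X $ (2, 2) $ (2, 2) = (X $ (1, 1) $ (1, 1) - X $ (1, 2) $ (1, 2) - X $ (2, 1) $ (2, 1) + X $ (2, 2) $ (2, 2)) / 2"
  by (simp_all add: LL_def matrix_matrix_mult_def sum_2_2 B1_def B2_def B3_def C1_def C2_def C3_def
      kronecker_def mat2_def vector_2)

lemma linear_LL: "linear LL"
  by (rule linearI; unfold vec_eq_iff all_2_2) (simp_all add: LL_entries field_simps)

text \<open>Together with \<open>LL_inner\<close> this makes \<open>LL\<close> a symmetric
  involution, hence an isometry of the Frobenius norm.\<close>

lemma LL_LL: "LL (LL X) = X"
  unfolding vec_eq_iff all_2_2 by (simp add: LL_entries field_simps)

lemma LL_inner: "LL X \<bullet> Y = X \<bullet> LL Y"
  by (simp add: inner_matrix sum_2_2 LL_entries field_simps)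

type_synonym vec4 = "real ^ (2 \<times> 2)"

text \<open>The factor 2 cancels the \<open>1/2\<close> of \<open>LL\<close>, so that unit vectors
  give an orthogonal matrix.\<close>

definition LL_outer :: "vec4 \<Rightarrow> vec4 \<Rightarrow> mat4" where
  "LL_outer x y = 2 *\<^sub>R LL (outer x y)"

lemma LL_outer_entries:
  "LL_outer x y $ (1, 1) $ (1, 1) = x $ (1, 1) * y $ (1, 1) + x $ (1, 2) * y $ (1, 2) + x $ (2, 1) * y $ (2, 1) + x $ (2, 2) * y $ (2, 2)"
  "LL_outer x y $ (1, 1) $ (1, 2) = x $ (1, 1) * y $ (1, 2) - x $ (1, 2) * y $ (1, 1) + x $ (2, 1) * y $ (2, 2) - x $ (2, 2) * y $ (2, 1)"
  "LL_outer x y $ (1, 1) $ (2, 1) = x $ (1, 1) * y $ (2, 1) - x $ (1, 2) * y $ (2, 2) - x $ (2, 1) * y $ (1, 1) + x $ (2, 2) * y $ (1, 2)"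
  "LL_outer x y $ (1, 1) $ (2, 2) = x $ (1, 1) * y $ (2, 2) + x $ (1, 2) * y $ (2, 1) - x $ (2, 1) * y $ (1, 2) - x $ (2, 2) * y $ (1, 1)"
  "LL_outer x y $ (1, 2) $ (1, 1) = - x $ (1, 1) * y $ (1, 2) + x $ (1, 2) * y $ (1, 1) + x $ (2, 1) * y $ (2, 2) - x $ (2, 2) * y $ (2, 1)"
  "LL_outer x y $ (1, 2) $ (1, 2) = x $ (1, 1) * y $ (1, 1) + x $ (1, 2) * y $ (1, 2) - x $ (2, 1) * y $ (2, 1) - x $ (2, 2) * y $ (2, 2)"
  "LL_outer x y $ (1, 2) $ (2, 1) = x $ (1, 1) * y $ (2, 2) + x $ (1, 2) * y $ (2, 1) + x $ (2, 1) * y $ (1, 2) + x $ (2, 2) * y $ (1, 1)"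
  "LL_outer x y $ (1, 2) $ (2, 2) = - x $ (1, 1) * y $ (2, 1) + x $ (1, 2) * y $ (2, 2) - x $ (2, 1) * y $ (1, 1) + x $ (2, 2) * y $ (1, 2)"
  "LL_outer x y $ (2, 1) $ (1, 1) = - x $ (1, 1) * y $ (2, 1) - x $ (1, 2) * y $ (2, 2) + x $ (2, 1) * y $ (1, 1) + x $ (2, 2) * y $ (1, 2)"
  "LL_outer x y $ (2, 1) $ (1, 2) = - x $ (1, 1) * y $ (2, 2) + x $ (1, 2) * y $ (2, 1) + x $ (2, 1) * y $ (1, 2) - x $ (2, 2) * y $ (1, 1)"
  "LL_outer x y $ (2, 1) $ (2, 1) = x $ (1, 1) * y $ (1, 1) - x $ (1, 2) * y $ (1, 2) + x $ (2, 1) * y $ (2, 1) - x $ (2, 2) * y $ (2, 2)"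
  "LL_outer x y $ (2, 1) $ (2, 2) = x $ (1, 1) * y $ (1, 2) + x $ (1, 2) * y $ (1, 1) + x $ (2, 1) * y $ (2, 2) + x $ (2, 2) * y $ (2, 1)"
  "LL_outer x y $ (2, 2) $ (1, 1) = - x $ (1, 1) * y $ (2, 2) + x $ (1, 2) * y $ (2, 1) - x $ (2, 1) * y $ (1, 2) + x $ (2, 2) * y $ (1, 1)"
  "LL_outer x y $ (2, 2) $ (1, 2) = x $ (1, 1) * y $ (2, 1) + x $ (1, 2) * y $ (2, 2) + x $ (2, 1) * y $ (1, 1) + x $ (2, 2) * y $ (1, 2)"
  "LL_outer x y $ (2, 2) $ (2, 1) = - x $ (1, 1) * y $ (1, 2) - x $ (1, 2) * y $ (1, 1) + x $ (2, 1) * y $ (2, 2) + x $ (2, 2) * y $ (2, 1)"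
  "LL_outer x y $ (2, 2) $ (2, 2) = x $ (1, 1) * y $ (1, 1) - x $ (1, 2) * y $ (1, 2) - x $ (2, 1) * y $ (2, 1) + x $ (2, 2) * y $ (2, 2)"
  by (simp_all add: LL_outer_def LL_entries outer_def)

lemma transpose_mult_entry: "(transpose A ** B) $ i $ j =
    A $ (1, 1) $ i * B $ (1, 1) $ j + A $ (1, 2) $ i * B $ (1, 2) $ j +
    A $ (2, 1) $ i * B $ (2, 1) $ j + A $ (2, 2) $ i * B $ (2, 2) $ j" for A B :: mat4
  by (simp add: matrix_matrix_mult_def transpose_def sum_2_2)

lemma inner_2_2: "x \<bullet> y = x $ (1, 1) * y $ (1, 1) + x $ (1, 2) * y $ (1, 2) + x $ (2, 1) * y $ (2, 1) + x $ (2, 2) * y $ (2, 2)"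
  for x y :: "vec4"
  by (simp add: inner_vec_def sum_2_2)

lemma mat4_id_entries:
  "(mat 1 :: mat4) $ (1, 1) $ (1, 1) = 1"
  "(mat 1 :: mat4) $ (1, 1) $ (1, 2) = 0"
  "(mat 1 :: mat4) $ (1, 1) $ (2, 1) = 0"
  "(mat 1 :: mat4) $ (1, 1) $ (2, 2) = 0"
  "(mat 1 :: mat4) $ (1, 2) $ (1, 1) = 0"
  "(mat 1 :: mat4) $ (1, 2) $ (1, 2) = 1"
  "(mat 1 :: mat4) $ (1, 2) $ (2, 1) = 0"
  "(mat 1 :: mat4) $ (1, 2) $ (2, 2) = 0"
  "(mat 1 :: mat4) $ (2, 1) $ (1, 1) = 0"
  "(mat 1 :: mat4) $ (2, 1) $ (1, 2) = 0"
  "(mat 1 :: mat4) $ (2, 1) $ (2, 1) = 1"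
  "(mat 1 :: mat4) $ (2, 1) $ (2, 2) = 0"
  "(mat 1 :: mat4) $ (2, 2) $ (1, 1) = 0"
  "(mat 1 :: mat4) $ (2, 2) $ (1, 2) = 0"
  "(mat 1 :: mat4) $ (2, 2) $ (2, 1) = 0"
  "(mat 1 :: mat4) $ (2, 2) $ (2, 2) = 1"
  by (simp_all add: mat_def)

text \<open>On the diagonal this is Euler's four-square identity.\<close>

lemma LL_outer_orthogonal:
  "transpose (LL_outer x y) ** LL_outer x y = ((x \<bullet> x) * (y \<bullet> y)) *\<^sub>R mat 1"
  unfolding vec_eq_iff all_2_2 vector_scaleR_component real_scaleR_def mat4_id_entries
    transpose_mult_entry LL_outer_entries inner_2_2
  by (intro conjI; algebra)

text \<open>\<open>LL_outer x y\<close> factors as \<open>M\<^sub>x N\<^sub>y\<^sup>T\<close> where, for \<open>x \<bottom> x'\<close> and \<open>y \<bottom> y'\<close>, the matrices \<open>M\<^sub>x\<^sup>T M\<^sub>x\<^sub>'\<close> and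
  \<open>N\<^sub>y\<^sup>T N\<^sub>y\<^sub>'\<close> are imaginary quaternions acting from the left and from the right. They commute, which is why
  the commutator below vanishes for orthogonal arguments.\<close>

definition LL_commutator :: "vec4 \<Rightarrow> vec4 \<Rightarrow> vec4 \<Rightarrow> vec4 \<Rightarrow> mat4" where
  "LL_commutator x x' y y' = transpose (LL_outer x y) ** LL_outer x' y' - transpose (LL_outer x' y') ** LL_outer x y"

lemma axis_2_2_entries:
  "(axis (1, 1) 1 :: vec4) $ (1, 1) = 1"
  "(axis (1, 1) 1 :: vec4) $ (1, 2) = 0"
  "(axis (1, 1) 1 :: vec4) $ (2, 1) = 0"
  "(axis (1, 1) 1 :: vec4) $ (2, 2) = 0"
  by (simp_all add: axis_1_component)

lemma LL_commutator_eq: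
  "LL_commutator x x' y y' = (x \<bullet> x') *\<^sub>R LL_commutator (axis (1, 1) 1) (axis (1, 1) 1) y y' +
    (y \<bullet> y') *\<^sub>R LL_commutator x x' (axis (1, 1) 1) (axis (1, 1) 1)"
  unfolding vec_eq_iff all_2_2 vector_scaleR_component vector_add_component vector_minus_component real_scaleR_def
    LL_commutator_def transpose_mult_entry LL_outer_entries inner_2_2 axis_2_2_entries
    mult_1_left mult_1_right mult_zero_left mult_zero_right
  by (intro conjI; algebra)

text \<open>The cubic relation makes every singular value 0 or 1, so \<open>M \<bullet> M\<close>
  counts the ones and is the trace norm.\<close>

lemma partial_isometry_in_dual_ball:
  fixes M :: "real^'n^'n"
  assumes k: "k \<le> CARD('n)" and triple: "M ** transpose M ** M = M" and norm: "M \<bullet> M \<le> k"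
  shows "M \<in> dual_ball k"
proof -
  obtain U V d where svd: "orthogonal_matrix U" "orthogonal_matrix V" "M = U ** diag d ** V" "\<And>i. 0 \<le> d $ i"
    using singular_value_decomposition[of M] by blast
  note conj = orthogonal_conjugate_cancel[OF svd(1,2)]
  have "M ** transpose M ** M = U ** diag d ** (V ** transpose V) ** diag d ** (transpose U ** U) ** diag d ** V"
    by (simp add: svd(3) matrix_transpose_mul transpose_diag matrix_mul_assoc)
  also have "\<dots> = U ** (diag d ** diag d ** diag d) ** V"
    using svd by (simp add: orthogonal_matrixD matrix_mul_assoc)
  finally have "U ** (diag d ** diag d ** diag d) ** V = U ** diag d ** V"
    by (simp only: triple) (simp add: svd(3))
  then have "diag d ** diag d ** diag d = diag d" using conj by metis
  then have "(diag d ** diag d ** diag d) $ i $ i = diag d $ i $ i" for i by simp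
  then have cube: "d $ i * d $ i * d $ i = d $ i" for i by (simp add: mult_diag diag_component)
  have d01: "d $ i = 0 \<or> d $ i = 1" for i
  proof -
    have "d $ i * ((d $ i - 1) * (d $ i + 1)) = 0" using cube[of i] by (simp add: algebra_simps)
    moreover have "d $ i + 1 \<noteq> 0" using svd(4)[of i] by linarith
    ultimately show ?thesis by simp
  qed
  have "M \<bullet> M = diag d \<bullet> diag d"
    using inner_mult3[of M U "diag d" V] conj[of "diag d"] by (simp add: svd(3))
  also have "\<dots> = (\<Sum>i\<in>UNIV. d $ i * d $ i)" by (simp add: inner_diag diag_component)
  also have "\<dots> = (\<Sum>i\<in>UNIV. \<bar>d $ i\<bar>)" proof -
    have "d $ i * d $ i = \<bar>d $ i\<bar>" for i using d01[of i] by auto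
    then show ?thesis by simp
  qed
  finally have "(\<Sum>i\<in>UNIV. \<bar>d $ i\<bar>) \<le> k" using norm by simp
  moreover have "\<bar>d $ i\<bar> \<le> 1" for i using d01[of i] by auto
  ultimately show ?thesis unfolding svd(3) by (intro diag_in_dual_ball svd k)
qed

text \<open>The image is half the sum of two orthogonal matrices \<open>A\<close> and
  \<open>B\<close> with \<open>transpose A ** B\<close> symmetric, which makes it a partial
  isometry. Its rank 2 is read off from the Frobenius norm, which \<open>LL\<close>
  preserves.\<close>

lemma LL_outer_sum_in_dual_ball:
  assumes x: "norm x = 1" "norm x' = 1" "x \<bullet> x' = 0" and y: "norm y = 1" "norm y' = 1" "y \<bullet> y' = 0"
  shows "LL (outer x y + outer x' y') \<in> dual_ball 2"
proof (rule partial_isometry_in_dual_ball)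
  define A B where "A = LL_outer x y" and "B = LL_outer x' y'"
  have sum: "LL (outer x y + outer x' y') = (1/2) *\<^sub>R (A + B)"
    by (simp add: linear_add[OF linear_LL] A_def B_def LL_outer_def scaleR_add_right)
  have AA: "transpose A ** A = mat 1" and BB: "transpose B ** B = mat 1"
    using x y by (simp_all add: A_def B_def LL_outer_orthogonal norm_eq_1)
  then have AA': "A ** transpose A = mat 1" and BB': "B ** transpose B = mat 1"
    by (simp_all add: matrix_left_right_inverse)
  have "LL_commutator x x' y y' = 0" using x y by (subst LL_commutator_eq) simp
  then have comm: "transpose A ** B = transpose B ** A" by (simp add: LL_commutator_def A_def B_def)
  have 1: "A ** transpose B ** A = B"
  proof -
    have "A ** transpose B ** A = A ** (transpose A ** B)" by (simp add: comm matrix_mul_assoc)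
    then show ?thesis by (simp add: matrix_mul_assoc AA')
  qed
  have 2: "B ** transpose A ** B = A"
  proof -
    have "B ** transpose A ** B = B ** (transpose B ** A)" by (simp add: comm flip: matrix_mul_assoc)
    then show ?thesis by (simp add: matrix_mul_assoc BB')
  qed
  have 3: "A ** transpose B ** B = A" "B ** transpose A ** A = B"
    by (simp_all add: AA BB flip: matrix_mul_assoc)
  have 4: "A ** transpose A ** A = A" "A ** transpose A ** B = B" "B ** transpose B ** A = A" "B ** transpose B ** B = B"
    by (simp_all add: AA' BB')
  \<comment> \<open>Of the eight triple products four equal \<open>A\<close> and four equal
    \<open>B\<close>.\<close>
  have "(A + B) ** transpose (A + B) ** (A + B) = 4 *\<^sub>R (A + B)"
    unfolding linear_add[OF linear_transpose] matrix_add_ldistrib matrix_mult_add_rdistrib 1 2 3 4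
    by (simp add: vec_eq_iff)
  then show "LL (outer x y + outer x' y') ** transpose (LL (outer x y + outer x' y')) ** LL (outer x y + outer x' y') =
      LL (outer x y + outer x' y')"
    unfolding sum by (simp add: linear_cmul[OF linear_transpose] matrix_scalar_ac scalar_matrix_assoc[symmetric])
  have "LL (outer x y + outer x' y') \<bullet> LL (outer x y + outer x' y') =
      (outer x y + outer x' y') \<bullet> (outer x y + outer x' y')"
    by (simp add: LL_inner LL_LL)
  also have "\<dots> = 2"
    using x y by (simp add: inner_add_left inner_outer outer_vec matrix_vector_mult_add_rdistrib
        inner_add_right inner_commute norm_eq_1)
  finally show "LL (outer x y + outer x' y') \<bullet> LL (outer x y + outer x' y') \<le> real 2" by simp
qed simp

text \<open>A supporting functional of \<open>LL X\<close> can be taken as a sum of two outer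
  products with orthonormal factors, which \<open>LL\<close> keeps in the dual ball. Symmetry of
  \<open>LL\<close> moves it to \<open>X\<close>, and the involution gives the reverse
  inequality.\<close>

lemma ky_fan_LL: "ky_fan 2 (LL X) = ky_fan 2 X"
proof -
  have le: "ky_fan 2 (LL X) \<le> ky_fan 2 X" for X
  proof -
    have card: "2 \<le> CARD(2 \<times> 2)" by simp
    obtain P Q S where PQ: "orthogonal_matrix P" "orthogonal_matrix Q" "card S = 2"
      "P ** diag (ind S) ** Q \<in> dual_ball 2" "(P ** diag (ind S) ** Q) \<bullet> LL X = ky_fan 2 (LL X)"
      using ky_fan_attained[OF card, of "LL X"] by blast
    obtain i j where ij: "S = {i, j}" "i \<noteq> j" using PQ(3) by (auto simp: card_2_iff)
    let ?x = "\<lambda>i. P *v axis i 1" and ?y = "\<lambda>i. axis i 1 v* Q"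
    have Z: "P ** diag (ind S) ** Q = outer (?x i) (?y i) + outer (?x j) (?y j)"
      by (simp add: ij(1) ind_pair[OF ij(2)] mult_diag_add mult_diag_axis)
    have "?x i \<bullet> ?x j = 0" "?y i \<bullet> ?y j = 0"
      using ij orthogonal_matrix_inner[OF PQ(1)] orthogonal_matrix_inner[of "transpose Q" "axis i 1" "axis j 1"] PQ(2)
      by (simp_all add: inner_axis_axis)
    then have "LL (P ** diag (ind S) ** Q) \<in> dual_ball 2"
      unfolding Z by (intro LL_outer_sum_in_dual_ball norm_orthogonal_axis PQ)
    from dual_ballD[OF this, of X] show ?thesis by (simp add: PQ(5) LL_inner)
  qed
  from le[of X] le[of "LL X"] show ?thesis by (simp add: LL_LL)
qed

section \<open>Transport of \<open>LL\<close> to an index type with four elements\<close>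

lemma reindex_reindex: "reindex g (reindex f A) = reindex (f \<circ> g) A"
  by (simp add: reindex_def vec_eq_iff)

lemma linear_reindex: "linear (reindex f)"
  by (rule linearI) (simp_all add: reindex_def vec_eq_iff)

context
  fixes f :: "'m::finite \<Rightarrow> 'n::finite"
  assumes f: "bij f"
begin

lemma reindex_mult: "reindex f (A ** B) = reindex f A ** reindex f B"
  by (simp add: reindex_def matrix_matrix_mult_def vec_eq_iff)
    (intro allI, rule sum.reindex_bij_betw[OF f, symmetric])

lemma reindex_transpose: "reindex f (transpose A) = transpose (reindex f A)"
  by (simp add: reindex_def transpose_def vec_eq_iff)

lemma reindex_id: "reindex f (mat 1) = mat 1"
  using f by (simp add: reindex_def mat_def vec_eq_iff bij_is_inj inj_eq)

lemma orthogonal_matrix_reindex: "orthogonal_matrix A \<Longrightarrow> orthogonal_matrix (reindex f A)"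
  by (simp add: orthogonal_matrix reindex_id flip: reindex_mult reindex_transpose)

lemma ky_fan_reindex: "ky_fan k (reindex f A) = ky_fan k A"
proof -
  obtain U V d where svd: "orthogonal_matrix U" "orthogonal_matrix V" "A = U ** diag d ** V"
    using singular_value_decomposition[of A] by blast
  have "reindex f (diag d) = diag (\<chi> i. d $ f i)"
    using f by (simp add: reindex_def diag_def vec_eq_iff bij_is_inj inj_eq)
  then have "reindex f A = reindex f U ** diag (\<chi> i. d $ f i) ** reindex f V"
    by (simp add: svd(3) reindex_mult)
  moreover have "image_mset (\<lambda>i. \<bar>(\<chi> i. d $ f i) $ i\<bar>) (mset_set UNIV) = image_mset (\<lambda>i. \<bar>d $ i\<bar>) (mset_set UNIV)"
  proof -
    have "image_mset f (mset_set UNIV) = mset_set UNIV"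
      using f by (simp add: image_mset_mset_set bij_is_inj bij_is_surj)
    then have "image_mset (\<lambda>i. \<bar>d $ i\<bar>) (mset_set UNIV) = image_mset (\<lambda>i. \<bar>d $ i\<bar>) (image_mset f (mset_set UNIV))" by simp
    then show ?thesis by (simp add: multiset.map_comp comp_def)
  qed
  ultimately show ?thesis
    using svd by (simp add: ky_fan_def singular_values_diag orthogonal_matrix_reindex)
qed

end

context
  fixes e :: "'n::finite \<Rightarrow> 2 \<times> 2"
  assumes e: "bij e"
begin

lemma linear_LL_on: "linear (LL_on e)"
proof -
  have "LL_on e = reindex e \<circ> LL \<circ> reindex (inv e)" by (simp add: LL_on_def fun_eq_iff)
  then show ?thesis by (simp add: linear_compose linear_reindex linear_LL)
qed

lemma LL_on_LL_on: "LL_on e (LL_on e X) = X"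
proof -
  have "reindex (inv e) (reindex e Y) = Y" for Y
    using e by (simp add: reindex_reindex bij_is_surj surj_iff[THEN iffD1]) (simp add: reindex_def)
  moreover have "reindex e (reindex (inv e) Y) = Y" for Y
    using e by (simp add: reindex_reindex bij_is_inj) (simp add: reindex_def)
  ultimately show ?thesis by (simp add: LL_on_def LL_LL)
qed

lemma ky_fan_LL_on: "ky_fan 2 (LL_on e X) = ky_fan 2 X"
  using e by (simp add: LL_on_def ky_fan_reindex ky_fan_LL bij_imp_bij_inv)

text \<open>One rank one matrix with a multiple of an orthogonal matrix as image is enough for the
  normalisation below; renumbering keeps axis vectors axis vectors.\<close>

lemma LL_on_rank_one:
  obtains W where "orthogonal_matrix W" "LL_on e (outer (axis i 1) (axis i 1)) = (1/2) *\<^sub>R W"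
proof
  have "reindex (inv e) (outer (axis i 1) (axis i 1)) = outer (axis (e i) 1) (axis (e i) (1::real))"
  proof -
    have "inv e p = i \<longleftrightarrow> p = e i" for p using e by (metis bij_inv_eq_iff)
    then show ?thesis by (simp add: reindex_def outer_axis vec_eq_iff)
  qed
  then show "LL_on e (outer (axis i 1) (axis i 1)) = (1/2) *\<^sub>R reindex e (LL_outer (axis (e i) 1) (axis (e i) 1))"
    by (simp add: LL_on_def LL_outer_def linear_cmul[OF linear_reindex])
  show "orthogonal_matrix (reindex e (LL_outer (axis (e i) 1) (axis (e i) 1)))"
    by (intro orthogonal_matrix_reindex e) (simp add: orthogonal_matrix LL_outer_orthogonal inner_axis_axis)
qed

text \<open>Composing \<open>S\<close> with an orthogonal \<open>P\<close> that makes one orthogonal image a multiple of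
  \<open>LL_on e (outer a a)\<close>, the isometry \<open>LL_on e \<circ> P \<circ> S\<close> has one, hence only, rank one images.\<close>

lemma orthogonal_type_form:
  fixes S :: "real^'n^'n \<Rightarrow> real^'n^'n"
  assumes n: "CARD('n) = 4" and lin: "linear S" and bij: "bij S"
    and iso: "\<And>A. ky_fan 2 (S A) = ky_fan 2 A"
    and orth: "\<And>u v. \<exists>r W. orthogonal_matrix W \<and> S (outer u v) = r *\<^sub>R W"
  shows "\<exists>\<gamma>>0. \<exists>U V P. orthogonal_matrix U \<and> orthogonal_matrix V \<and> orthogonal_matrix P \<and>
      (S = (\<lambda>X. \<gamma> *\<^sub>R (P ** LL_on e (U ** X ** V))) \<or>
       S = (\<lambda>X. \<gamma> *\<^sub>R (P ** LL_on e (U ** transpose X ** V))))"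
proof -
  define a :: "real^'n" where "a = axis undefined 1"
  have a: "norm a = 1" by (simp add: a_def)
  obtain r W where W: "orthogonal_matrix W" "S (outer a a) = r *\<^sub>R W" using orth by blast
  obtain W0 where W0: "orthogonal_matrix W0" "LL_on e (outer a a) = (1/2) *\<^sub>R W0"
    using LL_on_rank_one unfolding a_def by metis
  have k: "2 \<le> (2::nat)" "2 \<le> CARD('n)" "3 \<le> CARD('n)" using n by simp_all
  define P where "P = W0 ** transpose W"
  have P: "orthogonal_matrix P" using W W0 by (simp add: P_def orthogonal_matrix_mul)
  define R where "R X = LL_on e (P ** S X)" for X
  have lin_R: "linear R"
    unfolding R_def using linear_compose[OF linear_compose[OF lin matrix_mul_linear_left[of P]] linear_LL_on]
    by (simp add: comp_def)
  have iso_R: "ky_fan 2 (R X) = ky_fan 2 X" for X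
    using ky_fan_orthogonal[OF P orthogonal_matrix_id, of 2 "S X"] by (simp add: R_def ky_fan_LL_on iso)
  have "inj R"
    unfolding linear_injective_0[OF lin_R] using iso_R k by (metis ky_fan_eq_0 ky_fan_zero one_le_numeral)
  then have bij_R: "bij R" using linear_injective_imp_surjective[OF lin_R] by (simp add: bij_def)
  have Raa: "R (outer a a) = (2 * r) *\<^sub>R outer a a"
  proof -
    have "P ** S (outer a a) = r *\<^sub>R (W0 ** (transpose W ** W))"
      by (simp add: P_def W matrix_scalar_ac matrix_mul_assoc flip: scalar_matrix_assoc)
    also have "\<dots> = (2 * r) *\<^sub>R LL_on e (outer a a)"
      using W by (simp add: orthogonal_matrixD W0)
    finally show ?thesis by (simp add: R_def linear_cmul[OF linear_LL_on] LL_on_LL_on)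
  qed
  have rank_one: "\<exists>x y. R (outer u v) = outer x y" for u v
  proof -
    \<comment> \<open>\<open>R\<close> maps \<open>outer a a\<close> to a nonzero multiple of
      itself, which kills vectors orthogonal to \<open>a\<close>; a nonzero multiple of an
      orthogonal matrix kills none.\<close>
    have "\<not> (\<forall>u v. \<exists>r W. orthogonal_matrix W \<and> R (outer u v) = r *\<^sub>R W)"
    proof
      assume "\<forall>u v. \<exists>r W. orthogonal_matrix W \<and> R (outer u v) = r *\<^sub>R W"
      then obtain t Q where Q: "orthogonal_matrix Q" "R (outer a a) = t *\<^sub>R Q" by blast
      obtain z where z: "norm z = 1" "a \<bullet> z = 0" using exists_unit_orthogonal k by blast
      have "t *\<^sub>R (Q *v z) = 0"
        using arg_cong[OF Q(2), of "\<lambda>M. M *v z"] z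
        by (simp add: Raa outer_vec scaleR_matrix_vector_assoc[symmetric])
      moreover have "norm (Q *v z) = 1" using z by (simp add: orthogonal_matrix_norm[OF Q(1)])
      ultimately have "t = 0" by auto
      then have "outer a a = 0" using Q(2) \<open>inj R\<close> by (simp add: linear_injective_0[OF lin_R])
      then show False using a by (auto simp: outer_eq_0_iff)
    qed
    then show ?thesis using isometry_rank_one_dichotomy[OF k(3,1,2) lin_R bij_R iso_R] by blast
  qed
  have "ky_fan 2 (R A + R B) = ky_fan 2 (R A) + ky_fan 2 (R B)"
    if "ky_fan 2 (A + B) = ky_fan 2 A + ky_fan 2 B" for A B
    using that iso_R by (metis linear_add[OF lin_R])
  from rank_one_to_rank_one_form[OF k(1,2) lin_R bij_R this rank_one]
  obtain \<gamma> U V where form: "\<gamma> > 0" "orthogonal_matrix U" "orthogonal_matrix V"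
    "R = (\<lambda>X. \<gamma> *\<^sub>R (U ** X ** V)) \<or> R = (\<lambda>X. \<gamma> *\<^sub>R (U ** transpose X ** V))"
    by blast
  have S: "S X = transpose P ** LL_on e (R X)" for X
    using P by (simp add: R_def LL_on_LL_on matrix_mul_assoc orthogonal_matrixD)
  have "S = (\<lambda>X. \<gamma> *\<^sub>R (transpose P ** LL_on e (U ** X ** V))) \<or>
      S = (\<lambda>X. \<gamma> *\<^sub>R (transpose P ** LL_on e (U ** transpose X ** V)))"
    using form(4)
  proof (rule disj_forward)
    show "S = (\<lambda>X. \<gamma> *\<^sub>R (transpose P ** LL_on e (U ** X ** V)))" if "R = (\<lambda>X. \<gamma> *\<^sub>R (U ** X ** V))"
      by (rule ext) (simp add: S that linear_cmul[OF linear_LL_on] matrix_scalar_ac flip: scalar_matrix_assoc)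
    show "S = (\<lambda>X. \<gamma> *\<^sub>R (transpose P ** LL_on e (U ** transpose X ** V)))" if "R = (\<lambda>X. \<gamma> *\<^sub>R (U ** transpose X ** V))"
      by (rule ext) (simp add: S that linear_cmul[OF linear_LL_on] matrix_scalar_ac flip: scalar_matrix_assoc)
  qed
  then show ?thesis using form P by (intro exI[of _ \<gamma>] conjI exI[of _ U] exI[of _ V] exI[of _ "transpose P"]) auto
qed

end

text \<open>The exceptional form holds for every numbering \<open>e\<close>, with matrices that may
  depend on it; since \<open>CARD('n) = 4\<close>, numberings exist and the claim is not
  empty.\<close>

theorem corollary3p2:
  fixes T :: "real ^ 'n ^ 'n \<Rightarrow> real ^ 'n ^ 'n" and k :: nat
  assumes "1 < k" and "k \<le> CARD('n)"
    and "linear T" and "bij T"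
    and "\<And>A B. ky_fan k (A + B) = ky_fan k A + ky_fan k B
           \<Longrightarrow> ky_fan k (T A + T B) = ky_fan k (T A) + ky_fan k (T B)"
  shows "(\<exists>(c::real) S. linear S \<and> (\<forall>X. ky_fan k (S X) = ky_fan k X) \<and> T = (\<lambda>X. c *\<^sub>R S X))
    \<and> ((\<exists>\<gamma>>0. \<exists>U V. orthogonal_matrix U \<and> orthogonal_matrix V \<and>
           (T = (\<lambda>X. \<gamma> *\<^sub>R (U ** X ** V)) \<or> T = (\<lambda>X. \<gamma> *\<^sub>R (U ** transpose X ** V))))
       \<or> (k = 2 \<and> CARD('n) = 4 \<and>
          (\<forall>e :: 'n \<Rightarrow> 2 \<times> 2. bij e \<longrightarrow>
             (\<exists>\<gamma>>0. \<exists>U V P. orthogonal_matrix U \<and> orthogonal_matrix V \<and> orthogonal_matrix P \<and>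
                (T = (\<lambda>X. \<gamma> *\<^sub>R (P ** LL_on e (U ** X ** V)))
                 \<or> T = (\<lambda>X. \<gamma> *\<^sub>R (P ** LL_on e (U ** transpose X ** V))))))))"
proof (cases "k + 2 \<le> CARD('n)")
  case False
  have k: "2 \<le> k" "k \<le> CARD('n)" "CARD('n) \<le> k + 1" using assms False by simp_all
  have "\<exists>x y. T (outer u v) = outer x y" for u v
    by (rule scale_rank_one[OF assms(3)]) (rule rank_one_image[OF k assms(3-5)])
  from rank_one_to_rank_one_form[OF k(1,2) assms(3-5) this]
  obtain \<gamma> U V where form: "\<gamma> > 0" "orthogonal_matrix U" "orthogonal_matrix V"
    "T = (\<lambda>X. \<gamma> *\<^sub>R (U ** X ** V)) \<or> T = (\<lambda>X. \<gamma> *\<^sub>R (U ** transpose X ** V))"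
    by blast
  have "\<exists>c S. linear S \<and> (\<forall>X. ky_fan k (S X) = ky_fan k X) \<and> T = (\<lambda>X. c *\<^sub>R S X)"
    using form(4)
  proof
    assume "T = (\<lambda>X. \<gamma> *\<^sub>R (U ** X ** V))"
    then show ?thesis
      using form by (intro exI[of _ \<gamma>] exI[of _ "\<lambda>X. U ** X ** V"]) (simp add: matrix_mul_linear_both ky_fan_orthogonal)
  next
    assume "T = (\<lambda>X. \<gamma> *\<^sub>R (U ** transpose X ** V))"
    moreover have "linear (\<lambda>X. U ** transpose X ** V)"
      using linear_compose[OF linear_transpose matrix_mul_linear_both[of U V]] by (simp add: comp_def)
    ultimately show ?thesis
      using form by (intro exI[of _ \<gamma>] exI[of _ "\<lambda>X. U ** transpose X ** V"]) (simp add: ky_fan_orthogonal ky_fan_transpose)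
  qed
  with form show ?thesis by blast
next
  case True
  have k: "2 \<le> k" "k \<le> CARD('n)" "3 \<le> CARD('n)" "1 \<le> k" using assms True by simp_all
  \<comment> \<open>For linear \<open>T\<close>, the hypothesis says that \<open>N\<close> is
    additive on every pair on which \<open>ky_fan k\<close> is.\<close>
  define N where "N A = ky_fan k (T A)" for A
  have N_add: "N (A + B) = N A + N B" if "ky_fan k (A + B) = ky_fan k A + ky_fan k B" for A B
    using assms(5)[OF that] by (simp add: N_def linear_add[OF assms(3)])
  have N_scale: "N (t *\<^sub>R A) = \<bar>t\<bar> * N A" for t A
    using k by (simp add: N_def linear_cmul[OF assms(3)] ky_fan_scaleR)
  obtain c where c: "\<And>A. N A = c * ky_fan k A"
    using additive_norm_multiple[OF k(1) True N_add N_scale] by blast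
  have "c > 0"
  proof -
    define a :: "real ^ 'n" where "a = axis undefined 1"
    have a: "norm a = 1" by (simp add: a_def)
    then have "T (outer a a) \<noteq> 0"
      using linear_outer_nonzero[OF assms(3) bij_is_inj[OF assms(4)], of a a] by force
    then have "ky_fan k (T (outer a a)) \<noteq> 0" using k ky_fan_eq_0 by blast
    then have "ky_fan k (T (outer a a)) > 0" using k ky_fan_nonneg by (metis order_le_less)
    then show ?thesis using c[of "outer a a"] a k by (simp add: N_def ky_fan_outer)
  qed
  define S where "S X = (1 / c) *\<^sub>R T X" for X
  have T: "T = (\<lambda>X. c *\<^sub>R S X)" using \<open>c > 0\<close> by (simp add: S_def fun_eq_iff)
  have lin: "linear S" unfolding S_def by (rule linear_compose_scale_right[OF assms(3)])
  have iso: "ky_fan k (S X) = ky_fan k X" for X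
    using c[of X] \<open>c > 0\<close> k by (simp add: S_def N_def ky_fan_scaleR)
  have "inj S"
    unfolding linear_injective_0[OF lin] using iso k by (metis ky_fan_eq_0 ky_fan_zero)
  then have bij: "bij S" using linear_injective_imp_surjective[OF lin] by (simp add: bij_def)
  have first: "\<exists>c S. linear S \<and> (\<forall>X. ky_fan k (S X) = ky_fan k X) \<and> T = (\<lambda>X. c *\<^sub>R S X)"
    using lin iso T by blast
  show ?thesis
    using isometry_rank_one_dichotomy[OF k(3,1,2) lin bij iso]
  proof
    assume "\<forall>u v. \<exists>x y. S (outer u v) = outer x y"
    then have "\<exists>x y. T (outer u v) = outer x y" for u v by (metis T outer_scaleR_left)
    from rank_one_to_rank_one_form[OF k(1,2) assms(3-5) this] first show ?thesis by blast
  next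
    assume orth: "\<forall>u v. \<exists>r W. orthogonal_matrix W \<and> S (outer u v) = r *\<^sub>R W"
    then have "CARD('n) \<le> 4" using orthogonal_type_dimension[OF k(1,2) lin bij iso] by blast
    \<comment> \<open>\<open>4 \<le> k + 2 \<le> n \<le> 4\<close>.\<close>
    then have n: "CARD('n) = 4" "k = 2" using True k by simp_all
    have "\<exists>\<gamma>>0. \<exists>U V P. orthogonal_matrix U \<and> orthogonal_matrix V \<and> orthogonal_matrix P \<and>
        (T = (\<lambda>X. \<gamma> *\<^sub>R (P ** LL_on e (U ** X ** V))) \<or>
         T = (\<lambda>X. \<gamma> *\<^sub>R (P ** LL_on e (U ** transpose X ** V))))"
      if e: "bij e" for e :: "'n \<Rightarrow> 2 \<times> 2"
    proof -
      obtain \<gamma> U V P where form: "\<gamma> > 0" "orthogonal_matrix U" "orthogonal_matrix V" "orthogonal_matrix P"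
        "S = (\<lambda>X. \<gamma> *\<^sub>R (P ** LL_on e (U ** X ** V))) \<or>
         S = (\<lambda>X. \<gamma> *\<^sub>R (P ** LL_on e (U ** transpose X ** V)))"
        using orthogonal_type_form[OF e n(1) lin bij iso[unfolded n(2)]] orth by blast
      have "c * \<gamma> > 0" using form \<open>c > 0\<close> by simp
      moreover have "T = (\<lambda>X. (c * \<gamma>) *\<^sub>R (P ** LL_on e (U ** X ** V))) \<or>
         T = (\<lambda>X. (c * \<gamma>) *\<^sub>R (P ** LL_on e (U ** transpose X ** V)))"
        using form(5) by (auto simp: T)
      ultimately show ?thesis using form by blast
    qed
    with first n show ?thesis by blast
  qed
qed

end
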